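(* Consider a sequence of regression models $\mathbf{y}=X_p\boldsymbol{\beta}_p+\boldsymbol{\epsilon}$ with nearly-orthogonal design under structural constraints, with $r=\mathrm{rank}(X_p)\to\infty$. Let $\gamma>0$ and $c(\gamma)=8(\gamma+3/4)^2$, and assume that for some constant $c>0$ the priors satisfy, for all $k=1,\ldots,r$ with $m(k)>0$, $$\min\{m(k)^{-c},e^{-ck}\}\le\pi(k)\le m(k)e^{-c(\gamma)k}.$$ Then the corresponding MAP estimator $X_p\hat{\boldsymbol{\beta}}_{\hat M}$ is asymptotically at least nearly-minimax, up to a $\ln p_0$-factor, simultaneously over all $\mathfrak{M}_{p_0}$, $1\le p_0\le r$; that is, there is a constant $C>0$ such that for all sufficiently large $r$ and all $1\le p_0\le r$, $$\sup_{\boldsymbol{\beta}_M:\,M\in\mathfrak{M}_{p_0}}E\|X_p\hat{\boldsymbol{\beta}}_{\hat M}-X_p\boldsymbol{\beta}_M\|^2\le C\max(1,\ln p_0)\ \inf_{\tilde{\mathbf{y}}}\sup_{\boldsymbol{\beta}_M:\,M\in\mathfrak{M}_{p_0}}E\|\tilde{\mathbf{y}}-X_p\boldsymbol{\beta}_M\|^2,$$ where the infimum is over all estimators $\tilde{\mathbf{y}}$ of the mean vector.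
   Context: Asymptotic setup: a sequence indexed by the sample size $n$ of models $\mathbf{y}=X_p\boldsymbol{\beta}_p+\boldsymbol{\epsilon}$, where $p=p_n$ may grow with $n$ (possibly $p>n$), $X_p\in\mathbb{R}^{n\times p}$ with columns (predictors) $X_1,\ldots,X_p$, $\boldsymbol{\epsilon}\sim N(\mathbf{0},\sigma^2I_n)$, with $\sigma^2>0$ known and not depending on $n,p$; $r=r_n=\mathrm{rank}(X_p)\to\infty$, and any $r$ columns of $X_p$ are linearly independent. The index $n$ is suppressed; the admissible models, the $m(k)$ and the priors $\pi$ also depend on $n$, while $\gamma$ and $c$ do not. A model $M$ is a subset of the predictors, encoded by $D_M=\mathrm{diag}(\mathbf{d}_M)$, $d_{Mj}=1$ if $X_j\in M$ and $0$ otherwise; its size is $|M|=\mathrm{tr}(D_M)$. The least squares estimator for $M$ is $\hat{\boldsymbol{\beta}}_M=(D_MX_p'X_pD_M)^+D_MX_p'\mathbf{y}$. Structural constraints: a fixed known set of admissible models, restricted to sizes at most $r$. $\mathcal{M}_k$ is the set of admissible models of size $k$, $m(k)=\mathrm{card}(\mathcal{M}_k)$. The null model is admissible, so $m(0)=1$. All models of size $r$ are identified with a single saturated model, represented by a fixed set of $r$ columns, so $m(r)=1$. $\mathfrak{M}_{p_0}=\bigcup_{k=0}^{p_0}\mathcal{M}_k$. For a model $M$, $\boldsymbol{\beta}_M\in\mathbb{R}^p$ denotes a coefficient vector with $\beta_{Mj}\neq0$ iff $X_j\in M$; suprema are over all such vectors with $M\in\mathfrak{M}_{p_0}$, and expectations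 are under $\mathbf{y}=X_p\boldsymbol{\beta}_M+\boldsymbol{\epsilon}$. The prior $\pi(k)$, $k=0,\ldots,r$, is a probability distribution on model sizes with $\pi(k)=0$ iff $m(k)=0$. The MAP model $\hat M$ is a minimizer over admissible $M$ of $$\|\mathbf{y}-X_p\hat{\boldsymbol{\beta}}_M\|^2+2\sigma^2(1+1/\gamma)\ln\left\{m(|M|)\pi(|M|)^{-1}(1+\gamma)^{|M|/2}\right\}.$$ Sparse eigenvalue ratios: $\tau_p[k]=\phi_{min}[k]/\phi_{max}[k]$, where $\phi_{min}[k]$ and $\phi_{max}[k]$ are the minimum and maximum of $\|X_p\boldsymbol{\beta}\|^2/\|\boldsymbol{\beta}\|^2$ over $\boldsymbol{\beta}$ with between $1$ and $k$ nonzero entries. The design is nearly-orthogonal if the sequence $\tau_p[r]$ is bounded away from zero.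
   Formalization: The inequality is claimed only for those p_0 for which the class 𝔐_{p_0} contains some non-null admissible model; if it contains only the null model, the minimax risk is 0 while the MAP risk is positive, so the inequality as stated fails. *)

theory Defs
  imports "HOL-Probability.Probability" "Jordan_Normal_Form.DL_Rank"
begin

(* Dimensions vary along the sequence of models, so vectors and matrices are those of
   Jordan_Normal_Form; the notation shared with HOL-Analysis is switched off. *)
hide_type (open) Finite_Cartesian_Product.vec
hide_const (open) Finite_Cartesian_Product.vec Finite_Cartesian_Product.mat
no_notation vec_nth (infixl \<open>$\<close> 90)
no_notation inner (infix \<open>\<bullet>\<close> 70)


subsection \<open>Linear algebra\<close>

definition sqnorm :: "real vec \<Rightarrow> real" where
  "sqnorm v = v \<bullet> v"

definition mat_rank :: "real mat \<Rightarrow> nat" where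
  "mat_rank X = vec_space.rank (dim_row X) X"

(* Injectivity excludes repeated columns, which the set of columns cannot see. *)
definition indep_columns :: "real mat \<Rightarrow> nat set \<Rightarrow> bool" where
  "indep_columns X S \<longleftrightarrow> inj_on (col X) S \<and>
     LinearCombinations.module.lin_indpt class_ring (module_vec TYPE(real) (dim_row X)) (col X ` S)"

(* The four Penrose equations. *)
definition is_pinv :: "real mat \<Rightarrow> real mat \<Rightarrow> bool" where
  "is_pinv A B \<longleftrightarrow> B \<in> carrier_mat (dim_col A) (dim_row A) \<and>
     A * B * A = A \<and> B * A * B = B \<and>
     transpose_mat (A * B) = A * B \<and> transpose_mat (B * A) = B * A"

definition pinv :: "real mat \<Rightarrow> real mat" where
  "pinv A = (THE B. is_pinv A B)"


subsection \<open>Gaussian noise and estimators\<close>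

definition borel_vec :: "nat \<Rightarrow> real vec measure" where
  "borel_vec n = vimage_algebra (carrier_vec n) (\<lambda>v. \<lambda>i\<in>{..<n}. v $ i)
     (\<Pi>\<^sub>M i\<in>{..<n}. (borel :: real measure))"

(* The law N(0, sigma^2 I_n). *)
definition gaussian_noise :: "nat \<Rightarrow> real \<Rightarrow> real vec measure" where
  "gaussian_noise n \<sigma> = distr (\<Pi>\<^sub>M i\<in>{..<n}. density lborel (\<lambda>x. ennreal (normal_density 0 \<sigma> x)))
     (borel_vec n) (\<lambda>z. vec n z)"

(* Expected squared error of g under y = X beta + epsilon, as a value in [0, infinity]. *)
definition risk :: "real mat \<Rightarrow> real \<Rightarrow> (real vec \<Rightarrow> real vec) \<Rightarrow> real vec \<Rightarrow> ennreal" where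
  "risk X \<sigma> g \<beta> = (\<integral>\<^sup>+ \<epsilon>. ennreal (sqnorm (g (X *\<^sub>v \<beta> + \<epsilon>) - X *\<^sub>v \<beta>)) \<partial>gaussian_noise (dim_row X) \<sigma>)"


subsection \<open>Models\<close>

(* A model is the set of column indices of its predictors. *)
definition model_diag :: "real mat \<Rightarrow> nat set \<Rightarrow> real mat" where
  "model_diag X M = mat_diag (dim_col X) (\<lambda>j. if j \<in> M then 1 else 0)"

definition lse :: "real mat \<Rightarrow> nat set \<Rightarrow> real vec \<Rightarrow> real vec" where
  "lse X M y =
     (let D = model_diag X M
      in (pinv (D * transpose_mat X * X * D) * D * transpose_mat X) *\<^sub>v y)"

definition num_models :: "nat set set \<Rightarrow> nat \<Rightarrow> nat" where
  "num_models A k = card {M \<in> A. card M = k}"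

definition models_upto :: "nat set set \<Rightarrow> nat \<Rightarrow> nat set set" where
  "models_upto A k = {M \<in> A. card M \<le> k}"

(* The one model of maximal size is the representative of the saturated model. *)
definition admissible_models :: "real mat \<Rightarrow> nat set set \<Rightarrow> bool" where
  "admissible_models X A \<longleftrightarrow>
     (\<forall>M\<in>A. M \<subseteq> {..<dim_col X} \<and> card M \<le> mat_rank X) \<and>
     {} \<in> A \<and> num_models A (mat_rank X) = 1"

definition size_prior :: "real mat \<Rightarrow> nat set set \<Rightarrow> nat pmf \<Rightarrow> bool" where
  "size_prior X A \<pi> \<longleftrightarrow> set_pmf \<pi> \<subseteq> {..mat_rank X} \<and>
     (\<forall>k\<le>mat_rank X. pmf \<pi> k = 0 \<longleftrightarrow> num_models A k = 0)"

definition vec_support :: "real vec \<Rightarrow> nat set" where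
  "vec_support \<beta> = {j. j < dim_vec \<beta> \<and> \<beta> $ j \<noteq> 0}"

definition model_coeffs :: "real mat \<Rightarrow> nat set set \<Rightarrow> real vec set" where
  "model_coeffs X \<M> = {\<beta> \<in> carrier_vec (dim_col X). vec_support \<beta> \<in> \<M>}"

definition max_risk :: "real mat \<Rightarrow> real \<Rightarrow> nat set set \<Rightarrow> (real vec \<Rightarrow> real vec) \<Rightarrow> ennreal" where
  "max_risk X \<sigma> \<M> g = (SUP \<beta>\<in>model_coeffs X \<M>. risk X \<sigma> g \<beta>)"

definition minimax_risk :: "real mat \<Rightarrow> real \<Rightarrow> nat set set \<Rightarrow> ennreal" where
  "minimax_risk X \<sigma> \<M> =
     (INF g\<in>measurable (borel_vec (dim_row X)) (borel_vec (dim_row X)). max_risk X \<sigma> \<M> g)"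


subsection \<open>MAP model selection\<close>

definition map_criterion ::
  "real mat \<Rightarrow> nat set set \<Rightarrow> nat pmf \<Rightarrow> real \<Rightarrow> real \<Rightarrow> real vec \<Rightarrow> nat set \<Rightarrow> real" where
  "map_criterion X A \<pi> \<sigma> \<gamma> y M =
     sqnorm (y - X *\<^sub>v lse X M y) +
     2 * \<sigma>\<^sup>2 * (1 + 1 / \<gamma>) *
       ln (real (num_models A (card M)) * inverse (pmf \<pi> (card M)) *
           (1 + \<gamma>) powr (real (card M) / 2))"

(* Ties may be broken arbitrarily, and no measurability of the selection is required. *)
definition is_map_selection ::
  "real mat \<Rightarrow> nat set set \<Rightarrow> nat pmf \<Rightarrow> real \<Rightarrow> real \<Rightarrow> (real vec \<Rightarrow> nat set) \<Rightarrow> bool" where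
  "is_map_selection X A \<pi> \<sigma> \<gamma> sel \<longleftrightarrow>
     (\<forall>y\<in>carrier_vec (dim_row X).
        is_arg_min (map_criterion X A \<pi> \<sigma> \<gamma> y) (\<lambda>M. M \<in> A) (sel y))"

definition map_estimator :: "real mat \<Rightarrow> (real vec \<Rightarrow> nat set) \<Rightarrow> real vec \<Rightarrow> real vec" where
  "map_estimator X sel y = X *\<^sub>v lse X (sel y) y"


subsection \<open>Sparse eigenvalues\<close>

definition sparse_rayleigh :: "real mat \<Rightarrow> nat \<Rightarrow> real set" where
  "sparse_rayleigh X k = {sqnorm (X *\<^sub>v \<beta>) / sqnorm \<beta> | \<beta>.
     \<beta> \<in> carrier_vec (dim_col X) \<and> 1 \<le> card (vec_support \<beta>) \<and> card (vec_support \<beta>) \<le> k}"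

(* For k \<ge> 1 and at least one column both extrema are attained. *)
definition phi_min :: "real mat \<Rightarrow> nat \<Rightarrow> real" where
  "phi_min X k = Inf (sparse_rayleigh X k)"

definition phi_max :: "real mat \<Rightarrow> nat \<Rightarrow> real" where
  "phi_max X k = Sup (sparse_rayleigh X k)"

definition sparse_ratio :: "real mat \<Rightarrow> nat \<Rightarrow> real" where
  "sparse_ratio X k = phi_min X k / phi_max X k"

(* Designs of rank 0 are skipped: sparse_rayleigh is then empty. *)
definition nearly_orthogonal :: "(nat \<Rightarrow> real mat) \<Rightarrow> bool" where
  "nearly_orthogonal X \<longleftrightarrow>
     (\<exists>\<delta>>0. \<forall>n. 1 \<le> mat_rank (X n) \<longrightarrow> \<delta> \<le> sparse_ratio (X n) (mat_rank (X n)))"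

definition c_gamma :: "real \<Rightarrow> real" where
  "c_gamma \<gamma> = 8 * (\<gamma> + 3 / 4)\<^sup>2"

end

theory Submission
  imports Defs
begin

text \<open>
  With \<open>m(k)\<close> admissible models of size \<open>k\<close>, both sides are compared with the rate
  \<open>\<sigma>\<^sup>2 (k + ln m(k))\<close>: the MAP estimator never does worse up to a constant, and for \<open>2 k \<le> r\<close> no
  estimator improves on it in the worst case by more than a factor of order \<open>max 1 (ln k)\<close>. Every bound holds for each fixed design, with
  constants that depend only on \<open>\<gamma>\<close>, \<open>c\<close> and the lower bound \<open>\<delta>\<close> for the sparse eigenvalue ratio.

  \<^emph>\<open>Upper bound.\<close> Comparing the criterion at the selected model \<open>M\<close> with its value at a model whose
  columns span a space containing the true mean \<open>\<mu>\<close> leaves the noise term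
  \<open>2 \<langle>f - \<mu>, \<epsilon>\<rangle>\<close>, where the fit \<open>f\<close> lies in the span of the columns in \<open>M\<close>. As \<open>f - \<mu>\<close> lies in a
  space of dimension at most \<open>|M| + 1\<close> that depends on \<open>M\<close> only, this term is at most a fraction of
  the loss plus a chi-square variable with that many degrees of freedom
  (\<open>map_oracle_inequality\<close>). The latter is absorbed by the penalty: its exponential moment, damped by
  the exponential of the penalty, is at most a constant times the prior mass \<open>\<pi>(|M|) / m(|M|)\<close> of
  \<open>M\<close>, and these masses sum to at most one over all models (\<open>penalised_exponential_moment\<close>, \<open>map_risk_bound\<close>). The
  lower bound on the prior turns the penalty of the comparison model into the rate
  (\<open>penalty_bounds\<close>).

  \<^emph>\<open>Lower bound.\<close> If many means are pairwise separated but close to a common centre compared with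
  the logarithm of their number, no estimator identifies them all, so its risk is of the order of
  the squared separation (\<open>testing_lower_bound\<close>). Coefficients on a single model of size \<open>k\<close> that take
  two values along a Varshamov--Gilbert family of subsets give \<open>\<sigma>\<^sup>2 k\<close>
  (\<open>minimax_risk_ge_dimension\<close>). For \<open>ln m(k)\<close>, equal coefficients are placed on each of a family of
  models that is separated at some scale \<open>d\<close> and contained in a ball of radius \<open>2 d\<close>. Chaining over
  the dyadic scales up to \<open>2 k\<close> finds such a family whose log-cardinality is at least \<open>ln m(k)\<close>
  divided by the number of scales, and this division is where the factor \<open>ln k\<close> is lost
  (\<open>exists_local_packing\<close>, \<open>minimax_risk_ge_ln_card\<close>).

  The difference of two such coefficient vectors has up to \<open>2 k\<close> nonzero entries, whereas sparse
  eigenvalues are controlled up to \<open>r\<close> entries only. For \<open>2 k > r\<close> the MAP criterion is therefore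
  compared with the saturated model, whose columns span all means and whose rate is \<open>\<sigma>\<^sup>2 r \<le> 2 \<sigma>\<^sup>2 k\<close>, so
  that the bound \<open>\<sigma>\<^sup>2 k\<close> suffices. The zero mean is compared with any nonempty model of the class.
\<close>

section \<open>Gaussian noise and exponential moments\<close>

definition dot :: "nat \<Rightarrow> (nat \<Rightarrow> real) \<Rightarrow> (nat \<Rightarrow> real) \<Rightarrow> real" where
  "dot n x y = (\<Sum>i<n. x i * y i)"

abbreviation normal_law :: "real \<Rightarrow> real measure" where
  "normal_law \<sigma> \<equiv> density lborel (\<lambda>x. ennreal (normal_density 0 \<sigma> x))"

abbreviation normal_prod :: "nat \<Rightarrow> real \<Rightarrow> (nat \<Rightarrow> real) measure" where
  "normal_prod n \<sigma> \<equiv> (\<Pi>\<^sub>M i\<in>{..<n}. normal_law \<sigma>)"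

text \<open>
  The density of \<open>N(a, \<sigma>\<^sup>2)\<close> with respect to \<open>N(0, \<sigma>\<^sup>2)\<close>.
\<close>
definition tilt :: "real \<Rightarrow> real \<Rightarrow> real \<Rightarrow> real" where
  "tilt \<sigma> a z = exp (a * z / \<sigma>\<^sup>2 - a\<^sup>2 / (2 * \<sigma>\<^sup>2))"

lemma tilt_pos: "tilt \<sigma> a z > 0"
  by (simp add: tilt_def)

lemma tilt_measurable [measurable]: "tilt \<sigma> a \<in> borel_measurable borel"
  unfolding tilt_def[abs_def] by measurable

lemma normal_density_tilt:
  assumes "\<sigma> > 0"
  shows "normal_density 0 \<sigma> x * tilt \<sigma> a x = normal_density a \<sigma> x"
proof -
  have "- (x - 0)\<^sup>2 / (2 * \<sigma>\<^sup>2) + (a * x / \<sigma>\<^sup>2 - a\<^sup>2 / (2 * \<sigma>\<^sup>2)) = - (x - a)\<^sup>2 / (2 * \<sigma>\<^sup>2)"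
    using assms by (simp add: field_simps power2_eq_square)
  then show ?thesis
    unfolding normal_density_def tilt_def by (simp add: exp_add[symmetric])
qed

lemma density_normal_law_tilt:
  assumes "\<sigma> > 0"
  shows "density (normal_law \<sigma>) (\<lambda>z. ennreal (tilt \<sigma> a z)) =
    density lborel (\<lambda>x. ennreal (normal_density a \<sigma> x))"
  by (subst density_density_eq)
     (auto simp: ennreal_mult[symmetric] tilt_pos less_imp_le normal_density_tilt[OF assms])

lemma distr_normal_law_shift:
  assumes "\<sigma> > 0"
  shows "distr (normal_law \<sigma>) borel (\<lambda>z. a + z) =
    density (normal_law \<sigma>) (\<lambda>z. ennreal (tilt \<sigma> a z))"
proof -
  interpret prob_space "normal_law \<sigma>"
    by (rule prob_space_normal_density[OF assms])
  have "distributed (normal_law \<sigma>) lborel (\<lambda>x. x) (normal_density 0 \<sigma>)"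
    by (auto simp: distributed_def distr_id2)
  from normal_density_affine[OF this assms, of 1 a]
  have "distr (normal_law \<sigma>) lborel (\<lambda>z. a + z) = density lborel (normal_density a \<sigma>)"
    by (auto simp: distributed_def)
  moreover have "distr (normal_law \<sigma>) borel (\<lambda>z. a + z) = distr (normal_law \<sigma>) lborel (\<lambda>z. a + z)"
    by (rule distr_cong) auto
  ultimately show ?thesis
    using density_normal_law_tilt[OF assms] by simp
qed

lemma nn_integral_tilt:
  assumes "\<sigma> > 0"
  shows "(\<integral>\<^sup>+ z. ennreal (tilt \<sigma> a z) \<partial>normal_law \<sigma>) = 1"
proof -
  have "(\<integral>\<^sup>+ z. ennreal (tilt \<sigma> a z) \<partial>normal_law \<sigma>)
      = emeasure (density (normal_law \<sigma>) (\<lambda>z. ennreal (tilt \<sigma> a z))) UNIV"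
    by (subst emeasure_density) auto
  also have "\<dots> = 1"
    unfolding density_normal_law_tilt[OF assms]
    using prob_space.emeasure_space_1[OF prob_space_normal_density[OF assms, of a]] by simp
  finally show ?thesis .
qed

lemma sets_normal_prod [measurable_cong, simp]:
  "sets (normal_prod n \<sigma>) = sets (\<Pi>\<^sub>M i\<in>{..<n}. (borel :: real measure))"
  by (rule sets_PiM_cong) auto

lemma space_normal_prod: "space (normal_prod n \<sigma>) = PiE {..<n} (\<lambda>_. UNIV)"
  by (simp add: space_PiM)

lemma product_sigma_finite_normal_law:
  assumes "\<sigma> > 0"
  shows "product_sigma_finite (\<lambda>i::nat. normal_law \<sigma>)"
proof -
  interpret prob_space "normal_law \<sigma>"
    by (rule prob_space_normal_density[OF assms])
  show ?thesis by unfold_locales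
qed

lemma prob_space_normal_prod: "\<sigma> > 0 \<Longrightarrow> prob_space (normal_prod n \<sigma>)"
  by (intro prob_space_PiM prob_space_normal_density)

lemma dot_measurable [measurable]:
  "(\<lambda>z. dot n a z) \<in> borel_measurable (\<Pi>\<^sub>M i\<in>{..<n}. (borel :: real measure))"
  unfolding dot_def by measurable

lemma prod_tilt:
  "(\<Prod>i<n. tilt \<sigma> (a i) (z i)) = exp (dot n a z / \<sigma>\<^sup>2 - dot n a a / (2 * \<sigma>\<^sup>2))"
  by (simp add: tilt_def exp_sum[symmetric] dot_def sum_subtractf sum_divide_distrib power2_eq_square)

lemma nn_integral_exp_dot:
  assumes "\<sigma> > 0"
  shows "(\<integral>\<^sup>+ z. ennreal (exp (dot n a z / \<sigma>\<^sup>2)) \<partial>normal_prod n \<sigma>) =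
    ennreal (exp (dot n a a / (2 * \<sigma>\<^sup>2)))"
proof -
  interpret product_sigma_finite "\<lambda>i::nat. normal_law \<sigma>"
    by (rule product_sigma_finite_normal_law[OF assms])
  have 1: "ennreal (exp (dot n a z / \<sigma>\<^sup>2)) =
     ennreal (exp (dot n a a / (2 * \<sigma>\<^sup>2))) * (\<Prod>i<n. ennreal (tilt \<sigma> (a i) (z i)))" for z
    by (simp add: prod_ennreal tilt_pos less_imp_le prod_tilt ennreal_mult[symmetric] exp_add[symmetric])
  have "(\<integral>\<^sup>+ z. (\<Prod>i<n. ennreal (tilt \<sigma> (a i) (z i))) \<partial>normal_prod n \<sigma>) = 1"
    by (subst product_nn_integral_prod) (auto simp: nn_integral_tilt[OF assms])
  then show ?thesis
    unfolding 1 by (subst nn_integral_cmult) (auto simp: sets_normal_prod)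
qed

text \<open>
  The Cameron--Martin formula in finite dimension. Both sides agree on boxes with the product of the
  one-dimensional laws, whose density is \<^const>\<open>tilt\<close>.
\<close>
lemma distr_normal_prod_shift:
  assumes \<sigma>: "\<sigma> > 0"
  shows "distr (normal_prod n \<sigma>) (\<Pi>\<^sub>M i\<in>{..<n}. borel) (\<lambda>z. \<lambda>i\<in>{..<n}. a i + z i) =
    density (normal_prod n \<sigma>) (\<lambda>z. ennreal (exp (dot n a z / \<sigma>\<^sup>2 - dot n a a / (2 * \<sigma>\<^sup>2))))"
    (is "?L = ?R")
proof -
  let ?N = "\<lambda>i. density (normal_law \<sigma>) (\<lambda>z. ennreal (tilt \<sigma> (a i) z))"
  interpret N: product_sigma_finite "\<lambda>i::nat. normal_law \<sigma>"
    by (rule product_sigma_finite_normal_law[OF \<sigma>])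
  have "prob_space (?N i)" for i
    unfolding density_normal_law_tilt[OF \<sigma>] by (rule prob_space_normal_density[OF \<sigma>])
  then interpret T: product_sigma_finite ?N
    by (intro product_sigma_finite.intro prob_space_imp_sigma_finite)
  have setsT: "sets (PiM {..<n} ?N) = sets (\<Pi>\<^sub>M i\<in>{..<n}. (borel :: real measure))"
    by (rule sets_PiM_cong) auto
  have sh: "(\<lambda>z. \<lambda>i\<in>{..<n}. a i + z i) \<in> normal_prod n \<sigma> \<rightarrow>\<^sub>M (\<Pi>\<^sub>M i\<in>{..<n}. borel)"
    by measurable
  have "?L = PiM {..<n} ?N"
  proof (rule T.PiM_eqI)
    fix B assume B: "\<And>i. i \<in> {..<n} \<Longrightarrow> B i \<in> sets (?N i)"
    have Bb: "Pi\<^sub>E {..<n} B \<in> sets (\<Pi>\<^sub>M i\<in>{..<n}. (borel :: real measure))"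
      using B by (intro sets_PiM_I_finite) auto
    have "emeasure ?L (Pi\<^sub>E {..<n} B) =
      emeasure (normal_prod n \<sigma>) ((\<lambda>z. \<lambda>i\<in>{..<n}. a i + z i) -` Pi\<^sub>E {..<n} B \<inter> space (normal_prod n \<sigma>))"
      using sh Bb by (rule emeasure_distr)
    also have "(\<lambda>z. \<lambda>i\<in>{..<n}. a i + z i) -` Pi\<^sub>E {..<n} B \<inter> space (normal_prod n \<sigma>) =
       Pi\<^sub>E {..<n} (\<lambda>i. (\<lambda>z. a i + z) -` B i)"
      by (auto simp: space_normal_prod PiE_iff Pi_iff restrict_def extensional_def)
    also have "emeasure (normal_prod n \<sigma>) \<dots> = (\<Prod>i<n. emeasure (normal_law \<sigma>) ((\<lambda>z. a i + z) -` B i))"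
    proof (rule N.emeasure_PiM)
      fix i assume "i \<in> {..<n}"
      then have [measurable]: "B i \<in> sets borel" using B by simp
      show "(\<lambda>z. a i + z) -` B i \<in> sets (normal_law \<sigma>)"
        using measurable_sets[of "\<lambda>z. a i + z" borel borel "B i"] by simp
    qed simp
    also have "\<dots> = (\<Prod>i<n. emeasure (?N i) (B i))"
      using B by (intro prod.cong refl)
        (auto simp: distr_normal_law_shift[OF \<sigma>, symmetric] emeasure_distr)
    finally show "emeasure ?L (Pi\<^sub>E {..<n} B) = (\<Prod>i<n. emeasure (?N i) (B i))" .
  qed (simp_all add: setsT)
  also have "PiM {..<n} ?N = ?R"
  proof (rule T.PiM_eqI[symmetric])
    fix B assume B: "\<And>i. i \<in> {..<n} \<Longrightarrow> B i \<in> sets (?N i)"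
    have Bb: "Pi\<^sub>E {..<n} B \<in> sets (\<Pi>\<^sub>M i\<in>{..<n}. (borel :: real measure))"
      using B by (intro sets_PiM_I_finite) auto
    have "emeasure ?R (Pi\<^sub>E {..<n} B) = (\<integral>\<^sup>+ z. ennreal (exp (dot n a z / \<sigma>\<^sup>2 - dot n a a / (2 * \<sigma>\<^sup>2)))
        * indicator (Pi\<^sub>E {..<n} B) z \<partial>normal_prod n \<sigma>)"
      using Bb by (subst emeasure_density) auto
    also have "\<dots> = (\<integral>\<^sup>+ z. (\<Prod>i<n. ennreal (tilt \<sigma> (a i) (z i)) * indicator (B i) (z i)) \<partial>normal_prod n \<sigma>)"
    proof (rule nn_integral_cong)
      fix z assume z: "z \<in> space (normal_prod n \<sigma>)"
      have "indicator (Pi\<^sub>E {..<n} B) z = (\<Prod>i<n. indicator (B i) (z i) :: ennreal)"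
        using z by (auto simp: space_normal_prod PiE_iff indicator_def Pi_iff prod_zero_iff)
      then show "ennreal (exp (dot n a z / \<sigma>\<^sup>2 - dot n a a / (2 * \<sigma>\<^sup>2))) * indicator (Pi\<^sub>E {..<n} B) z =
          (\<Prod>i<n. ennreal (tilt \<sigma> (a i) (z i)) * indicator (B i) (z i))"
        by (simp add: prod.distrib prod_ennreal tilt_pos less_imp_le prod_tilt)
    qed
    also have "\<dots> = (\<Prod>i<n. \<integral>\<^sup>+ z. ennreal (tilt \<sigma> (a i) z) * indicator (B i) z \<partial>normal_law \<sigma>)"
      using B by (intro N.product_nn_integral_prod) auto
    also have "\<dots> = (\<Prod>i<n. emeasure (?N i) (B i))"
      using B by (intro prod.cong refl) (auto simp: emeasure_density[of _ "normal_law \<sigma>"])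
    finally show "emeasure ?R (Pi\<^sub>E {..<n} B) = (\<Prod>i<n. emeasure (?N i) (B i))" .
  qed (simp_all add: setsT)
  finally show ?thesis .
qed

lemma nn_integral_normal_prod_shift:
  assumes \<sigma>: "\<sigma> > 0" and h [measurable]: "h \<in> borel_measurable (\<Pi>\<^sub>M i\<in>{..<n}. borel)"
  shows "(\<integral>\<^sup>+ z. h (\<lambda>i\<in>{..<n}. a i + z i) \<partial>normal_prod n \<sigma>) =
    (\<integral>\<^sup>+ z. ennreal (exp (dot n a z / \<sigma>\<^sup>2 - dot n a a / (2 * \<sigma>\<^sup>2))) * h z \<partial>normal_prod n \<sigma>)"
proof -
  have "(\<integral>\<^sup>+ z. h (\<lambda>i\<in>{..<n}. a i + z i) \<partial>normal_prod n \<sigma>) =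
    (\<integral>\<^sup>+ z. h z \<partial>distr (normal_prod n \<sigma>) (\<Pi>\<^sub>M i\<in>{..<n}. borel) (\<lambda>z. \<lambda>i\<in>{..<n}. a i + z i))"
    by (subst nn_integral_distr) auto
  also have "\<dots> = (\<integral>\<^sup>+ z. ennreal (exp (dot n a z / \<sigma>\<^sup>2 - dot n a a / (2 * \<sigma>\<^sup>2))) * h z \<partial>normal_prod n \<sigma>)"
    unfolding distr_normal_prod_shift[OF \<sigma>] by (subst nn_integral_density) auto
  finally show ?thesis .
qed

lemma nn_integral_exp_linear_normal:
  "(\<integral>\<^sup>+ g. ennreal (exp (b * g)) \<partial>normal_law 1) = ennreal (exp (b\<^sup>2 / 2))"
proof -
  have "ennreal (exp (b * g)) = ennreal (exp (b\<^sup>2 / 2)) * ennreal (tilt 1 b g)" for g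
    by (simp add: tilt_def ennreal_mult[symmetric] exp_add[symmetric])
  then show ?thesis
    using nn_integral_tilt[of 1 b] by (simp add: nn_integral_cmult)
qed

lemma nn_integral_exp_square_normal:
  assumes "0 \<le> s" "2 * s < 1"
  shows "(\<integral>\<^sup>+ g. ennreal (exp (s * g\<^sup>2)) \<partial>normal_law 1) = ennreal (1 / sqrt (1 - 2 * s))"
proof -
  define q where "q = 1 / sqrt (1 - 2 * s)"
  have q: "q > 0" using assms by (simp add: q_def)
  have q2: "q\<^sup>2 = 1 / (1 - 2 * s)"
    using assms by (simp add: q_def power_divide)
  have eq: "normal_density 0 1 g * exp (s * g\<^sup>2) = q * normal_density 0 q g" for g
  proof -
    have "- g\<^sup>2 / 2 + s * g\<^sup>2 = - g\<^sup>2 / (2 * q\<^sup>2)"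
      using assms by (simp add: q2 field_simps)
    then have "exp (- g\<^sup>2 / 2) * exp (s * g\<^sup>2) = exp (- g\<^sup>2 / (2 * q\<^sup>2))"
      by (simp add: exp_add[symmetric])
    moreover have "sqrt (2 * pi * q\<^sup>2) = sqrt (2 * pi) * q"
      using q by (simp add: real_sqrt_mult)
    ultimately show ?thesis
      using q by (simp add: normal_density_def)
  qed
  have "(\<integral>\<^sup>+ g. ennreal (exp (s * g\<^sup>2)) \<partial>normal_law 1) =
     (\<integral>\<^sup>+ g. ennreal q * ennreal (normal_density 0 q g) \<partial>lborel)"
    using q by (subst nn_integral_density) (auto simp: ennreal_mult[symmetric] eq)
  also have "\<dots> = ennreal q * (\<integral>\<^sup>+ g. ennreal (normal_density 0 q g) \<partial>lborel)"
    by (rule nn_integral_cmult) auto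
  also have "(\<integral>\<^sup>+ g. ennreal (normal_density 0 q g) \<partial>lborel) = 1"
    using prob_space.emeasure_space_1[OF prob_space_normal_density[OF q, of 0]]
    by (simp add: emeasure_density)
  finally show ?thesis by (simp add: q_def)
qed

lemma dot_commute: "dot n x y = dot n y x"
  by (simp add: dot_def mult.commute)

lemma dot_add_left: "dot n (\<lambda>i. x i + y i) z = dot n x z + dot n y z"
  by (simp add: dot_def algebra_simps sum.distrib)

lemma dot_scale_left: "dot n (\<lambda>i. c * x i) z = c * dot n x z"
  by (simp add: dot_def sum_distrib_left mult.assoc)

definition orthonormal :: "nat \<Rightarrow> nat \<Rightarrow> (nat \<Rightarrow> nat \<Rightarrow> real) \<Rightarrow> bool" where
  "orthonormal n d u \<longleftrightarrow> (\<forall>a<d. \<forall>b<d. dot n (u a) (u b) = (if a = b then 1 else 0))"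

text \<open>
  The last square is removed by writing \<open>exp (t\<^sup>2 / 2)\<close> as the average of \<open>exp (t g)\<close> over a standard
  normal \<open>g\<close> and exchanging the integrals. This moves a multiple of the last basis vector into the
  linear term, which is why a linear term \<open>v\<close> orthogonal to the basis is carried along; it avoids
  any appeal to rotation invariance of the Gaussian law.
\<close>
lemma nn_integral_exp_chi_square_aux:
  assumes \<sigma>: "\<sigma> > 0" and s: "0 \<le> s" "2 * s < 1"
  shows "orthonormal n d u \<Longrightarrow> (\<And>a. a < d \<Longrightarrow> dot n (u a) v = 0) \<Longrightarrow>
    (\<integral>\<^sup>+ z. ennreal (exp (s * (\<Sum>a<d. (dot n (u a) z)\<^sup>2) / \<sigma>\<^sup>2 + dot n v z / \<sigma>\<^sup>2)) \<partial>normal_prod n \<sigma>) =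
    ennreal ((1 / sqrt (1 - 2 * s)) ^ d * exp (dot n v v / (2 * \<sigma>\<^sup>2)))"
proof (induction d arbitrary: v)
  case 0
  then show ?case by (simp add: nn_integral_exp_dot[OF \<sigma>])
next
  case (Suc d)
  interpret G: prob_space "normal_law 1" by (rule prob_space_normal_density) simp
  interpret P: prob_space "normal_prod n \<sigma>" by (rule prob_space_normal_prod[OF \<sigma>])
  interpret pair_sigma_finite "normal_law 1" "normal_prod n \<sigma>" by unfold_locales
  have on: "orthonormal n d u" and ud: "dot n (u d) (u d) = 1" "dot n (u d) v = 0"
    and ua: "\<And>a. a < d \<Longrightarrow> dot n (u a) (u d) = 0" "\<And>a. a < d \<Longrightarrow> dot n (u a) v = 0"
    using Suc.prems by (auto simp: orthonormal_def)
  define w where "w g = (\<lambda>i. v i + (sqrt (2 * s) * \<sigma> * g) * u d i)" for g :: real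
  define E where "E z = s * (\<Sum>a<d. (dot n (u a) z)\<^sup>2) / \<sigma>\<^sup>2 + dot n v z / \<sigma>\<^sup>2" for z
  have w_dot: "dot n (w g) z = dot n v z + sqrt (2 * s) * \<sigma> * g * dot n (u d) z" for g z
    unfolding w_def dot_add_left dot_scale_left by simp
  have ww: "dot n (w g) (w g) = dot n v v + 2 * s * \<sigma>\<^sup>2 * g\<^sup>2" for g
  proof -
    have "dot n (w g) (w g) = dot n v (w g) + sqrt (2 * s) * \<sigma> * g * dot n (u d) (w g)"
      by (rule w_dot)
    also have "dot n v (w g) = dot n v v"
      using ud w_dot[of g v] by (simp add: dot_commute)
    also have "dot n (u d) (w g) = sqrt (2 * s) * \<sigma> * g"
      using ud w_dot[of g "u d"] by (simp add: dot_commute[of n v] dot_commute[of n "u d" "w g"])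
    finally show ?thesis
      using s by (simp add: power2_eq_square algebra_simps flip: real_sqrt_mult)
  qed
  have hs: "ennreal (exp (s * (\<Sum>a<Suc d. (dot n (u a) z)\<^sup>2) / \<sigma>\<^sup>2 + dot n v z / \<sigma>\<^sup>2)) =
      (\<integral>\<^sup>+ g. ennreal (exp (s * (\<Sum>a<d. (dot n (u a) z)\<^sup>2) / \<sigma>\<^sup>2 + dot n (w g) z / \<sigma>\<^sup>2)) \<partial>normal_law 1)" for z
  proof -
    let ?b = "sqrt (2 * s) * dot n (u d) z / \<sigma>"
    have b2: "?b\<^sup>2 / 2 = s * (dot n (u d) z)\<^sup>2 / \<sigma>\<^sup>2"
      using s by (simp add: power_mult_distrib power_divide)
    have e: "exp (s * (\<Sum>a<d. (dot n (u a) z)\<^sup>2) / \<sigma>\<^sup>2 + dot n (w g) z / \<sigma>\<^sup>2) = exp (E z) * exp (?b * g)" for g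
      using \<sigma> by (simp add: E_def w_dot exp_add[symmetric] field_simps power2_eq_square)
    have "(\<integral>\<^sup>+ g. ennreal (exp (s * (\<Sum>a<d. (dot n (u a) z)\<^sup>2) / \<sigma>\<^sup>2 + dot n (w g) z / \<sigma>\<^sup>2)) \<partial>normal_law 1)
       = ennreal (exp (E z)) * (\<integral>\<^sup>+ g. ennreal (exp (?b * g)) \<partial>normal_law 1)"
      unfolding e by (subst nn_integral_cmult[symmetric]) (auto simp: ennreal_mult)
    also have "\<dots> = ennreal (exp (E z + ?b\<^sup>2 / 2))"
      unfolding nn_integral_exp_linear_normal by (simp add: ennreal_mult[symmetric] exp_add[symmetric])
    also have "E z + ?b\<^sup>2 / 2 = s * (\<Sum>a<Suc d. (dot n (u a) z)\<^sup>2) / \<sigma>\<^sup>2 + dot n v z / \<sigma>\<^sup>2"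
      unfolding b2 E_def by (simp add: algebra_simps add_divide_distrib)
    finally show ?thesis by simp
  qed
  have "(\<integral>\<^sup>+ z. ennreal (exp (s * (\<Sum>a<Suc d. (dot n (u a) z)\<^sup>2) / \<sigma>\<^sup>2 + dot n v z / \<sigma>\<^sup>2)) \<partial>normal_prod n \<sigma>)
     = (\<integral>\<^sup>+ z. \<integral>\<^sup>+ g. ennreal (exp (s * (\<Sum>a<d. (dot n (u a) z)\<^sup>2) / \<sigma>\<^sup>2 + dot n (w g) z / \<sigma>\<^sup>2)) \<partial>normal_law 1 \<partial>normal_prod n \<sigma>)"
    unfolding hs ..
  also have "\<dots> = (\<integral>\<^sup>+ g. \<integral>\<^sup>+ z. ennreal (exp (s * (\<Sum>a<d. (dot n (u a) z)\<^sup>2) / \<sigma>\<^sup>2 + dot n (w g) z / \<sigma>\<^sup>2)) \<partial>normal_prod n \<sigma> \<partial>normal_law 1)"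
    unfolding w_dot by (rule Fubini') measurable
  also have "\<dots> = (\<integral>\<^sup>+ g. ennreal ((1 / sqrt (1 - 2 * s)) ^ d * exp (dot n v v / (2 * \<sigma>\<^sup>2))) * ennreal (exp (s * g\<^sup>2)) \<partial>normal_law 1)"
  proof (rule nn_integral_cong)
    fix g :: real
    have "dot n (u a) (w g) = 0" if "a < d" for a
      using ua[OF that] w_dot[of g "u a"] by (simp add: dot_commute)
    from Suc.IH[OF on this]
    have "(\<integral>\<^sup>+ z. ennreal (exp (s * (\<Sum>a<d. (dot n (u a) z)\<^sup>2) / \<sigma>\<^sup>2 + dot n (w g) z / \<sigma>\<^sup>2)) \<partial>normal_prod n \<sigma>) =
      ennreal ((1 / sqrt (1 - 2 * s)) ^ d * exp (dot n (w g) (w g) / (2 * \<sigma>\<^sup>2)))" by simp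
    also have "dot n (w g) (w g) / (2 * \<sigma>\<^sup>2) = dot n v v / (2 * \<sigma>\<^sup>2) + s * g\<^sup>2"
      using \<sigma> by (simp add: ww field_simps)
    finally show "(\<integral>\<^sup>+ z. ennreal (exp (s * (\<Sum>a<d. (dot n (u a) z)\<^sup>2) / \<sigma>\<^sup>2 + dot n (w g) z / \<sigma>\<^sup>2)) \<partial>normal_prod n \<sigma>) =
      ennreal ((1 / sqrt (1 - 2 * s)) ^ d * exp (dot n v v / (2 * \<sigma>\<^sup>2))) * ennreal (exp (s * g\<^sup>2))"
      using s by (simp add: exp_add ennreal_mult[symmetric] mult.assoc)
  qed
  also have "\<dots> = ennreal ((1 / sqrt (1 - 2 * s)) ^ d * exp (dot n v v / (2 * \<sigma>\<^sup>2))) * ennreal (1 / sqrt (1 - 2 * s))"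
    by (subst nn_integral_cmult) (auto simp: nn_integral_exp_square_normal[OF s])
  also have "\<dots> = ennreal ((1 / sqrt (1 - 2 * s)) ^ Suc d * exp (dot n v v / (2 * \<sigma>\<^sup>2)))"
    using s by (subst ennreal_mult[symmetric]) (auto simp: mult_ac)
  finally show ?case .
qed

lemma nn_integral_exp_chi_square:
  assumes "\<sigma> > 0" "0 \<le> s" "2 * s < 1" "orthonormal n d u"
  shows "(\<integral>\<^sup>+ z. ennreal (exp (s * (\<Sum>a<d. (dot n (u a) z)\<^sup>2) / \<sigma>\<^sup>2)) \<partial>normal_prod n \<sigma>) =
    ennreal ((1 / sqrt (1 - 2 * s)) ^ d)"
  using nn_integral_exp_chi_square_aux[OF assms, of "\<lambda>_. 0"] by (simp add: dot_def)

section \<open>Orthonormal bases and least squares\<close>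

lemma dot_self_nonneg: "dot n x x \<ge> 0"
  by (simp add: dot_def sum_nonneg)

lemma dot_self_eq_0: "dot n x x = 0 \<Longrightarrow> i < n \<Longrightarrow> x i = 0"
  by (simp add: dot_def sum_nonneg_eq_0_iff)

lemma dot_cong: "(\<And>i. i < n \<Longrightarrow> x i = x' i) \<Longrightarrow> dot n x y = dot n x' y"
  by (simp add: dot_def)

lemma dot_diff_left: "dot n (\<lambda>i. x i - y i) z = dot n x z - dot n y z"
  by (simp add: dot_def algebra_simps sum_subtractf)

lemma dot_sum_left: "dot n (\<lambda>i. \<Sum>a\<in>S. c a * u a i) y = (\<Sum>a\<in>S. c a * dot n (u a) y)"
  unfolding dot_def sum_distrib_right sum_distrib_left
  by (subst sum.swap) (simp add: mult.assoc)

text \<open>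
  Gram--Schmidt orthogonalisation. A vector that depends on the earlier ones adds no basis vector, so
  \<open>d\<close> can be smaller than the number of vectors.
\<close>
lemma exists_orthonormal_span:
  assumes "finite J"
  shows "\<exists>d u. d \<le> card J \<and> orthonormal n d u \<and>
    (\<forall>j\<in>J. \<exists>c. \<forall>i<n. f j i = (\<Sum>a<d. c a * u a i))"
  using assms
proof (induction J rule: finite_induct)
  case empty
  show ?case by (intro exI[of _ 0]) (auto simp: orthonormal_def)
next
  case (insert k J)
  then obtain d u where d: "d \<le> card J" and on: "orthonormal n d u"
    and sp: "\<forall>j\<in>J. \<exists>c. \<forall>i<n. f j i = (\<Sum>a<d. c a * u a i)" by blast
  define w where "w i = f k i - (\<Sum>a<d. dot n (u a) (f k) * u a i)" for i
  have fk: "f k i = (\<Sum>a<d. dot n (u a) (f k) * u a i) + w i" for i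
    by (simp add: w_def)
  have orth: "dot n (u b) w = 0" if "b < d" for b
  proof -
    have "dot n w (u b) = dot n (f k) (u b) - (\<Sum>a<d. dot n (u a) (f k) * dot n (u a) (u b))"
      using dot_diff_left[of n "f k" "\<lambda>i. \<Sum>a<d. dot n (u a) (f k) * u a i" "u b"]
      by (simp add: dot_sum_left w_def[abs_def])
    also have "(\<Sum>a<d. dot n (u a) (f k) * dot n (u a) (u b)) = (\<Sum>a<d. if a = b then dot n (u a) (f k) else 0)"
      using on that by (intro sum.cong) (auto simp: orthonormal_def)
    also have "\<dots> = dot n (u b) (f k)" using that by simp
    finally show ?thesis by (simp add: dot_commute)
  qed
  show ?case
  proof (cases "dot n w w = 0")
    case True
    then have "\<forall>i<n. f k i = (\<Sum>a<d. dot n (u a) (f k) * u a i)"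
      using fk dot_self_eq_0[OF True] by simp
    then have "\<forall>j\<in>insert k J. \<exists>c. \<forall>i<n. f j i = (\<Sum>a<d. c a * u a i)"
      using sp by auto
    then show ?thesis using d on insert.hyps by (intro exI[of _ d] exI[of _ u]) auto
  next
    case False
    then have pos: "dot n w w > 0" using dot_self_nonneg[of n w] by simp
    define q where "q = sqrt (dot n w w)"
    have q: "q > 0" "q * q = dot n w w" using pos by (auto simp: q_def)
    define u' where "u' = u(d := (\<lambda>i. (1 / q) * w i))"
    have on': "orthonormal n (Suc d) u'"
      unfolding orthonormal_def
    proof (intro allI impI)
      fix a b assume ab: "a < Suc d" "b < Suc d"
      have "dot n (u' d) (u' d) = (1 / q) * ((1 / q) * dot n w w)"
        unfolding u'_def fun_upd_same dot_scale_left by (subst dot_commute) (simp only: dot_scale_left)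
      then have ww: "dot n (u' d) (u' d) = 1"
        using q(1) by (simp add: q(2)[symmetric])
      have aw: "dot n (u' d) (u' c) = 0" if "c < d" for c
        using orth[OF that] that unfolding u'_def fun_upd_same dot_scale_left
        by (simp add: dot_commute)
      show "dot n (u' a) (u' b) = (if a = b then 1 else 0)"
        using ab ww aw[of a] aw[of b] on
        by (cases "a = d"; cases "b = d") (auto simp: dot_commute u'_def orthonormal_def)
    qed
    have old: "\<exists>c'. \<forall>i<n. x i = (\<Sum>a<Suc d. c' a * u' a i)"
      if "\<forall>i<n. x i = (\<Sum>a<d. c a * u a i) + e * w i" for c e and x :: "nat \<Rightarrow> real"
    proof (intro exI allI impI)
      fix i assume "i < n"
      have "(\<Sum>a<d. (c(d := e * q)) a * u' a i) = (\<Sum>a<d. c a * u a i)"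
        by (intro sum.cong) (auto simp: u'_def)
      then show "x i = (\<Sum>a<Suc d. (c(d := e * q)) a * u' a i)"
        using that \<open>i < n\<close> q by (simp add: u'_def)
    qed
    have "\<exists>c. \<forall>i<n. f k i = (\<Sum>a<Suc d. c a * u' a i)"
      using old[of "f k" "\<lambda>a. dot n (u a) (f k)" 1] fk by simp
    moreover have "\<exists>c. \<forall>i<n. f j i = (\<Sum>a<Suc d. c a * u' a i)" if "j \<in> J" for j
      using sp that old[of "f j" _ 0] by fastforce
    ultimately show ?thesis
      using d on' insert.hyps by (intro exI[of _ "Suc d"] exI[of _ u']) auto
  qed
qed

definition covers_span :: "nat \<Rightarrow> nat \<Rightarrow> (nat \<Rightarrow> nat \<Rightarrow> real) \<Rightarrow> 'j set \<Rightarrow> ('j \<Rightarrow> nat \<Rightarrow> real) \<Rightarrow> bool" where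
  "covers_span n d u J f \<longleftrightarrow>
    (\<forall>x b. (\<forall>i<n. x i = (\<Sum>j\<in>J. b j * f j i)) \<longrightarrow> (\<exists>c. \<forall>i<n. x i = (\<Sum>a<d. c a * u a i)))"

lemma covers_spanD:
  assumes "covers_span n d u J f" and "\<forall>i<n. x i = (\<Sum>j\<in>J. b j * f j i)"
  shows "\<exists>c. \<forall>i<n. x i = (\<Sum>a<d. c a * u a i)"
  using assms unfolding covers_span_def by blast

lemma exists_orthonormal_covers_span:
  assumes "finite J"
  shows "\<exists>d u. d \<le> card J \<and> orthonormal n d u \<and> covers_span n d u J f"
proof -
  obtain d u where d: "d \<le> card J" and on: "orthonormal n d u"
    and sp: "\<forall>j\<in>J. \<exists>c. \<forall>i<n. f j i = (\<Sum>a<d. c a * u a i)"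
    using exists_orthonormal_span[OF assms, of n f] by blast
  from sp obtain C where C: "\<And>j i. j \<in> J \<Longrightarrow> i < n \<Longrightarrow> f j i = (\<Sum>a<d. C j a * u a i)"
    by metis
  have "\<exists>c. \<forall>i<n. x i = (\<Sum>a<d. c a * u a i)" if x: "\<forall>i<n. x i = (\<Sum>j\<in>J. b j * f j i)" for x b
  proof (intro exI allI impI)
    fix i assume i: "i < n"
    have "x i = (\<Sum>j\<in>J. \<Sum>a<d. b j * C j a * u a i)"
      using x i by (simp add: C sum_distrib_left mult.assoc)
    also have "\<dots> = (\<Sum>a<d. (\<Sum>j\<in>J. b j * C j a) * u a i)"
      by (subst sum.swap) (simp add: sum_distrib_right)
    finally show "x i = (\<Sum>a<d. (\<Sum>j\<in>J. b j * C j a) * u a i)" .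
  qed
  then show ?thesis using d on unfolding covers_span_def by blast
qed

text \<open>
  The inequality \<open>2 s t \<le> \<theta> s\<^sup>2 + t\<^sup>2 / \<theta>\<close>, coordinate by coordinate: only the projection of \<open>e\<close> onto the
  span of the \<open>u a\<close> interacts with \<open>x\<close>.
\<close>
lemma two_dot_le_orthonormal:
  assumes on: "orthonormal n d u" and x: "\<forall>i<n. x i = (\<Sum>a<d. c a * u a i)" and \<theta>: "\<theta> > 0"
  shows "2 * dot n x e \<le> \<theta> * dot n x x + (\<Sum>a<d. (dot n (u a) e)\<^sup>2) / \<theta>"
proof -
  have xe: "dot n x y = (\<Sum>a<d. c a * dot n (u a) y)" for y
    using x by (subst dot_cong[of n x "\<lambda>i. \<Sum>a<d. c a * u a i"]) (auto simp: dot_sum_left)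
  have ux: "dot n (u a) x = c a" if "a < d" for a
  proof -
    have "dot n (u a) x = (\<Sum>b<d. c b * dot n (u b) (u a))" using xe[of "u a"] by (simp add: dot_commute)
    also have "\<dots> = (\<Sum>b<d. if b = a then c b else 0)"
      using on that by (intro sum.cong) (auto simp: orthonormal_def)
    finally show ?thesis using that by simp
  qed
  have "2 * dot n x e = (\<Sum>a<d. 2 * (c a * dot n (u a) e))"
    by (simp add: xe sum_distrib_left)
  also have "\<dots> \<le> (\<Sum>a<d. \<theta> * (c a)\<^sup>2 + (dot n (u a) e)\<^sup>2 / \<theta>)"
  proof (rule sum_mono)
    fix a
    have "0 \<le> (\<theta> * c a - dot n (u a) e)\<^sup>2 / \<theta>" using \<theta> by simp
    also have "\<dots> = \<theta> * (c a)\<^sup>2 + (dot n (u a) e)\<^sup>2 / \<theta> - 2 * (c a * dot n (u a) e)"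
      using \<theta> by (simp add: power2_eq_square field_simps)
    finally show "2 * (c a * dot n (u a) e) \<le> \<theta> * (c a)\<^sup>2 + (dot n (u a) e)\<^sup>2 / \<theta>" by simp
  qed
  also have "\<dots> = \<theta> * dot n x x + (\<Sum>a<d. (dot n (u a) e)\<^sup>2) / \<theta>"
    using ux by (simp add: xe[of x] sum.distrib sum_distrib_left sum_divide_distrib power2_eq_square)
  finally show ?thesis .
qed

lemma sqnorm_dot: "v \<in> carrier_vec n \<Longrightarrow> sqnorm v = dot n (($) v) (($) v)"
  by (auto simp: sqnorm_def scalar_prod_def dot_def lessThan_atLeast0)

lemma sqnorm_nonneg: "sqnorm v \<ge> 0"
  unfolding sqnorm_dot[OF carrier_vecI[OF refl]] by (rule dot_self_nonneg)

lemma sqnorm_eq_0: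
  assumes "v \<in> carrier_vec n" "sqnorm v = 0" shows "v = 0\<^sub>v n"
proof (rule eq_vecI)
  fix i assume "i < dim_vec (0\<^sub>v n)"
  then show "v $ i = 0\<^sub>v n $ i"
    using dot_self_eq_0[of n "($) v" i] sqnorm_dot[OF assms(1)] assms by simp
qed (use assms in auto)

lemma is_pinv_unique:
  assumes P: "is_pinv A P" and Q: "is_pinv A Q"
  shows "P = Q"
proof -
  define m n where "m = dim_row A" and "n = dim_col A"
  have A: "A \<in> carrier_mat m n" by (auto simp: m_def n_def)
  have Pc: "P \<in> carrier_mat n m" and Qc: "Q \<in> carrier_mat n m"
    using P Q by (auto simp: is_pinv_def m_def n_def)
  have P': "A * P * A = A" "P * A * P = P" "transpose_mat (A * P) = A * P" "transpose_mat (P * A) = P * A"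
    and Q': "A * Q * A = A" "Q * A * Q = Q" "transpose_mat (A * Q) = A * Q" "transpose_mat (Q * A) = Q * A"
    using P Q by (auto simp: is_pinv_def)
  have AP: "A * P \<in> carrier_mat m m" and AQ: "A * Q \<in> carrier_mat m m"
    and PA: "P * A \<in> carrier_mat n n" and QA: "Q * A \<in> carrier_mat n n"
    using A Pc Qc by auto
  have "A * P = (A * Q * A) * P" using Q' by simp
  also have "\<dots> = (A * Q) * (A * P)" by (rule assoc_mult_mat[OF AQ A Pc])
  also have "\<dots> = transpose_mat ((A * P) * (A * Q))"
    using transpose_mult[OF AP AQ] P' Q' by simp
  also have "(A * P) * (A * Q) = (A * P * A) * Q" by (rule assoc_mult_mat[OF AP A Qc, symmetric])
  finally have 1: "A * P = A * Q" using P' Q' by simp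
  have "P * A = P * (A * Q * A)" using Q' by simp
  also have "\<dots> = P * (A * (Q * A))" by (simp add: assoc_mult_mat[OF A Qc A])
  also have "\<dots> = (P * A) * (Q * A)" by (rule assoc_mult_mat[OF Pc A QA, symmetric])
  also have "\<dots> = transpose_mat ((Q * A) * (P * A))"
    using transpose_mult[OF QA PA] P' Q' by simp
  also have "(Q * A) * (P * A) = Q * (A * (P * A))" by (rule assoc_mult_mat[OF Qc A PA])
  also have "A * (P * A) = A" using assoc_mult_mat[OF A Pc A] P' by simp
  finally have 2: "P * A = Q * A" using Q' by simp
  have "P = (P * A) * P" using P' by simp
  also have "\<dots> = (Q * A) * P" by (simp add: 2)
  also have "\<dots> = Q * (A * P)" by (rule assoc_mult_mat[OF Qc A Pc])
  also have "\<dots> = Q * (A * Q)" by (simp add: 1)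
  also have "\<dots> = (Q * A) * Q" by (rule assoc_mult_mat[OF Qc A Qc, symmetric])
  finally show ?thesis using Q' by simp
qed

lemma pinv_eqI: "is_pinv A P \<Longrightarrow> pinv A = P"
  unfolding pinv_def using is_pinv_unique by blast

lemma model_diag_mult_vec:
  assumes "X \<in> carrier_mat n p" "v \<in> carrier_vec p" "j < p"
  shows "(model_diag X M *\<^sub>v v) $ j = (if j \<in> M then v $ j else 0)"
  using assms
  by (simp add: model_diag_def mat_diag_def scalar_prod_def if_distrib[of "\<lambda>x. x * _"] cong: if_cong)

lemma model_diag_fixes:
  assumes "X \<in> carrier_mat n p" "v \<in> carrier_vec p" "vec_support v \<subseteq> M"
  shows "model_diag X M *\<^sub>v v = v"
proof (rule eq_vecI)
  fix j assume "j < dim_vec v"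
  then show "(model_diag X M *\<^sub>v v) $ j = v $ j"
    using assms by (auto simp: model_diag_mult_vec[OF assms(1,2)] vec_support_def)
qed (use assms in \<open>auto simp: model_diag_def mat_diag_def\<close>)

lemma model_diag_fixed_support:
  assumes "X \<in> carrier_mat n p" "v \<in> carrier_vec p" "model_diag X M *\<^sub>v v = v"
  shows "vec_support v \<subseteq> M"
proof
  fix j assume "j \<in> vec_support v"
  then have "j < p" "v $ j \<noteq> 0" using assms by (auto simp: vec_support_def)
  then show "j \<in> M" using model_diag_mult_vec[OF assms(1,2), of j M] assms(3) by (auto split: if_splits)
qed

text \<open>
  Injectivity of \<open>X\<close> on the vectors supported in \<open>M\<close>; it makes the Gram matrix of \<open>M\<close> invertible.
\<close>
definition identifiable :: "real mat \<Rightarrow> nat set \<Rightarrow> bool" where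
  "identifiable X M \<longleftrightarrow> (\<forall>v\<in>carrier_vec (dim_col X).
     vec_support v \<subseteq> M \<longrightarrow> X *\<^sub>v v = 0\<^sub>v (dim_row X) \<longrightarrow> v = 0\<^sub>v (dim_col X))"

text \<open>
  Write \<open>B = D X' X D\<close> for the Gram matrix of the model. On the coordinates in \<open>M\<close> it is invertible, so
  \<open>E = B + (I - D)\<close> is invertible; its inverse \<open>W\<close> commutes with \<open>D\<close>, and \<open>W D\<close> satisfies the Penrose
  equations for \<open>B\<close>. With this explicit pseudoinverse the normal equations are a computation.
\<close>
lemma lse_normal_equations:
  assumes X: "X \<in> carrier_mat n p" and y: "y \<in> carrier_vec n"
    and inj: "identifiable X M"
  shows "lse X M y \<in> carrier_vec p" "vec_support (lse X M y) \<subseteq> M"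
    and "model_diag X M *\<^sub>v (transpose_mat X *\<^sub>v (X *\<^sub>v lse X M y)) =
         model_diag X M *\<^sub>v (transpose_mat X *\<^sub>v y)"
proof -
  define D where "D = model_diag X M"
  define T where "T = transpose_mat X"
  define G where "G = T * X"
  define B where "B = D * T * X * D"
  define E where "E = B + (1\<^sub>m p - D)"
  have D [simp]: "D \<in> carrier_mat p p" using X by (auto simp: D_def model_diag_def)
  have Tc [simp]: "T \<in> carrier_mat p n" using X by (auto simp: T_def)
  have G [simp]: "G \<in> carrier_mat p p" unfolding G_def by (rule mult_carrier_mat[OF Tc X])
  have DD: "D * D = D"
    by (auto simp: D_def model_diag_def intro!: arg_cong[of _ _ "mat_diag _"])
  have Dt: "transpose_mat D = D"
    by (rule eq_matI) (auto simp: D_def model_diag_def mat_diag_def)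
  have BG: "B = D * G * D"
    using assoc_mult_mat[OF D Tc X] by (simp add: B_def G_def)
  have Bc [simp]: "B \<in> carrier_mat p p" unfolding BG using mult_carrier_mat[OF mult_carrier_mat[OF D G] D] .
  have I [simp]: "1\<^sub>m p - D \<in> carrier_mat p p" using D by (rule minus_carrier_mat)
  have Ec [simp]: "E \<in> carrier_mat p p" unfolding E_def using I by simp
  have DG [simp]: "D * G \<in> carrier_mat p p" using mult_carrier_mat[OF D G] .
  have DB: "D * B = B"
  proof -
    have "D * B = D * (D * G) * D" unfolding BG by (rule assoc_mult_mat[OF D DG D, symmetric])
    also have "D * (D * G) = D * D * G" by (rule assoc_mult_mat[OF D D G, symmetric])
    finally show ?thesis by (simp add: DD BG)
  qed
  have BD: "B * D = B"
    using assoc_mult_mat[OF DG D D] by (simp add: BG DD)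
  have DE: "D * E = B"
    unfolding E_def using mult_add_distrib_mat[OF D Bc I] mult_minus_distrib_mat[OF D one_carrier_mat D]
    by (simp add: DB DD right_mult_one_mat[OF D] minus_r_inv_mat[OF D] right_add_zero_mat[OF Bc])
  have ED: "E * D = B"
    unfolding E_def using add_mult_distrib_mat[OF Bc I D] minus_mult_distrib_mat[OF one_carrier_mat D D]
    by (simp add: BD DD left_mult_one_mat[OF D] minus_r_inv_mat[OF D] right_add_zero_mat[OF Bc])
  have inj_E: "v = 0\<^sub>v p" if v: "v \<in> carrier_vec p" and Ev: "E *\<^sub>v v = 0\<^sub>v p" for v
  proof -
    have "D *\<^sub>v 0\<^sub>v p = 0\<^sub>v p" by (rule eq_vecI) (simp_all add: carrier_matD[OF D])
    then have Bv: "B *\<^sub>v v = 0\<^sub>v p"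
      using assoc_mult_mat_vec[OF D Ec v] DE Ev by simp
    have "E *\<^sub>v v = B *\<^sub>v v + (v - D *\<^sub>v v)"
      unfolding E_def using add_mult_distrib_mat_vec[OF Bc I v] minus_mult_distrib_mat_vec[OF one_carrier_mat D v] v
      by simp
    then have vDv: "v - D *\<^sub>v v = 0\<^sub>v p" using Ev Bv v D by auto
    have Dv: "D *\<^sub>v v = v"
    proof (intro eq_vecI)
      fix j assume "j < dim_vec v"
      then have "(v - D *\<^sub>v v) $ j = 0" "j < p" using vDv v by auto
      then show "(D *\<^sub>v v) $ j = v $ j" using v by (simp add: carrier_matD[OF D])
    qed (use v in \<open>simp add: carrier_matD[OF D]\<close>)
    have sup: "vec_support v \<subseteq> M"
      using model_diag_fixed_support[OF X v] Dv by (simp add: D_def)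
    have Xv: "X *\<^sub>v v \<in> carrier_vec n" using X v by auto
    have "sqnorm (X *\<^sub>v v) = (T *\<^sub>v (X *\<^sub>v v)) \<bullet> v"
      unfolding sqnorm_def T_def using transpose_vec_mult_scalar[OF X v Xv] by simp
    also have "T *\<^sub>v (X *\<^sub>v v) = G *\<^sub>v v" unfolding G_def by (rule assoc_mult_mat_vec[OF Tc X v, symmetric])
    also have "(G *\<^sub>v v) \<bullet> v = (G *\<^sub>v v) \<bullet> (D *\<^sub>v v)" by (simp add: Dv)
    also have "\<dots> = (D *\<^sub>v (G *\<^sub>v v)) \<bullet> v"
      using transpose_vec_mult_scalar[OF D v, of "G *\<^sub>v v"] G v by (simp add: Dt)
    also have "D *\<^sub>v (G *\<^sub>v v) = B *\<^sub>v v"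
      using assoc_mult_mat_vec[OF DG D v] assoc_mult_mat_vec[OF D G v] by (simp add: BG Dv)
    finally have "sqnorm (X *\<^sub>v v) = 0" using Bv v by simp
    then have "X *\<^sub>v v = 0\<^sub>v n" using sqnorm_eq_0[OF Xv] by simp
    then show ?thesis using inj v sup X by (auto simp: identifiable_def)
  qed
  have "det E \<noteq> 0" using det_0_iff_vec_prod_zero_field[OF Ec] inj_E by blast
  then have "E \<in> Units (ring_mat TYPE(real) p ())" by (rule det_non_zero_imp_unit[OF Ec])
  then obtain W where W [simp]: "W \<in> carrier_mat p p" and WE: "W * E = 1\<^sub>m p" and EW: "E * W = 1\<^sub>m p"
    by (auto simp: Units_def ring_mat_def)
  have BW: "B * W = D" using assoc_mult_mat[OF D Ec W] DE EW D by simp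
  have WB: "W * B = D" using assoc_mult_mat[OF W Ec D] ED WE D by simp
  have DW: "D * W = W * D"
  proof -
    have "W * B * W = W * (B * W)" by (rule assoc_mult_mat[OF W Bc W])
    then show ?thesis by (simp add: BW WB)
  qed
  have WD: "W * D \<in> carrier_mat p p" using W D by (rule mult_carrier_mat)
  define P where "P = W * D"
  have Pc [simp]: "P \<in> carrier_mat p p" using WD by (simp add: P_def)
  have DP: "D * P = P"
    unfolding P_def DW[symmetric] using assoc_mult_mat[OF D D W] by (simp add: DD)
  have PD: "P * D = P" unfolding P_def using assoc_mult_mat[OF W D D] by (simp add: DD)
  have BP: "B * P = D" unfolding P_def using assoc_mult_mat[OF Bc W D] by (simp add: BW DD)
  have PB: "P * B = D" unfolding P_def using assoc_mult_mat[OF W D Bc] by (simp add: DB WB)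
  have "is_pinv B P"
    unfolding is_pinv_def using Pc by (simp add: BP PB DB DP Dt carrier_matD[OF Bc])
  then have pinv: "pinv B = P" by (rule pinv_eqI)
  define b where "b = lse X M y"
  have b_eq: "b = (P * D * T) *\<^sub>v y"
    unfolding b_def lse_def Let_def D_def[symmetric] T_def[symmetric] B_def[symmetric] pinv ..
  also have "\<dots> = P *\<^sub>v (T *\<^sub>v y)"
    using assoc_mult_mat_vec[OF Pc Tc y] by (simp add: PD)
  finally have bP: "b = P *\<^sub>v (T *\<^sub>v y)" .
  have Ty: "T *\<^sub>v y \<in> carrier_vec p" by (rule mult_mat_vec_carrier[OF Tc y])
  show bc: "lse X M y \<in> carrier_vec p"
    unfolding b_def[symmetric] bP by (rule mult_mat_vec_carrier[OF Pc Ty])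
  then have bc': "b \<in> carrier_vec p" by (simp add: b_def)
  have Db: "D *\<^sub>v b = b"
    using assoc_mult_mat_vec[OF D Pc Ty] by (simp add: bP DP)
  then show "vec_support (lse X M y) \<subseteq> M"
    using model_diag_fixed_support[OF X bc] by (simp add: D_def b_def)
  have "D *\<^sub>v (T *\<^sub>v (X *\<^sub>v b)) = D *\<^sub>v (G *\<^sub>v b)"
    unfolding G_def assoc_mult_mat_vec[OF Tc X bc'] ..
  also have "\<dots> = B *\<^sub>v b"
    using assoc_mult_mat_vec[OF DG D bc'] assoc_mult_mat_vec[OF D G bc'] by (simp add: BG Db)
  also have "\<dots> = D *\<^sub>v (T *\<^sub>v y)"
    unfolding bP using assoc_mult_mat_vec[OF Bc Pc Ty] by (simp add: BP)
  finally show "model_diag X M *\<^sub>v (transpose_mat X *\<^sub>v (X *\<^sub>v lse X M y)) =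
         model_diag X M *\<^sub>v (transpose_mat X *\<^sub>v y)"
    unfolding D_def T_def b_def .
qed

text \<open>
  By the normal equations the residual is orthogonal to the column space of the model, so the claim
  is Pythagoras' theorem.
\<close>
lemma lse_minimises:
  assumes X: "X \<in> carrier_mat n p" and y: "y \<in> carrier_vec n"
    and inj: "identifiable X M"
    and b: "b \<in> carrier_vec p" "vec_support b \<subseteq> M"
  shows "sqnorm (y - X *\<^sub>v lse X M y) \<le> sqnorm (y - X *\<^sub>v b)"
proof -
  note L = lse_normal_equations[OF X y inj]
  define l where "l = lse X M y"
  define D where "D = model_diag X M"
  have D: "D \<in> carrier_mat p p" using X by (auto simp: D_def model_diag_def)
  have Dt: "transpose_mat D = D"
    by (rule eq_matI) (auto simp: D_def model_diag_def mat_diag_def)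
  have l: "l \<in> carrier_vec p" "vec_support l \<subseteq> M"
    using L(1,2) by (simp_all add: l_def)
  define h where "h = l - b"
  have h: "h \<in> carrier_vec p" using l b by (simp add: h_def)
  have sh: "vec_support h \<subseteq> M"
  proof
    fix j assume j: "j \<in> vec_support h"
    then have "j < p" "l $ j \<noteq> 0 \<or> b $ j \<noteq> 0" using h b l by (auto simp: vec_support_def h_def)
    then show "j \<in> M" using l b by (auto simp: vec_support_def)
  qed
  define e where "e = y - X *\<^sub>v l"
  have Xl: "X *\<^sub>v l \<in> carrier_vec n" and Xh: "X *\<^sub>v h \<in> carrier_vec n" using X l h by auto
  have e: "e \<in> carrier_vec n" using y Xl by (simp add: e_def)
  have T: "transpose_mat X \<in> carrier_mat p n" using X by simp
  have DTe: "D *\<^sub>v (transpose_mat X *\<^sub>v e) = 0\<^sub>v p"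
  proof -
    have "transpose_mat X *\<^sub>v e = transpose_mat X *\<^sub>v y - transpose_mat X *\<^sub>v (X *\<^sub>v l)"
      unfolding e_def by (rule mult_minus_distrib_mat_vec[OF T y Xl])
    then have "D *\<^sub>v (transpose_mat X *\<^sub>v e) = D *\<^sub>v (transpose_mat X *\<^sub>v y) - D *\<^sub>v (transpose_mat X *\<^sub>v (X *\<^sub>v l))"
      using mult_minus_distrib_mat_vec[OF D, of "transpose_mat X *\<^sub>v y" "transpose_mat X *\<^sub>v (X *\<^sub>v l)"] T y Xl
      by (metis mult_mat_vec_carrier)
    moreover have "D *\<^sub>v (transpose_mat X *\<^sub>v (X *\<^sub>v l)) = D *\<^sub>v (transpose_mat X *\<^sub>v y)"
      using L(3) by (simp add: D_def l_def)
    moreover have "D *\<^sub>v (transpose_mat X *\<^sub>v y) \<in> carrier_vec p" using D T y by (metis mult_mat_vec_carrier)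
    ultimately show ?thesis by simp
  qed
  have "e \<bullet> (X *\<^sub>v h) = (transpose_mat X *\<^sub>v e) \<bullet> (D *\<^sub>v h)"
    using transpose_vec_mult_scalar[OF X h e] model_diag_fixes[OF X h sh] by (simp add: D_def)
  also have "\<dots> = (D *\<^sub>v (transpose_mat X *\<^sub>v e)) \<bullet> h"
    using transpose_vec_mult_scalar[OF D h, of "transpose_mat X *\<^sub>v e"] T e by (metis Dt mult_mat_vec_carrier)
  finally have eh: "e \<bullet> (X *\<^sub>v h) = 0" using DTe h by simp
  have Xb: "y - X *\<^sub>v b = e + X *\<^sub>v h"
  proof -
    have "X *\<^sub>v h = X *\<^sub>v l - X *\<^sub>v b" unfolding h_def by (rule mult_minus_distrib_mat_vec[OF X l(1) b(1)])
    then show ?thesis unfolding e_def using y Xl X b by (intro eq_vecI) auto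
  qed
  have "sqnorm (y - X *\<^sub>v b) = (e + X *\<^sub>v h) \<bullet> (e + X *\<^sub>v h)" by (simp add: sqnorm_def Xb)
  also have "\<dots> = e \<bullet> e + (X *\<^sub>v h) \<bullet> (X *\<^sub>v h)"
    using e Xh eh comm_scalar_prod[OF e Xh]
    by (simp add: add_scalar_prod_distrib[of _ n] scalar_prod_add_distrib[of _ n])
  also have "\<dots> = sqnorm e + sqnorm (X *\<^sub>v h)" by (simp add: sqnorm_def)
  finally show ?thesis using sqnorm_nonneg[of "X *\<^sub>v h"] by (simp add: e_def l_def)
qed

lemma mult_mat_vec_nth:
  fixes X :: "real mat"
  assumes "X \<in> carrier_mat n p" "v \<in> carrier_vec p" "i < n"
  shows "(X *\<^sub>v v) $ i = (\<Sum>j<p. v $ j * X $$ (i, j))"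
  using assms by (auto simp: scalar_prod_def lessThan_atLeast0 intro!: sum.cong mult.commute)

lemma mult_mat_vec_nth_support:
  fixes X :: "real mat"
  assumes "X \<in> carrier_mat n p" "v \<in> carrier_vec p" "i < n" "vec_support v \<subseteq> M" "M \<subseteq> {..<p}"
  shows "(X *\<^sub>v v) $ i = (\<Sum>j\<in>M. v $ j * X $$ (i, j))"
proof -
  have "(\<Sum>j<p. v $ j * X $$ (i, j)) = (\<Sum>j\<in>M. v $ j * X $$ (i, j))"
    using assms by (intro sum.mono_neutral_right) (auto simp: vec_support_def)
  then show ?thesis using mult_mat_vec_nth[OF assms(1-3)] by simp
qed

text \<open>
  Otherwise adding the column would give \<open>mat_rank X + 1\<close> independent columns.
\<close>
lemma column_in_span_of_independent_columns:
  assumes X: "X \<in> carrier_mat n p" and S: "S \<subseteq> {..<p}" "card S = mat_rank X"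
    and ind: "indep_columns X S" and j: "j < p"
  shows "\<exists>c. \<forall>i<n. X $$ (i, j) = (\<Sum>l\<in>S. c l * X $$ (i, l))"
proof -
  interpret vec_space "TYPE(real)" n .
  have fS: "finite S" using S finite_subset by blast
  have inj: "inj_on (col X) S" and li: "lin_indpt (col X ` S)"
    using ind X by (auto simp: indep_columns_def)
  have carr: "col X l \<in> carrier_vec n" if "l < p" for l using X that by auto
  have sub: "col X ` S \<subseteq> carrier_vec n" using S carr by auto
  have subc: "insert (col X j) (col X ` S) \<subseteq> set (cols X)"
    using S j X by (auto simp: cols_def)
  have rk: "mat_rank X = rank X" using X by (simp add: mat_rank_def)
  have "col X j \<in> span (col X ` S)"
  proof (cases "col X j \<in> col X ` S")
    case True
    then show ?thesis using span_mem[OF sub] by simp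
  next
    case False
    have "lin_dep (insert (col X j) (col X ` S))"
    proof (rule ccontr)
      assume "\<not> lin_dep (insert (col X j) (col X ` S))"
      then have "card (insert (col X j) (col X ` S)) \<le> rank X"
        using rank_ge_card_indpt[OF X subc] by simp
      moreover have "card (insert (col X j) (col X ` S)) = Suc (card S)"
        using False fS inj by (simp add: card_image)
      ultimately show False using S rk by simp
    qed
    then show ?thesis
      using lin_dep_iff_in_span[of "col X ` S" "col X j"] sub li carr[OF j] False
      by (simp add: module_vec_def)
  qed
  then obtain a where a: "col X j = lincomb a (col X ` S)"
    using finite_span[of "col X ` S"] fS sub by (auto simp: module_vec_def)
  have "X $$ (i, j) = (\<Sum>l\<in>S. a (col X l) * X $$ (i, l))" if i: "i < n" for i
  proof -
    have "X $$ (i, j) = col X j $ i" using X i j by simp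
    also have "\<dots> = (\<Sum>x\<in>col X ` S. a x * x $ i)" unfolding a by (rule lincomb_index[OF i sub])
    also have "\<dots> = (\<Sum>l\<in>S. a (col X l) * col X l $ i)" by (simp add: sum.reindex[OF inj])
    also have "\<dots> = (\<Sum>l\<in>S. a (col X l) * X $$ (i, l))"
      using S X i by (intro sum.cong) auto
    finally show ?thesis .
  qed
  then show ?thesis by (intro exI[of _ "\<lambda>l. a (col X l)"]) auto
qed

lemma range_eq_independent_columns:
  assumes X: "X \<in> carrier_mat n p" and S: "S \<subseteq> {..<p}" "card S = mat_rank X"
    and ind: "indep_columns X S" and v: "v \<in> carrier_vec p"
  shows "\<exists>w \<in> carrier_vec p. vec_support w \<subseteq> S \<and> X *\<^sub>v w = X *\<^sub>v v"
proof -
  obtain C where C: "\<And>j i. j < p \<Longrightarrow> i < n \<Longrightarrow> X $$ (i, j) = (\<Sum>l\<in>S. C j l * X $$ (i, l))"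
    using column_in_span_of_independent_columns[OF X S ind] by metis
  define w where "w = vec p (\<lambda>l. if l \<in> S then \<Sum>j<p. v $ j * C j l else 0)"
  have w: "w \<in> carrier_vec p" "vec_support w \<subseteq> S" by (auto simp: w_def vec_support_def split: if_splits)
  have "X *\<^sub>v w = X *\<^sub>v v"
  proof (rule eq_vecI)
    fix i assume "i < dim_vec (X *\<^sub>v v)"
    then have i: "i < n" using X by simp
    have "(X *\<^sub>v v) $ i = (\<Sum>j<p. \<Sum>l\<in>S. v $ j * C j l * X $$ (i, l))"
      using mult_mat_vec_nth[OF X v i] C i by (simp add: sum_distrib_left mult.assoc)
    also have "\<dots> = (\<Sum>l\<in>S. w $ l * X $$ (i, l))"
      using S by (subst sum.swap) (auto simp: w_def sum_distrib_right intro!: sum.cong)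
    finally show "(X *\<^sub>v w) $ i = (X *\<^sub>v v) $ i"
      using mult_mat_vec_nth_support[OF X w(1) i w(2) S(1)] by simp
  qed simp
  then show ?thesis using w by blast
qed

section \<open>Packings of finite sets\<close>

definition separated :: "('a \<Rightarrow> 'a \<Rightarrow> nat) \<Rightarrow> nat \<Rightarrow> 'a set \<Rightarrow> bool" where
  "separated \<delta> d L \<longleftrightarrow> (\<forall>x\<in>L. \<forall>y\<in>L. x \<noteq> y \<longrightarrow> d \<le> \<delta> x y)"

text \<open>
  A separated subset of maximal size is also a covering, since an uncovered point could be added.
\<close>
lemma exists_covering_separated_subset:
  fixes \<delta> :: "'a \<Rightarrow> 'a \<Rightarrow> nat"
  assumes fin: "finite F" and sym: "\<And>x y. \<delta> x y = \<delta> y x" and refl: "\<And>x. \<delta> x x < d"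
  shows "\<exists>L\<subseteq>F. separated \<delta> d L \<and> (\<forall>x\<in>F. \<exists>y\<in>L. \<delta> x y < d)"
proof -
  have "{} \<subseteq> F \<and> separated \<delta> d {}" by (simp add: separated_def)
  moreover have "\<forall>L. L \<subseteq> F \<and> separated \<delta> d L \<longrightarrow> card L < Suc (card F)"
    using fin by (simp add: less_Suc_eq_le card_mono)
  ultimately have "\<exists>L. (L \<subseteq> F \<and> separated \<delta> d L) \<and> (\<forall>L'. L' \<subseteq> F \<and> separated \<delta> d L' \<longrightarrow> card L' \<le> card L)"
    by (rule ex_has_greatest_nat)
  then obtain L where L: "L \<subseteq> F" "separated \<delta> d L"
    and max: "\<And>L'. L' \<subseteq> F \<Longrightarrow> separated \<delta> d L' \<Longrightarrow> card L' \<le> card L"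
    by (elim exE conjE) simp
  have "\<exists>y\<in>L. \<delta> x y < d" if x: "x \<in> F" for x
  proof (rule ccontr)
    assume *: "\<not> (\<exists>y\<in>L. \<delta> x y < d)"
    then have "x \<notin> L" using refl by auto
    have "separated \<delta> d (insert x L)"
      using L * sym by (auto simp: separated_def not_less)
    then have "card (insert x L) \<le> card L" using max x L by blast
    then show False using \<open>x \<notin> L\<close> finite_subset[OF L(1) fin] by simp
  qed
  then show ?thesis using L by blast
qed

lemma card_le_balls_mult_centres:
  assumes "finite F" "L \<subseteq> F" "\<forall>x\<in>F. \<exists>y\<in>L. \<delta> x y < (d::nat)"
    and ball: "\<And>y. y \<in> L \<Longrightarrow> card {x\<in>F. \<delta> x y < d} \<le> b"
  shows "card F \<le> b * card L"
proof -
  have "F \<subseteq> (\<Union>y\<in>L. {x\<in>F. \<delta> x y < d})" using assms by auto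
  then have "card F \<le> card (\<Union>y\<in>L. {x\<in>F. \<delta> x y < d})"
    using assms finite_subset[OF assms(2,1)] by (intro card_mono) auto
  also have "\<dots> \<le> (\<Sum>y\<in>L. card {x\<in>F. \<delta> x y < d})"
    using finite_subset[OF assms(2,1)] by (rule card_UN_le)
  also have "\<dots> \<le> (\<Sum>y\<in>L. b)" by (intro sum_mono ball)
  finally show ?thesis by (simp add: mult.commute)
qed

text \<open>
  Chaining: a ball of radius \<open>2 ^ (j + 1)\<close> is covered by balls of radius \<open>2 ^ j\<close> around the points of a
  maximal separated subset, which has at most \<open>B\<close> points because it is a packing at scale \<open>2 ^ j\<close>
  inside a ball of twice that radius. After \<open>j\<close> steps the balls are singletons.
\<close>
lemma card_le_power_local_packing:
  fixes \<delta> :: "'a \<Rightarrow> 'a \<Rightarrow> nat"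
  assumes fin: "finite F" and sym: "\<And>x y. \<delta> x y = \<delta> y x" and refl: "\<And>x. \<delta> x x = 0"
    and eq: "\<And>x y. x \<in> F \<Longrightarrow> y \<in> F \<Longrightarrow> \<delta> x y = 0 \<Longrightarrow> x = y"
    and B: "\<And>d z L. 1 \<le> d \<Longrightarrow> z \<in> F \<Longrightarrow> L \<subseteq> F \<Longrightarrow> separated \<delta> d L \<Longrightarrow>
      (\<And>x. x \<in> L \<Longrightarrow> \<delta> x z < 2 * d) \<Longrightarrow> card L \<le> B"
  shows "G \<subseteq> F \<Longrightarrow> z \<in> F \<Longrightarrow> (\<And>x. x \<in> G \<Longrightarrow> \<delta> x z < 2 ^ j) \<Longrightarrow> card G \<le> B ^ j"
proof (induction j arbitrary: G z)
  case 0
  then have "G \<subseteq> {z}" using eq by fastforce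
  then have "card G \<le> card {z}" by (intro card_mono) auto
  then show ?case by simp
next
  case (Suc j)
  have finG: "finite G" using fin Suc.prems finite_subset by blast
  have "\<exists>L\<subseteq>G. separated \<delta> (2 ^ j) L \<and> (\<forall>x\<in>G. \<exists>y\<in>L. \<delta> x y < 2 ^ j)"
    by (rule exists_covering_separated_subset[OF finG sym]) (simp add: refl)
  then obtain L where L: "L \<subseteq> G" "separated \<delta> (2 ^ j) L" "\<forall>x\<in>G. \<exists>y\<in>L. \<delta> x y < 2 ^ j"
    by blast
  have "card G \<le> B ^ j * card L"
  proof (rule card_le_balls_mult_centres[OF finG L(1,3)])
    fix y assume "y \<in> L"
    then show "card {x \<in> G. \<delta> x y < 2 ^ j} \<le> B ^ j"
      using L Suc.prems by (intro Suc.IH[of _ y]) auto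
  qed
  also have "card L \<le> B"
    using L Suc.prems by (intro B[of "2 ^ j" z]) auto
  finally show ?case by (simp add: mult.commute)
qed

text \<open>
  The largest local packing has the required size: apply chaining with its cardinality as \<open>B\<close>.
\<close>
lemma exists_local_packing:
  fixes \<delta> :: "'a \<Rightarrow> 'a \<Rightarrow> nat"
  assumes fin: "finite F" and "F \<noteq> {}" and sym: "\<And>x y. \<delta> x y = \<delta> y x" and refl: "\<And>x. \<delta> x x = 0"
    and eq: "\<And>x y. x \<in> F \<Longrightarrow> y \<in> F \<Longrightarrow> \<delta> x y = 0 \<Longrightarrow> x = y"
    and diam: "\<And>x y. x \<in> F \<Longrightarrow> y \<in> F \<Longrightarrow> \<delta> x y < 2 ^ J"
  obtains d z L where "1 \<le> d" "z \<in> F" "L \<subseteq> F" "separated \<delta> d L" "\<forall>x\<in>L. \<delta> x z < 2 * d"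
    "card F \<le> card L ^ J"
proof -
  define Q where "Q = (\<lambda>(d, z, L). 1 \<le> d \<and> z \<in> F \<and> L \<subseteq> F \<and> separated \<delta> d L \<and> (\<forall>x\<in>L. \<delta> x z < 2 * d))"
  obtain z0 where z0: "z0 \<in> F" using \<open>F \<noteq> {}\<close> by blast
  have "Q (1, z0, {})" using z0 by (simp add: Q_def separated_def)
  moreover have "\<forall>t. Q t \<longrightarrow> card (snd (snd t)) < Suc (card F)"
    using fin by (simp add: Q_def less_Suc_eq_le card_mono split: prod.splits)
  ultimately have "\<exists>t. Q t \<and> (\<forall>t'. Q t' \<longrightarrow> card (snd (snd t')) \<le> card (snd (snd t)))"
    by (rule ex_has_greatest_nat)
  then obtain t where "Q t \<and> (\<forall>t'. Q t' \<longrightarrow> card (snd (snd t')) \<le> card (snd (snd t)))" ..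
  then have t: "Q t" and max: "\<And>t'. Q t' \<Longrightarrow> card (snd (snd t')) \<le> card (snd (snd t))"
    by metis+
  obtain d z L where dzL: "t = (d, z, L)" by (cases t)
  have "card F \<le> card L ^ J"
  proof (rule card_le_power_local_packing[OF fin sym refl eq _ order_refl z0])
    fix d' z' L'
    assume "(1::nat) \<le> d'" "z' \<in> F" "L' \<subseteq> F" "separated \<delta> d' L'" "\<And>x. x \<in> L' \<Longrightarrow> \<delta> x z' < 2 * d'"
    then show "card L' \<le> card L" using max[of "(d', z', L')"] by (simp add: Q_def dzL)
  qed (use diam z0 in auto)
  then show thesis using t that[of d z L] unfolding Q_def dzL prod.case by simp
qed

definition sdist :: "nat set \<Rightarrow> nat set \<Rightarrow> nat" where
  "sdist S T = card (sym_diff S T)"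

lemma sdist_commute: "sdist S T = sdist T S"
  by (simp add: sdist_def Un_commute)

lemma sdist_self [simp]: "sdist S S = 0"
  by (simp add: sdist_def)

lemma sdist_eq_0: "finite S \<Longrightarrow> finite T \<Longrightarrow> sdist S T = 0 \<Longrightarrow> S = T"
  by (auto simp: sdist_def)

lemma sdist_le: "finite S \<Longrightarrow> finite T \<Longrightarrow> sdist S T \<le> card S + card T"
  unfolding sdist_def
  by (rule order_trans[OF card_Un_le], rule add_mono) (simp_all add: card_mono)

lemma sum_power_card_Pow:
  assumes "finite M"
  shows "(\<Sum>U\<in>Pow M. (x::real) ^ card U) = (1 + x) ^ card M"
  using assms
proof (induction M rule: finite_induct)
  case (insert a M)
  have inj: "inj_on (insert a) (Pow M)" using insert.hyps by (auto simp: inj_on_def)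
  have "(\<Sum>U\<in>Pow (insert a M). x ^ card U) = (\<Sum>U\<in>Pow M. x ^ card U) + (\<Sum>U\<in>insert a ` Pow M. x ^ card U)"
    unfolding Pow_insert using insert.hyps by (intro sum.union_disjoint) auto
  also have "(\<Sum>U\<in>insert a ` Pow M. x ^ card U) = (\<Sum>U\<in>Pow M. x * x ^ card U)"
    unfolding sum.reindex[OF inj]
  proof (rule sum.cong[OF refl])
    fix U assume "U \<in> Pow M"
    then have "finite U" "a \<notin> U" using insert.hyps finite_subset by auto
    then show "((\<lambda>U. x ^ card U) \<circ> insert a) U = x * x ^ card U" by simp
  qed
  finally show ?case using insert by (simp add: sum_distrib_left[symmetric] algebra_simps)
qed simp

text \<open>
  A Chernoff bound: a set of fewer than \<open>card M / 8\<close> elements has weight at least one under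
  \<open>(6 / 5) ^ card M * (1 / 4) ^ card U\<close>, because \<open>(6 / 5) ^ 8 \<ge> 4\<close>, and the total weight of all
  subsets is \<open>(6 / 5 * 5 / 4) ^ card M\<close>.
\<close>
lemma card_small_subsets:
  assumes "finite M"
  shows "real (card {U\<in>Pow M. 8 * card U < card M}) \<le> (3 / 2) ^ card M"
proof -
  let ?k = "card M" and ?S = "{U\<in>Pow M. 8 * card U < card M}"
  have "real (card ?S) = (\<Sum>U\<in>?S. 1)" by simp
  also have "\<dots> \<le> (\<Sum>U\<in>?S. (6 / 5) ^ ?k * (1 / 4) ^ card U)"
  proof (rule sum_mono)
    fix U assume "U \<in> ?S"
    then have "8 * card U \<le> ?k" by simp
    have "(1::real) \<le> ((6 / 5) ^ 8 * (1 / 4)) ^ card U" by (rule one_le_power) (simp add: power_divide)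
    also have "\<dots> = (6 / 5) ^ (8 * card U) * (1 / 4) ^ card U"
      unfolding power_mult_distrib power_mult ..
    also have "\<dots> \<le> (6 / 5) ^ ?k * (1 / 4) ^ card U"
      using \<open>8 * card U \<le> ?k\<close> by (intro mult_right_mono power_increasing) auto
    finally show "(1::real) \<le> (6 / 5) ^ ?k * (1 / 4) ^ card U" .
  qed
  also have "\<dots> \<le> (\<Sum>U\<in>Pow M. (6 / 5) ^ ?k * (1 / 4) ^ card U)"
    using assms by (intro sum_mono2) auto
  also have "\<dots> = (6 / 5) ^ ?k * (5 / 4) ^ ?k"
    using sum_power_card_Pow[OF assms, of "1 / 4"] by (simp add: sum_distrib_left[symmetric])
  also have "\<dots> = (3 / 2) ^ ?k" by (simp add: power_mult_distrib[symmetric])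
  finally show ?thesis .
qed

text \<open>
  A maximal separated family covers the \<open>2 ^ card M\<close> subsets by Hamming balls, each of which contains at
  most \<open>(3 / 2) ^ card M\<close> of them.
\<close>
lemma varshamov_gilbert:
  assumes fin: "finite M"
  shows "\<exists>L\<subseteq>Pow M. (\<forall>S\<in>L. \<forall>T\<in>L. S \<noteq> T \<longrightarrow> card M \<le> 8 * sdist S T) \<and> (4 / 3) ^ card M \<le> real (card L)"
proof (cases "card M = 0")
  case True
  then show ?thesis using fin by (intro exI[of _ "{{}}"]) auto
next
  case False
  let ?k = "card M"
  \<comment> \<open>The least \<open>d\<close> with \<open>?k \<le> 8 d\<close>.\<close>
  define d where "d = (?k + 7) div 8"
  have d: "1 \<le> d" "\<And>i. i < d \<Longrightarrow> 8 * i < ?k" "\<And>i. d \<le> i \<Longrightarrow> ?k \<le> 8 * i"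
    using False by (auto simp: d_def)
  have finP: "finite (Pow M)" using fin by simp
  have "\<exists>L\<subseteq>Pow M. separated sdist d L \<and> (\<forall>S\<in>Pow M. \<exists>T\<in>L. sdist S T < d)"
    by (rule exists_covering_separated_subset[OF finP sdist_commute]) (use d(1) in simp)
  then obtain L where L: "L \<subseteq> Pow M" "separated sdist d L" "\<forall>S\<in>Pow M. \<exists>T\<in>L. sdist S T < d"
    by blast
  have ball: "card {S\<in>Pow M. sdist S T < d} \<le> card {U\<in>Pow M. 8 * card U < ?k}" if "T \<in> L" for T
  proof (rule card_inj_on_le)
    show "inj_on (\<lambda>S. sym_diff S T) {S\<in>Pow M. sdist S T < d}"
      by (auto simp: inj_on_def set_eq_iff)
    show "(\<lambda>S. sym_diff S T) ` {S\<in>Pow M. sdist S T < d} \<subseteq> {U\<in>Pow M. 8 * card U < ?k}"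
      using L that d(2) by (auto simp: sdist_def)
  qed (use fin in auto)
  have "card (Pow M) \<le> card {U\<in>Pow M. 8 * card U < ?k} * card L"
    using finP L(1,3) ball by (rule card_le_balls_mult_centres)
  then have "2 ^ ?k \<le> card {U\<in>Pow M. 8 * card U < ?k} * card L"
    using fin by (simp add: card_Pow)
  then have "real (2 ^ ?k) \<le> real (card {U\<in>Pow M. 8 * card U < ?k} * card L)"
    by (rule of_nat_mono)
  also have "\<dots> \<le> (3 / 2) ^ ?k * real (card L)"
    using card_small_subsets[OF fin] by (simp add: mult_right_mono)
  finally have "(4 / 3) ^ ?k * (3 / 2) ^ ?k \<le> (3 / 2) ^ ?k * real (card L)"
    by (simp add: power_mult_distrib[symmetric])
  then have "(4 / 3) ^ ?k \<le> real (card L)" by (simp add: mult.commute)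
  then show ?thesis using L d(3) by (intro exI[of _ L]) (auto simp: separated_def)
qed

section \<open>Lower bounds from testing\<close>

lemma space_borel_vec [simp]: "space (borel_vec n) = carrier_vec n"
  by (simp add: borel_vec_def)

lemma vec_nth_measurable [measurable]:
  assumes "i < n"
  shows "(\<lambda>v. v $ i) \<in> borel_measurable (borel_vec n)"
proof -
  have "(\<lambda>v. \<lambda>i\<in>{..<n}. v $ i) \<in> borel_vec n \<rightarrow>\<^sub>M (\<Pi>\<^sub>M i\<in>{..<n}. (borel :: real measure))"
    unfolding borel_vec_def by (rule measurable_vimage_algebra1) (auto simp: space_PiM)
  from measurable_compose[OF this measurable_component_singleton[of i "{..<n}" "\<lambda>_. borel"]]
  show ?thesis using assms by simp
qed

lemma borel_vec_measurableI:
  assumes "\<And>x. x \<in> space N \<Longrightarrow> f x \<in> carrier_vec n"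
    and "\<And>i. i < n \<Longrightarrow> (\<lambda>x. f x $ i) \<in> borel_measurable N"
  shows "f \<in> N \<rightarrow>\<^sub>M borel_vec n"
  unfolding borel_vec_def
proof (rule measurable_vimage_algebra2)
  show "f \<in> space N \<rightarrow> carrier_vec n" using assms(1) by auto
  show "(\<lambda>x. \<lambda>i\<in>{..<n}. f x $ i) \<in> N \<rightarrow>\<^sub>M (\<Pi>\<^sub>M i\<in>{..<n}. borel)"
    using assms(2) by (intro measurable_restrict) auto
qed

lemma vec_measurable [measurable]: "vec n \<in> (\<Pi>\<^sub>M i\<in>{..<n}. (borel :: real measure)) \<rightarrow>\<^sub>M borel_vec n"
proof (rule borel_vec_measurableI)
  fix i assume i: "i < n"
  then have "(\<lambda>z. z i) \<in> borel_measurable (\<Pi>\<^sub>M i\<in>{..<n}. (borel :: real measure))"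
    by (intro measurable_component_singleton) auto
  then show "(\<lambda>z. vec n z $ i) \<in> borel_measurable (\<Pi>\<^sub>M i\<in>{..<n}. (borel :: real measure))"
    using i by simp
qed simp

lemma vec_measurable_normal_prod [measurable]: "vec n \<in> normal_prod n \<sigma> \<rightarrow>\<^sub>M borel_vec n"
  using vec_measurable measurable_cong_sets[OF sets_normal_prod refl] by blast

lemma sqnorm_diff_measurable:
  assumes g: "g \<in> N \<rightarrow>\<^sub>M borel_vec n" and \<theta>: "\<theta> \<in> carrier_vec n"
  shows "(\<lambda>x. sqnorm (g x - \<theta>)) \<in> borel_measurable N"
proof -
  have [measurable]: "(\<lambda>x. g x $ i) \<in> borel_measurable N" if "i < n" for i
    using measurable_compose[OF g vec_nth_measurable[OF that]] .
  have "g x \<in> carrier_vec n" if "x \<in> space N" for x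
    using measurable_space[OF g that] by simp
  then have "sqnorm (g x - \<theta>) = (\<Sum>i<n. (g x $ i - \<theta> $ i) * (g x $ i - \<theta> $ i))" if "x \<in> space N" for x
    using \<theta> that by (subst sqnorm_dot[of _ n]) (auto simp: dot_def)
  moreover have "(\<lambda>x. \<Sum>i<n. (g x $ i - \<theta> $ i) * (g x $ i - \<theta> $ i)) \<in> borel_measurable N"
    by measurable
  ultimately show ?thesis by (subst measurable_cong) auto
qed

lemma nn_integral_gaussian_noise:
  assumes "f \<in> borel_measurable (borel_vec n)"
  shows "(\<integral>\<^sup>+ \<epsilon>. f \<epsilon> \<partial>gaussian_noise n \<sigma>) = (\<integral>\<^sup>+ z. f (vec n z) \<partial>normal_prod n \<sigma>)"
  unfolding gaussian_noise_def by (rule nn_integral_distr[OF vec_measurable_normal_prod]) (use assms in simp)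

text \<open>
  Let \<open>N = card L\<close>. The balls of squared radius \<open>\<rho>\<close> around the means are disjoint, and an estimate
  outside the ball of the true mean costs at least \<open>\<rho>\<close>. Under the law of the common centre the
  probabilities of the balls sum to at most one; passing from that law to the law of \<open>\<theta> t\<close> costs the
  second moment \<open>exp (sqnorm (\<theta> t - z0) / \<sigma>\<^sup>2) \<le> sqrt N\<close> of the likelihood ratio. So the probabilities
  that the estimate falls in the right ball sum to at most \<open>N powr (3/4)\<close>, which for \<open>N \<ge> 2\<close> is less
  than \<open>7 N / 8\<close>.
\<close>
lemma testing_lower_bound:
  assumes \<sigma>: "\<sigma> > 0" and \<rho>: "\<rho> > 0" and L: "finite L" "2 \<le> card L"
    and \<theta>: "\<And>t. t \<in> L \<Longrightarrow> \<theta> t \<in> carrier_vec n" and z0: "z0 \<in> carrier_vec n"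
    and far: "\<And>s t. s \<in> L \<Longrightarrow> t \<in> L \<Longrightarrow> s \<noteq> t \<Longrightarrow> 4 * \<rho> \<le> sqnorm (\<theta> s - \<theta> t)"
    and near: "\<And>t. t \<in> L \<Longrightarrow> sqnorm (\<theta> t - z0) \<le> \<sigma>\<^sup>2 * ln (real (card L)) / 2"
    and g: "g \<in> borel_vec n \<rightarrow>\<^sub>M borel_vec n"
  shows "\<exists>t\<in>L. ennreal (\<rho> / 8) \<le> (\<integral>\<^sup>+ \<epsilon>. ennreal (sqnorm (g (\<theta> t + \<epsilon>) - \<theta> t)) \<partial>gaussian_noise n \<sigma>)"
proof (rule ccontr)
  assume neg: "\<not> ?thesis"
  define N where "N = real (card L)"
  have N: "N \<ge> 2" using L by (simp add: N_def)
  \<comment> \<open>This value balances the two terms in the bound for the sum of the \<open>pr t\<close> below.\<close>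
  define \<eta> where "\<eta> = N powr (-3/4)"
  have \<eta>: "\<eta> > 0" using N by (simp add: \<eta>_def)
  interpret P: prob_space "normal_prod n \<sigma>" by (rule prob_space_normal_prod[OF \<sigma>])
  let ?P = "normal_prod n \<sigma>" and ?B = "\<Pi>\<^sub>M i\<in>{..<n}. (borel :: real measure)"
  define hit where "hit t w \<longleftrightarrow> sqnorm (g (vec n w) - \<theta> t) < \<rho>" for t and w :: "nat \<Rightarrow> real"
  define h where "h t w = (if hit t w then 1 else 0 :: ennreal)" for t w
  have loss_meas: "(\<lambda>w. sqnorm (g (vec n w) - \<theta> t)) \<in> borel_measurable ?B" if "t \<in> L" for t
    using measurable_compose[OF vec_measurable g] \<theta>[OF that] by (rule sqnorm_diff_measurable)
  have h_meas: "h t \<in> borel_measurable ?B" if "t \<in> L" for t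
    using loss_meas[OF that] unfolding h_def[abs_def] hit_def by measurable
  have tr: "(\<lambda>z. \<lambda>i\<in>{..<n}. v i + z i) \<in> ?B \<rightarrow>\<^sub>M ?B" for v :: "nat \<Rightarrow> real"
    by measurable
  have gc: "g v \<in> carrier_vec n" if "v \<in> carrier_vec n" for v
    using measurable_space[OF g] that by simp
  \<comment> \<open>The balls are disjoint.\<close>
  have unique: "(\<Sum>t\<in>L. h t w) \<le> 1" for w
  proof (cases "\<exists>s\<in>L. hit s w")
    case True
    then obtain s where s: "s \<in> L" "hit s w" by blast
    have "\<not> hit t w" if t: "t \<in> L" "t \<noteq> s" for t
    proof
      assume "hit t w"
      let ?G = "($) (g (vec n w))"
      have c: "g (vec n w) \<in> carrier_vec n" using gc by simp
      have dt: "sqnorm (g (vec n w) - \<theta> r) = (\<Sum>i<n. (?G i - \<theta> r $ i)\<^sup>2)" if "r \<in> L" for r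
        using c \<theta>[OF that] by (subst sqnorm_dot[of _ n]) (auto simp: dot_def power2_eq_square)
      have "sqnorm (\<theta> s - \<theta> t) = (\<Sum>i<n. (\<theta> s $ i - \<theta> t $ i)\<^sup>2)"
        using \<theta>[OF s(1)] \<theta>[OF t(1)] by (subst sqnorm_dot[of _ n]) (auto simp: dot_def power2_eq_square)
      also have "\<dots> \<le> (\<Sum>i<n. 2 * (?G i - \<theta> s $ i)\<^sup>2 + 2 * (?G i - \<theta> t $ i)\<^sup>2)"
      proof (rule sum_mono)
        fix i
        have "0 \<le> ((?G i - \<theta> s $ i) + (?G i - \<theta> t $ i))\<^sup>2" by simp
        then show "(\<theta> s $ i - \<theta> t $ i)\<^sup>2 \<le> 2 * (?G i - \<theta> s $ i)\<^sup>2 + 2 * (?G i - \<theta> t $ i)\<^sup>2"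
          by (simp add: power2_eq_square algebra_simps)
      qed
      also have "\<dots> = 2 * sqnorm (g (vec n w) - \<theta> s) + 2 * sqnorm (g (vec n w) - \<theta> t)"
        using s t by (simp add: dt sum.distrib sum_distrib_left)
      also have "\<dots> < 4 * \<rho>" using s \<open>hit t w\<close> by (simp add: hit_def)
      finally show False using far[of s t] s t by simp
    qed
    then have "(\<Sum>t\<in>L. h t w) = (\<Sum>t\<in>L. if t = s then 1 else 0)"
      using s by (intro sum.cong) (auto simp: h_def)
    then show ?thesis using s L by simp
  qed (simp add: h_def)
  define pr where "pr t = (\<integral>\<^sup>+ z. h t (\<lambda>i\<in>{..<n}. \<theta> t $ i + z i) \<partial>?P)" for t
  define q where "q t = (\<integral>\<^sup>+ z. h t (\<lambda>i\<in>{..<n}. z0 $ i + z i) \<partial>?P)" for t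
  have hz_meas: "(\<lambda>z. h t (\<lambda>i\<in>{..<n}. v i + z i)) \<in> borel_measurable ?P" if "t \<in> L" for t and v
    using measurable_compose[OF tr[of v] h_meas[OF that]] by simp
  \<comment> \<open>Change of measure to the common centre, then \<open>l x \<le> (\<eta> l\<^sup>2 + x / \<eta>) / 2\<close> for \<open>x \<in> {0, 1}\<close>.\<close>
  have pr_le: "pr t \<le> ennreal (\<eta> / 2 * sqrt N) + ennreal (1 / (2 * \<eta>)) * q t" if t: "t \<in> L" for t
  proof -
    define a where "a i = \<theta> t $ i - z0 $ i" for i
    have aa: "dot n a a = sqnorm (\<theta> t - z0)"
      using \<theta>[OF t] z0 by (subst sqnorm_dot[of _ n]) (auto simp: dot_def a_def)
    have "dot n a a / \<sigma>\<^sup>2 \<le> ln N / 2"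
      using near[OF t] \<sigma> by (simp add: aa N_def field_simps)
    then have "exp (dot n a a / \<sigma>\<^sup>2) \<le> exp (ln N / 2)" by simp
    also have "\<dots> = sqrt N" using N by (simp add: powr_half_sqrt[symmetric] powr_def)
    finally have ea: "exp (dot n a a / \<sigma>\<^sup>2) \<le> sqrt N" .
    have d2: "dot n (\<lambda>i. 2 * a i) z = 2 * dot n a z" for z by (rule dot_scale_left)
    have d22: "dot n (\<lambda>i. 2 * a i) (\<lambda>i. 2 * a i) = 4 * dot n a a"
      using d2[of a] by (simp add: d2 dot_commute)
    define l where "l z = exp (dot n a z / \<sigma>\<^sup>2 - dot n a a / (2 * \<sigma>\<^sup>2))" for z
    have l_meas [measurable]: "l \<in> borel_measurable ?B" unfolding l_def[abs_def] by measurable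
    let ?H = "\<lambda>w. h t (\<lambda>i\<in>{..<n}. z0 $ i + w i)"
    have H_meas: "?H \<in> borel_measurable ?B" using measurable_compose[OF tr h_meas[OF t]] .
    have "pr t = (\<integral>\<^sup>+ z. ?H (\<lambda>i\<in>{..<n}. a i + z i) \<partial>?P)"
      unfolding pr_def by (intro nn_integral_cong arg_cong[of _ _ "h t"] ext) (simp add: a_def)
    also have "\<dots> = (\<integral>\<^sup>+ z. ennreal (l z) * ?H z \<partial>?P)"
      unfolding l_def by (rule nn_integral_normal_prod_shift[OF \<sigma> H_meas])
    also have "\<dots> \<le> (\<integral>\<^sup>+ z. ennreal (\<eta> / 2) * ennreal ((l z)\<^sup>2) + ennreal (1 / (2 * \<eta>)) * ?H z \<partial>?P)"
    proof (rule nn_integral_mono)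
      fix z
      have "0 \<le> (\<eta> * l z - 1)\<^sup>2 / (2 * \<eta>)" using \<eta> by simp
      also have "\<dots> = \<eta> / 2 * (l z)\<^sup>2 + 1 / (2 * \<eta>) - l z"
        using \<eta> by (simp add: power2_eq_square field_simps)
      finally have "l z \<le> \<eta> / 2 * (l z)\<^sup>2 + 1 / (2 * \<eta>)" by simp
      then have "ennreal (l z) \<le> ennreal (\<eta> / 2) * ennreal ((l z)\<^sup>2) + ennreal (1 / (2 * \<eta>))"
        using \<eta> by (simp add: ennreal_mult[symmetric] ennreal_plus[symmetric] ennreal_leI del: ennreal_plus)
      then show "ennreal (l z) * ?H z \<le> ennreal (\<eta> / 2) * ennreal ((l z)\<^sup>2) + ennreal (1 / (2 * \<eta>)) * ?H z"
        by (simp add: h_def)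
    qed
    also have "\<dots> = ennreal (\<eta> / 2) * (\<integral>\<^sup>+ z. ennreal ((l z)\<^sup>2) \<partial>?P) + ennreal (1 / (2 * \<eta>)) * q t"
      unfolding q_def using hz_meas[OF t, of "($) z0"]
      by (subst nn_integral_add) (auto simp: nn_integral_cmult)
    also have "(\<integral>\<^sup>+ z. ennreal ((l z)\<^sup>2) \<partial>?P) =
        (\<integral>\<^sup>+ z. ennreal (exp (- dot n a a / \<sigma>\<^sup>2)) * ennreal (exp (dot n (\<lambda>i. 2 * a i) z / \<sigma>\<^sup>2)) \<partial>?P)"
    proof (rule nn_integral_cong)
      fix z
      have "(l z)\<^sup>2 = exp (2 * (dot n a z / \<sigma>\<^sup>2 - dot n a a / (2 * \<sigma>\<^sup>2)))"
        unfolding l_def exp_double ..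
      also have "2 * (dot n a z / \<sigma>\<^sup>2 - dot n a a / (2 * \<sigma>\<^sup>2)) = - dot n a a / \<sigma>\<^sup>2 + 2 * dot n a z / \<sigma>\<^sup>2"
        using \<sigma> by (simp add: field_simps)
      finally show "ennreal ((l z)\<^sup>2) = ennreal (exp (- dot n a a / \<sigma>\<^sup>2)) * ennreal (exp (dot n (\<lambda>i. 2 * a i) z / \<sigma>\<^sup>2))"
        unfolding d2 by (simp only: exp_add ennreal_mult[OF exp_ge_zero exp_ge_zero])
    qed
    also have "\<dots> = ennreal (exp (- dot n a a / \<sigma>\<^sup>2)) * ennreal (exp (4 * dot n a a / (2 * \<sigma>\<^sup>2)))"
      by (subst nn_integral_cmult) (auto simp: nn_integral_exp_dot[OF \<sigma>] d22)
    also have "\<dots> = ennreal (exp (dot n a a / \<sigma>\<^sup>2))"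
      using \<sigma> by (simp add: ennreal_mult[symmetric] exp_add[symmetric] field_simps)
    finally have "pr t \<le> ennreal (\<eta> / 2) * ennreal (exp (dot n a a / \<sigma>\<^sup>2)) + ennreal (1 / (2 * \<eta>)) * q t" .
    also have "ennreal (\<eta> / 2) * ennreal (exp (dot n a a / \<sigma>\<^sup>2)) \<le> ennreal (\<eta> / 2 * sqrt N)"
      using ea \<eta> by (subst ennreal_mult[symmetric]) (auto intro!: ennreal_leI mult_left_mono)
    finally show ?thesis by (simp add: add_right_mono)
  qed
  have "(\<Sum>t\<in>L. q t) = (\<integral>\<^sup>+ z. (\<Sum>t\<in>L. h t (\<lambda>i\<in>{..<n}. z0 $ i + z i)) \<partial>?P)"
    unfolding q_def by (rule nn_integral_sum[symmetric]) (rule hz_meas)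
  also have "\<dots> \<le> (\<integral>\<^sup>+ z. 1 \<partial>?P)"
    by (intro nn_integral_mono unique)
  finally have q_sum: "(\<Sum>t\<in>L. q t) \<le> 1" using P.emeasure_space_1 by simp
  have "(\<Sum>t\<in>L. pr t) \<le> (\<Sum>t\<in>L. ennreal (\<eta> / 2 * sqrt N) + ennreal (1 / (2 * \<eta>)) * q t)"
    by (intro sum_mono pr_le)
  also have "\<dots> = ennreal N * ennreal (\<eta> / 2 * sqrt N) + ennreal (1 / (2 * \<eta>)) * (\<Sum>t\<in>L. q t)"
    by (simp add: sum.distrib sum_distrib_left N_def ennreal_of_nat_eq_real_of_nat)
  also have "\<dots> \<le> ennreal N * ennreal (\<eta> / 2 * sqrt N) + ennreal (1 / (2 * \<eta>)) * 1"
    using q_sum by (intro add_left_mono mult_left_mono) auto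
  also have "\<dots> = ennreal (N powr (3/4))"
  proof -
    have "N * (\<eta> / 2 * sqrt N) = (N powr 1 * N powr (-3/4) * N powr (1/2)) / 2"
      using N by (simp add: \<eta>_def powr_half_sqrt)
    also have "N powr 1 * N powr (-3/4) * N powr (1/2) = N powr (3/4)"
      unfolding powr_add[symmetric] by simp
    finally have 1: "N * (\<eta> / 2 * sqrt N) = N powr (3/4) / 2" .
    have 2: "1 / (2 * \<eta>) = N powr (3/4) / 2"
      using N by (simp add: \<eta>_def powr_minus field_simps)
    have "ennreal N * ennreal (\<eta> / 2 * sqrt N) + ennreal (1 / (2 * \<eta>)) * 1 =
        ennreal (N * (\<eta> / 2 * sqrt N) + 1 / (2 * \<eta>))"
      using N \<eta> by (simp add: ennreal_mult[symmetric] ennreal_plus[symmetric] del: ennreal_plus)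
    then show ?thesis unfolding 1 2 by simp
  qed
  finally have pr_sum: "(\<Sum>t\<in>L. pr t) \<le> ennreal (N powr (3/4))" .
  define R where "R t = (\<integral>\<^sup>+ \<epsilon>. ennreal (sqnorm (g (\<theta> t + \<epsilon>) - \<theta> t)) \<partial>gaussian_noise n \<sigma>)" for t
  have R_ge: "ennreal \<rho> \<le> R t + ennreal \<rho> * pr t" if t: "t \<in> L" for t
  proof -
    have sh: "(\<lambda>\<epsilon>. \<theta> t + \<epsilon>) \<in> borel_vec n \<rightarrow>\<^sub>M borel_vec n"
    proof (rule borel_vec_measurableI)
      fix i assume i: "i < n"
      have "(\<lambda>x. \<theta> t $ i + x $ i) \<in> borel_measurable (borel_vec n)" using i by measurable
      then show "(\<lambda>x. (\<theta> t + x) $ i) \<in> borel_measurable (borel_vec n)"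
        using i by (subst measurable_cong[of _ _ "\<lambda>x. \<theta> t $ i + x $ i"]) auto
    qed (use \<theta>[OF t] in auto)
    have m: "(\<lambda>\<epsilon>. sqnorm (g (\<theta> t + \<epsilon>) - \<theta> t)) \<in> borel_measurable (borel_vec n)"
      using measurable_compose[OF sh g] \<theta>[OF t] by (rule sqnorm_diff_measurable)
    have m': "(\<lambda>z. sqnorm (g (\<theta> t + vec n z) - \<theta> t)) \<in> borel_measurable ?P"
      using measurable_compose[OF vec_measurable_normal_prod m] .
    have Rt: "R t = (\<integral>\<^sup>+ z. ennreal (sqnorm (g (\<theta> t + vec n z) - \<theta> t)) \<partial>?P)"
      unfolding R_def using m by (intro nn_integral_gaussian_noise) simp
    have ev: "\<theta> t + vec n z = vec n (\<lambda>i\<in>{..<n}. \<theta> t $ i + z i)" for z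
      using \<theta>[OF t] by (intro eq_vecI) auto
    have "ennreal \<rho> = (\<integral>\<^sup>+ z. ennreal \<rho> \<partial>?P)" using P.emeasure_space_1 by simp
    also have "\<dots> \<le> (\<integral>\<^sup>+ z. ennreal (sqnorm (g (\<theta> t + vec n z) - \<theta> t)) +
        ennreal \<rho> * h t (\<lambda>i\<in>{..<n}. \<theta> t $ i + z i) \<partial>?P)"
      unfolding ev by (intro nn_integral_mono) (auto simp: h_def hit_def intro: ennreal_leI)
    also have "\<dots> = R t + ennreal \<rho> * pr t"
      unfolding Rt pr_def using m' hz_meas[OF t, of "($) (\<theta> t)"]
      by (subst nn_integral_add) (auto simp: nn_integral_cmult)
    finally show ?thesis .
  qed
  have R_small: "R t \<le> ennreal (\<rho> / 8)" if "t \<in> L" for t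
    using neg that by (auto simp: R_def not_le less_imp_le)
  have "ennreal (N * \<rho>) = (\<Sum>t\<in>L. ennreal \<rho>)"
    using \<rho> N by (simp add: N_def ennreal_mult ennreal_of_nat_eq_real_of_nat)
  also have "\<dots> \<le> (\<Sum>t\<in>L. ennreal (\<rho> / 8) + ennreal \<rho> * pr t)"
    by (rule sum_mono) (rule order_trans[OF R_ge add_right_mono[OF R_small]])
  also have "\<dots> = ennreal N * ennreal (\<rho> / 8) + ennreal \<rho> * (\<Sum>t\<in>L. pr t)"
    by (simp add: sum.distrib sum_distrib_left N_def ennreal_of_nat_eq_real_of_nat)
  also have "\<dots> \<le> ennreal N * ennreal (\<rho> / 8) + ennreal \<rho> * ennreal (N powr (3/4))"
    using pr_sum by (intro add_left_mono mult_left_mono) auto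
  also have "\<dots> = ennreal (N * (\<rho> / 8) + \<rho> * N powr (3/4))"
    using \<rho> N by (simp add: ennreal_mult[symmetric] ennreal_plus[symmetric] del: ennreal_plus)
  finally have "N * \<rho> \<le> N * (\<rho> / 8) + \<rho> * N powr (3/4)"
    using \<rho> N by (subst (asm) ennreal_le_iff) auto
  then have "\<rho> * (N * (7 / 8)) \<le> \<rho> * N powr (3/4)" by (simp add: algebra_simps)
  then have "N * (7 / 8) \<le> N powr (3/4)" using \<rho> by simp
  then have "(N * (7 / 8)) ^ 4 \<le> (N powr (3/4)) ^ 4" using N by (intro power_mono) auto
  also have "(N powr (3/4)) ^ 4 = N powr (3/4 + 3/4 + 3/4 + 3/4)"
    by (simp only: power4_eq_xxxx powr_add)
  also have "\<dots> = N ^ 3" using N by (simp add: powr_numeral)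
  finally have le: "(N * (7 / 8)) ^ 4 \<le> N ^ 3" .
  have "N ^ 4 = N * N ^ 3" using power_Suc[of N 3] by simp
  then have "N * (N ^ 3 * (7 / 8) ^ 4) \<le> N ^ 3" using le unfolding power_mult_distrib by simp
  moreover have "N * (N ^ 3 * (7 / 8) ^ 4) \<ge> 2 * (N ^ 3 * (7 / 8) ^ 4)"
    using N by (intro mult_right_mono) auto
  ultimately have "N ^ 3 * (2 * (7 / 8) ^ 4 - 1) \<le> 0" by (simp add: algebra_simps)
  moreover have "N ^ 3 * (2 * (7 / 8) ^ 4 - 1) > 0" using N by (simp add: power_divide)
  ultimately show False by simp
qed

lemma minimax_risk_ge_testing:
  assumes X: "X \<in> carrier_mat n p" and \<sigma>: "\<sigma> > 0" and \<rho>: "\<rho> > 0" and L: "finite L" "2 \<le> card L"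
    and \<beta>: "\<And>t. t \<in> L \<Longrightarrow> \<beta> t \<in> model_coeffs X \<M>" and b0: "b0 \<in> carrier_vec p"
    and far: "\<And>s t. s \<in> L \<Longrightarrow> t \<in> L \<Longrightarrow> s \<noteq> t \<Longrightarrow> 4 * \<rho> \<le> sqnorm (X *\<^sub>v (\<beta> s - \<beta> t))"
    and near: "\<And>t. t \<in> L \<Longrightarrow> sqnorm (X *\<^sub>v (\<beta> t - b0)) \<le> \<sigma>\<^sup>2 * ln (real (card L)) / 2"
  shows "ennreal (\<rho> / 8) \<le> minimax_risk X \<sigma> \<M>"
  unfolding minimax_risk_def
proof (rule INF_greatest)
  fix g assume "g \<in> borel_vec (dim_row X) \<rightarrow>\<^sub>M borel_vec (dim_row X)"
  then have g: "g \<in> borel_vec n \<rightarrow>\<^sub>M borel_vec n" using X by simp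
  have \<beta>c: "\<beta> t \<in> carrier_vec p" if "t \<in> L" for t
    using \<beta>[OF that] X by (simp add: model_coeffs_def)
  have "\<exists>t\<in>L. ennreal (\<rho> / 8) \<le>
      (\<integral>\<^sup>+ \<epsilon>. ennreal (sqnorm (g (X *\<^sub>v \<beta> t + \<epsilon>) - X *\<^sub>v \<beta> t)) \<partial>gaussian_noise n \<sigma>)"
  proof (rule testing_lower_bound[OF \<sigma> \<rho> L _ _ _ _ g])
    show "X *\<^sub>v \<beta> t \<in> carrier_vec n" if "t \<in> L" for t using X \<beta>c[OF that] by simp
    show "X *\<^sub>v b0 \<in> carrier_vec n" using X b0 by simp
    show "4 * \<rho> \<le> sqnorm (X *\<^sub>v \<beta> s - X *\<^sub>v \<beta> t)" if "s \<in> L" "t \<in> L" "s \<noteq> t" for s t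
      using far[OF that] mult_minus_distrib_mat_vec[OF X \<beta>c \<beta>c] that by simp
    show "sqnorm (X *\<^sub>v \<beta> t - X *\<^sub>v b0) \<le> \<sigma>\<^sup>2 * ln (real (card L)) / 2" if "t \<in> L" for t
      using near[OF that] mult_minus_distrib_mat_vec[OF X \<beta>c b0] that by simp
  qed
  then obtain t where t: "t \<in> L" "ennreal (\<rho> / 8) \<le> risk X \<sigma> g (\<beta> t)"
    using X by (auto simp: risk_def)
  note t(2)
  also have "risk X \<sigma> g (\<beta> t) \<le> max_risk X \<sigma> \<M> g"
    unfolding max_risk_def using \<beta>[OF t(1)] by (rule SUP_upper)
  finally show "ennreal (\<rho> / 8) \<le> max_risk X \<sigma> \<M> g" .
qed

section \<open>Sparse eigenvalues and the minimax risk\<close>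

text \<open>
  This bounds the set of sparse Rayleigh quotients, so that its infimum and supremum are genuine
  bounds.
\<close>
lemma sqnorm_mult_le_frobenius:
  assumes X: "X \<in> carrier_mat n p" and v: "v \<in> carrier_vec p"
  shows "sqnorm (X *\<^sub>v v) \<le> (\<Sum>i<n. \<Sum>j<p. (X $$ (i, j))\<^sup>2) * sqnorm v"
proof -
  have "sqnorm (X *\<^sub>v v) = (\<Sum>i<n. ((X *\<^sub>v v) $ i)\<^sup>2)"
    using X v by (subst sqnorm_dot[of _ n]) (auto simp: dot_def power2_eq_square)
  also have "\<dots> = (\<Sum>i<n. (\<Sum>j<p. v $ j * X $$ (i, j))\<^sup>2)"
    by (intro sum.cong refl) (simp only: lessThan_iff mult_mat_vec_nth[OF X v])
  also have "\<dots> \<le> (\<Sum>i<n. (\<Sum>j<p. (v $ j)\<^sup>2) * (\<Sum>j<p. (X $$ (i, j))\<^sup>2))"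
    by (intro sum_mono Cauchy_Schwarz_ineq_sum)
  also have "\<dots> = (\<Sum>i<n. \<Sum>j<p. (X $$ (i, j))\<^sup>2) * (\<Sum>j<p. (v $ j)\<^sup>2)"
    by (simp add: sum_distrib_left[symmetric] mult.commute)
  also have "(\<Sum>j<p. (v $ j)\<^sup>2) = sqnorm v"
    using v by (subst sqnorm_dot[of _ p]) (auto simp: dot_def power2_eq_square)
  finally show ?thesis .
qed

lemma vec_support_empty: "v \<in> carrier_vec p \<Longrightarrow> vec_support v = {} \<longleftrightarrow> v = 0\<^sub>v p"
  by (auto simp: vec_support_def)

lemma finite_vec_support [simp]: "finite (vec_support v)"
  by (simp add: vec_support_def)

lemma sqnorm_zero [simp]: "sqnorm (0\<^sub>v p) = 0"
  by (simp add: sqnorm_def)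

lemma sqnorm_pos:
  assumes "v \<in> carrier_vec p" "vec_support v \<noteq> {}"
  shows "sqnorm v > 0"
  using sqnorm_nonneg[of v] sqnorm_eq_0[OF assms(1)] assms vec_support_empty[OF assms(1)] by fastforce

lemma sparse_rayleigh_bounds:
  assumes X: "X \<in> carrier_mat n p" and v: "v \<in> carrier_vec p" and k: "card (vec_support v) \<le> k"
  shows "phi_min X k * sqnorm v \<le> sqnorm (X *\<^sub>v v)" "sqnorm (X *\<^sub>v v) \<le> phi_max X k * sqnorm v"
proof -
  define K where "K = (\<Sum>i<n. \<Sum>j<p. (X $$ (i, j))\<^sup>2)"
  have bounds: "0 \<le> q \<and> q \<le> K" if q: "q \<in> sparse_rayleigh X k" for q
  proof -
    obtain b where b: "b \<in> carrier_vec p" "1 \<le> card (vec_support b)" "q = sqnorm (X *\<^sub>v b) / sqnorm b"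
      using q X by (auto simp: sparse_rayleigh_def)
    have "vec_support b \<noteq> {}" using b(2) by auto
    then have "sqnorm b > 0" by (rule sqnorm_pos[OF b(1)])
    then show ?thesis
      using sqnorm_mult_le_frobenius[OF X b(1)] sqnorm_nonneg[of "X *\<^sub>v b"]
      by (simp add: b(3) K_def divide_le_eq)
  qed
  have bdd: "bdd_below (sparse_rayleigh X k)" "bdd_above (sparse_rayleigh X k)"
    by (rule bdd_belowI[of _ 0], use bounds in blast) (rule bdd_aboveI[of _ K], use bounds in blast)
  show "phi_min X k * sqnorm v \<le> sqnorm (X *\<^sub>v v)" "sqnorm (X *\<^sub>v v) \<le> phi_max X k * sqnorm v"
  proof (atomize (full), cases "vec_support v = {}")
    case True
    then have v0: "v = 0\<^sub>v p" using vec_support_empty[OF v] by simp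
    have "X *\<^sub>v v = 0\<^sub>v n" unfolding v0 using X by (intro eq_vecI) auto
    then show "phi_min X k * sqnorm v \<le> sqnorm (X *\<^sub>v v) \<and> sqnorm (X *\<^sub>v v) \<le> phi_max X k * sqnorm v"
      by (simp add: v0)
  next
    case False
    have pos: "sqnorm v > 0" by (rule sqnorm_pos[OF v False])
    have "1 \<le> card (vec_support v)" using False by (simp add: Suc_le_eq card_gt_0_iff)
    then have mem: "sqnorm (X *\<^sub>v v) / sqnorm v \<in> sparse_rayleigh X k"
      unfolding sparse_rayleigh_def using v X k by auto
    show "phi_min X k * sqnorm v \<le> sqnorm (X *\<^sub>v v) \<and> sqnorm (X *\<^sub>v v) \<le> phi_max X k * sqnorm v"
      using cInf_lower[OF mem bdd(1)] cSup_upper[OF mem bdd(2)] pos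
      by (simp add: phi_min_def phi_max_def pos_le_divide_eq pos_divide_le_eq)
  qed
qed

lemma sparse_ratio_bound:
  assumes X: "X \<in> carrier_mat n p" and k: "1 \<le> k" and p: "1 \<le> p"
    and \<delta>: "0 < \<delta>" "\<delta> \<le> sparse_ratio X k"
  shows "0 < phi_max X k" "\<delta> * phi_max X k \<le> phi_min X k"
proof -
  have "vec_support (unit_vec p 0 :: real vec) = {0}" using p by (auto simp: vec_support_def split: if_splits)
  then have e: "unit_vec p 0 \<in> carrier_vec p" "vec_support (unit_vec p 0 :: real vec) \<noteq> {}"
    "card (vec_support (unit_vec p 0 :: real vec)) \<le> k" using k by auto
  have "0 \<le> phi_max X k * sqnorm (unit_vec p 0)"
    using sparse_rayleigh_bounds(2)[OF X e(1,3)] sqnorm_nonneg[of "X *\<^sub>v unit_vec p 0"] by linarith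
  then have "0 \<le> phi_max X k" using sqnorm_pos[OF e(1,2)] by (simp add: zero_le_mult_iff)
  moreover have "phi_max X k \<noteq> 0" using \<delta> by (auto simp: sparse_ratio_def)
  ultimately show pos: "0 < phi_max X k" by simp
  then show "\<delta> * phi_max X k \<le> phi_min X k" using \<delta> by (simp add: sparse_ratio_def pos_le_divide_eq)
qed

lemma identifiable_of_phi_min:
  assumes X: "X \<in> carrier_mat n p" and pos: "0 < phi_min X r" and M: "finite M" "card M \<le> r"
  shows "identifiable X M"
  unfolding identifiable_def
proof (intro ballI impI)
  fix v assume v: "v \<in> carrier_vec (dim_col X)" "vec_support v \<subseteq> M" "X *\<^sub>v v = 0\<^sub>v (dim_row X)"
  have vc: "v \<in> carrier_vec p" using v X by simp
  have "card (vec_support v) \<le> r" using card_mono[OF M(1) v(2)] M by simp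
  then have "phi_min X r * sqnorm v \<le> 0" using sparse_rayleigh_bounds(1)[OF X vc] v(3) by fastforce
  then have "sqnorm v = 0" using pos sqnorm_nonneg[of v] by (simp add: mult_le_0_iff)
  then show "v = 0\<^sub>v (dim_col X)" using sqnorm_eq_0[OF vc] X by simp
qed

text \<open>
  Differences of the coefficient vectors used for the lower bounds have this form, with \<open>S\<close> a symmetric
  difference; their norms are thus Hamming distances.
\<close>
lemma sqnorm_signed_indicator:
  assumes "v \<in> carrier_vec p" "S \<subseteq> {..<p}"
    and "\<And>j. j \<in> S \<Longrightarrow> \<bar>v $ j\<bar> = a" and "\<And>j. j < p \<Longrightarrow> j \<notin> S \<Longrightarrow> v $ j = 0"
  shows "sqnorm v = a\<^sup>2 * real (card S)"
proof -
  have "sqnorm v = (\<Sum>j<p. (v $ j)\<^sup>2)"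
    using assms(1) by (subst sqnorm_dot[of _ p]) (auto simp: dot_def power2_eq_square)
  also have "\<dots> = (\<Sum>j\<in>S. (v $ j)\<^sup>2)"
    using assms by (intro sum.mono_neutral_right) auto
  also have "\<dots> = (\<Sum>j\<in>S. a\<^sup>2)"
    using assms(3) by (intro sum.cong refl) (metis power2_abs)
  finally show ?thesis by (simp add: mult.commute)
qed

text \<open>
  All coefficient vectors have support exactly \<open>M\<close>, with entries \<open>a\<close> and \<open>2 a\<close>, the latter on the members
  of a Varshamov--Gilbert family. The log-cardinality of the family is of order \<open>card M\<close>, so \<open>a\<close> can be
  taken of order \<open>\<sigma> / sqrt (phi_max X r)\<close>.
\<close>
lemma minimax_risk_ge_dimension:
  assumes X: "X \<in> carrier_mat n p" and \<sigma>: "\<sigma> > 0" and \<delta>: "\<delta> > 0"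
    and phi: "0 < phi_max X r" "\<delta> * phi_max X r \<le> phi_min X r"
    and M: "M \<in> \<M>" "M \<subseteq> {..<p}" "1 \<le> card M" "card M \<le> r"
  shows "ennreal (\<delta> * \<sigma>\<^sup>2 * real (card M) / 2048) \<le> minimax_risk X \<sigma> \<M>"
proof -
  let ?k = "card M"
  have fM: "finite M" using M(2) finite_subset by blast
  obtain L where L: "L \<subseteq> Pow M" "\<forall>S\<in>L. \<forall>T\<in>L. S \<noteq> T \<longrightarrow> ?k \<le> 8 * sdist S T" "(4 / 3) ^ ?k \<le> real (card L)"
    using varshamov_gilbert[OF fM] by blast
  have fL: "finite L" using L(1) fM finite_subset by blast
  have "(1::real) < (4 / 3) ^ ?k" using M(3) by (intro one_less_power) auto
  then have L2: "2 \<le> card L" using L(3) by linarith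
  have "exp (- (1 / 4) :: real) \<ge> 3 / 4" using exp_ge_add_one_self[of "- (1 / 4) :: real"] by simp
  then have "exp (1 / 4 :: real) \<le> 4 / 3" by (simp add: exp_minus field_simps)
  then have "exp (1 / 4 :: real) ^ ?k \<le> (4 / 3) ^ ?k" by (intro power_mono) auto
  then have "exp (real ?k / 4) \<le> real (card L)" using L(3) by (simp add: exp_of_nat_mult[symmetric])
  then have lnL: "real ?k / 4 \<le> ln (real (card L))" using L2 by (subst ln_ge_iff) auto
  \<comment> \<open>Chosen so that \<open>phi_max X r * a\<^sup>2 * ?k = \<sigma>\<^sup>2 * (?k / 4) / 2\<close>, the radius that the test allows.\<close>
  define a where "a = \<sigma> / sqrt (8 * phi_max X r)"
  have a: "a > 0" using \<sigma> phi by (simp add: a_def)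
  have a2: "a\<^sup>2 = \<sigma>\<^sup>2 / (8 * phi_max X r)" using phi by (simp add: a_def power_divide)
  define \<beta> where "\<beta> T = vec p (\<lambda>j. if j \<in> M then (if j \<in> T then 2 * a else a) else 0)" for T
  have \<beta>c: "\<beta> T \<in> carrier_vec p" for T by (simp add: \<beta>_def)
  have supp: "vec_support (\<beta> T) = M" for T
    using M(2) a by (auto simp: \<beta>_def vec_support_def split: if_splits)
  have diff: "sqnorm (\<beta> S - \<beta> T) = a\<^sup>2 * real (sdist S T)" "card (vec_support (\<beta> S - \<beta> T)) \<le> r"
    if "S \<subseteq> M" "T \<subseteq> M" for S T
  proof -
    have p: "j < p" if "j \<in> S \<or> j \<in> T" for j using that \<open>S \<subseteq> M\<close> \<open>T \<subseteq> M\<close> M(2) by blast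
    show "sqnorm (\<beta> S - \<beta> T) = a\<^sup>2 * real (sdist S T)"
      unfolding sdist_def
      by (rule sqnorm_signed_indicator) (use that p a in \<open>auto simp: \<beta>_def\<close>)
    have "vec_support (\<beta> S - \<beta> T) \<subseteq> M" by (auto simp: \<beta>_def vec_support_def split: if_splits)
    then show "card (vec_support (\<beta> S - \<beta> T)) \<le> r" using card_mono[OF fM] M(4) le_trans by blast
  qed
  have "ennreal ((\<delta> * \<sigma>\<^sup>2 * real ?k / 256) / 8) \<le> minimax_risk X \<sigma> \<M>"
  proof (rule minimax_risk_ge_testing[OF X \<sigma> _ fL L2, where \<beta> = \<beta> and ?b0.0 = "\<beta> {}"])
    show "0 < \<delta> * \<sigma>\<^sup>2 * real ?k / 256" using \<delta> \<sigma> M(3) by simp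
    show "\<beta> t \<in> model_coeffs X \<M>" for t
      using \<beta>c[of t] supp[of t] M(1) X by (simp add: model_coeffs_def)
    show "\<beta> {} \<in> carrier_vec p" by (rule \<beta>c)
  next
    fix S T assume ST: "S \<in> L" "T \<in> L" "S \<noteq> T"
    then have sub: "S \<subseteq> M" "T \<subseteq> M" using L(1) by auto
    have "4 * (\<delta> * \<sigma>\<^sup>2 * real ?k / 256) = \<delta> * phi_max X r * (a\<^sup>2 * (real ?k / 8))"
      using phi by (simp add: a2)
    also have "\<dots> \<le> phi_min X r * (a\<^sup>2 * real (sdist S T))"
    proof (rule mult_mono[OF phi(2)])
      have "real ?k / 8 \<le> real (sdist S T)" using L(2) ST by fastforce
      then show "a\<^sup>2 * (real ?k / 8) \<le> a\<^sup>2 * real (sdist S T)" by (rule mult_left_mono) simp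
      show "0 \<le> phi_min X r" using phi \<delta> by (meson less_imp_le mult_pos_pos order_trans)
    qed simp
    also have "\<dots> \<le> sqnorm (X *\<^sub>v (\<beta> S - \<beta> T))"
      using sparse_rayleigh_bounds(1)[OF X _ diff(2)[OF sub]] \<beta>c by (simp add: diff(1)[OF sub])
    finally show "4 * (\<delta> * \<sigma>\<^sup>2 * real ?k / 256) \<le> sqnorm (X *\<^sub>v (\<beta> S - \<beta> T))" .
  next
    fix T assume "T \<in> L"
    then have sub: "T \<subseteq> M" "{} \<subseteq> M" using L(1) by auto
    have "sqnorm (X *\<^sub>v (\<beta> T - \<beta> {})) \<le> phi_max X r * (a\<^sup>2 * real (sdist T {}))"
      using sparse_rayleigh_bounds(2)[OF X _ diff(2)[OF sub]] \<beta>c by (simp add: diff(1)[OF sub])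
    also have "\<dots> \<le> phi_max X r * (a\<^sup>2 * real ?k)"
      using phi card_mono[OF fM sub(1)] by (intro mult_left_mono) (auto simp: sdist_def)
    also have "\<dots> = \<sigma>\<^sup>2 * (real ?k / 4) / 2" using phi by (simp add: a2)
    also have "\<dots> \<le> \<sigma>\<^sup>2 * ln (real (card L)) / 2"
      using lnL by (intro divide_right_mono mult_left_mono) auto
    finally show "sqnorm (X *\<^sub>v (\<beta> T - \<beta> {})) \<le> \<sigma>\<^sup>2 * ln (real (card L)) / 2" .
  qed
  then show ?thesis by simp
qed

text \<open>
  The models of a local packing at scale \<open>d\<close> receive the constant coefficient \<open>a\<close>, with \<open>a\<^sup>2 d\<close>
  proportional to the log-cardinality of the packing: the means are then as close to the centre as the
  test allows, while their squared separation is of the order of that logarithm. Since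
  \<open>2 * k \<le> r\<close>, differences of coefficient vectors are sparse enough for the eigenvalue bounds.
\<close>
lemma minimax_risk_ge_ln_card:
  assumes X: "X \<in> carrier_mat n p" and \<sigma>: "\<sigma> > 0" and \<delta>: "\<delta> > 0"
    and phi: "0 < phi_max X r" "\<delta> * phi_max X r \<le> phi_min X r"
    and F: "F \<subseteq> \<M>" "F \<noteq> {}" "\<And>M. M \<in> F \<Longrightarrow> M \<subseteq> {..<p} \<and> card M = k" and k: "1 \<le> k" "2 * k \<le> r" "k \<le> p0"
  shows "ennreal (\<delta> * \<sigma>\<^sup>2 * ln (real (card F)) / (512 * max 1 (ln (real p0)))) \<le> minimax_risk X \<sigma> \<M>"
proof (cases "card F \<le> 1")
  case True
  then have "ln (real (card F)) = 0" by (cases "card F") auto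
  then show ?thesis by simp
next
  case False
  have fF: "finite F" using False by (metis card.infinite le0)
  have fin: "finite M" if "M \<in> F" for M using F(3)[OF that] finite_subset by blast
  obtain i where i: "2 ^ i \<le> 2 * k" "2 * k < 2 ^ (i + 1)"
    using ex_power_ivl1[of 2 "2 * k"] k by auto
  define J where "J = i + 1"
  have J: "2 * k < 2 ^ J" "2 ^ J \<le> 4 * k" using i by (auto simp: J_def)
  have diam: "sdist S T < 2 ^ J" if "S \<in> F" "T \<in> F" for S T
    using sdist_le[OF fin[OF that(1)] fin[OF that(2)]] F(3)[OF that(1)] F(3)[OF that(2)] J(1) by linarith
  have eq: "S = T" if "S \<in> F" "T \<in> F" "sdist S T = 0" for S T
    using sdist_eq_0 fin that by blast
  obtain d z L where d: "1 \<le> d" and z: "z \<in> F" and L: "L \<subseteq> F" "separated sdist d L"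
    "\<forall>x\<in>L. sdist x z < 2 * d" "card F \<le> card L ^ J"
    by (rule exists_local_packing[OF fF F(2), of sdist J])
      (rule sdist_commute sdist_self eq diam that; assumption)+
  have fL: "finite L" using L(1) fF finite_subset by blast
  have L2: "2 \<le> card L"
  proof (rule ccontr)
    assume "\<not> 2 \<le> card L"
    then have "card L ^ J \<le> 1 ^ J" by (intro power_mono) auto
    then show False using L(4) False by simp
  qed
  define l where "l = ln (real (card L))"
  have l: "l > 0" using L2 by (simp add: l_def)
  define H where "H = max 1 (ln (real p0))"
  have "ln (real k) \<le> ln (real p0)" using k by simp
  then have H: "1 \<le> H" "ln (real k) \<le> H" by (simp_all add: H_def le_max_iff_disj)
  have lnF: "ln (real (card F)) \<le> 4 * H * l"
  proof -
    have "ln (real (card F)) \<le> ln (real (card L ^ J))"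
      using L(4) False L2 by (subst ln_le_cancel_iff) (auto simp del: of_nat_power simp flip: of_nat_le_iff)
    also have "\<dots> = real J * l" using L2 by (simp add: l_def ln_realpow)
    finally have 1: "ln (real (card F)) \<le> real J * l" .
    have "real (2 ^ J) \<le> real (4 * k)" using J(2) by (rule of_nat_mono)
    then have "ln (2 ^ J) \<le> ln (4 * real k)" using k by (subst ln_le_cancel_iff) auto
    then have "real J * ln 2 \<le> ln 4 + ln (real k)" using k by (simp add: ln_realpow ln_mult)
    also have "ln (4::real) = 2 * ln 2" using ln_realpow[of 2 2] by simp
    finally have "(real J - 2) * ln 2 \<le> H" using H by (simp add: algebra_simps)
    moreover have "2 / 3 \<le> (ln 2 :: real)" by (rule ln2_ge_two_thirds)
    ultimately have "real J \<le> 4 * H"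
    proof -
      have "real J \<le> 4 * H" if "real J > 2"
      proof -
        have "(real J - 2) * (2 / 3) \<le> (real J - 2) * ln 2"
          using that \<open>2 / 3 \<le> (ln 2 :: real)\<close> by (intro mult_left_mono) auto
        then show ?thesis using \<open>(real J - 2) * ln 2 \<le> H\<close> H(1) by simp
      qed
      then show ?thesis using H(1) by (cases "real J > 2") auto
    qed
    then have "real J * l \<le> 4 * H * l" using l by (intro mult_right_mono) auto
    then show ?thesis using 1 by simp
  qed
  \<comment> \<open>Chosen so that \<open>phi_max X r * a\<^sup>2 * (2 * d) = \<sigma>\<^sup>2 * l / 2\<close>, the radius that the test allows.\<close>
  define a where "a = sqrt (\<sigma>\<^sup>2 * l / (4 * d * phi_max X r))"
  have a2: "a\<^sup>2 = \<sigma>\<^sup>2 * l / (4 * d * phi_max X r)" using phi l by (simp add: a_def)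
  have a: "a > 0" using \<sigma> phi l d by (simp add: a_def)
  define \<beta> where "\<beta> T = vec p (\<lambda>j. if j \<in> T then a else 0)" for T
  have \<beta>c: "\<beta> T \<in> carrier_vec p" for T by (simp add: \<beta>_def)
  have supp: "vec_support (\<beta> T) = T" if "T \<in> F" for T
    using F(3)[OF that] a by (auto simp: \<beta>_def vec_support_def split: if_splits)
  have diff: "sqnorm (\<beta> S - \<beta> T) = a\<^sup>2 * real (sdist S T)" "card (vec_support (\<beta> S - \<beta> T)) \<le> r"
    if ST: "S \<in> F" "T \<in> F" for S T
  proof -
    have sub: "S \<subseteq> {..<p}" "T \<subseteq> {..<p}" using F(3) ST by auto
    have p: "j < p" if "j \<in> S \<or> j \<in> T" for j using that sub by blast
    show "sqnorm (\<beta> S - \<beta> T) = a\<^sup>2 * real (sdist S T)"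
      unfolding sdist_def
      by (rule sqnorm_signed_indicator) (use p a in \<open>auto simp: \<beta>_def\<close>)
    have "vec_support (\<beta> S - \<beta> T) \<subseteq> S \<union> T" by (auto simp: \<beta>_def vec_support_def split: if_splits)
    then have "card (vec_support (\<beta> S - \<beta> T)) \<le> card (S \<union> T)" using fin ST by (intro card_mono) auto
    also have "\<dots> \<le> card S + card T" by (rule card_Un_le)
    finally show "card (vec_support (\<beta> S - \<beta> T)) \<le> r" using F(3) ST k by auto
  qed
  have "ennreal ((\<delta> * \<sigma>\<^sup>2 * l / 16) / 8) \<le> minimax_risk X \<sigma> \<M>"
  proof (rule minimax_risk_ge_testing[OF X \<sigma> _ fL L2, where \<beta> = \<beta> and ?b0.0 = "\<beta> z"])
    show "0 < \<delta> * \<sigma>\<^sup>2 * l / 16" using \<delta> \<sigma> l by simp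
    show "\<beta> T \<in> model_coeffs X \<M>" if "T \<in> L" for T
    proof -
      have "T \<in> F" "T \<in> \<M>" using that F(1) L(1) by auto
      then show ?thesis using \<beta>c[of T] supp[of T] X by (simp add: model_coeffs_def)
    qed
    show "\<beta> z \<in> carrier_vec p" by (rule \<beta>c)
  next
    fix S T assume ST: "S \<in> L" "T \<in> L" "S \<noteq> T"
    then have sub: "S \<in> F" "T \<in> F" using L(1) by auto
    have "4 * (\<delta> * \<sigma>\<^sup>2 * l / 16) = \<delta> * phi_max X r * (a\<^sup>2 * real d)"
      using phi d by (simp add: a2)
    also have "\<dots> \<le> phi_min X r * (a\<^sup>2 * real (sdist S T))"
    proof (rule mult_mono[OF phi(2)])
      have "real d \<le> real (sdist S T)" using L(2) ST by (simp add: separated_def)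
      then show "a\<^sup>2 * real d \<le> a\<^sup>2 * real (sdist S T)" by (rule mult_left_mono) simp
      show "0 \<le> phi_min X r" using phi \<delta> by (meson less_imp_le mult_pos_pos order_trans)
    qed simp
    also have "\<dots> \<le> sqnorm (X *\<^sub>v (\<beta> S - \<beta> T))"
      using sparse_rayleigh_bounds(1)[OF X _ diff(2)[OF sub]] \<beta>c by (simp add: diff(1)[OF sub])
    finally show "4 * (\<delta> * \<sigma>\<^sup>2 * l / 16) \<le> sqnorm (X *\<^sub>v (\<beta> S - \<beta> T))" .
  next
    fix T assume T: "T \<in> L"
    then have sub: "T \<in> F" "z \<in> F" using L(1) z by auto
    have "sqnorm (X *\<^sub>v (\<beta> T - \<beta> z)) \<le> phi_max X r * (a\<^sup>2 * real (sdist T z))"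
      using sparse_rayleigh_bounds(2)[OF X _ diff(2)[OF sub]] \<beta>c by (simp add: diff(1)[OF sub])
    also have "\<dots> \<le> phi_max X r * (a\<^sup>2 * (2 * real d))"
    proof -
      have "sdist T z \<le> 2 * d" using L(3) T by fastforce
      then have "real (sdist T z) \<le> 2 * real d" by simp
      then show ?thesis using phi by (intro mult_left_mono) auto
    qed
    also have "\<dots> = \<sigma>\<^sup>2 * ln (real (card L)) / 2" using phi d by (simp add: a2 l_def)
    finally show "sqnorm (X *\<^sub>v (\<beta> T - \<beta> z)) \<le> \<sigma>\<^sup>2 * ln (real (card L)) / 2" .
  qed
  moreover have "\<delta> * \<sigma>\<^sup>2 * ln (real (card F)) / (512 * H) \<le> (\<delta> * \<sigma>\<^sup>2 * l / 16) / 8"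
  proof -
    have "\<delta> * \<sigma>\<^sup>2 * ln (real (card F)) \<le> \<delta> * \<sigma>\<^sup>2 * (4 * H * l)"
      using lnF \<delta> by (intro mult_left_mono) auto
    then show ?thesis using H(1) by (simp add: field_simps)
  qed
  ultimately show ?thesis unfolding H_def[symmetric] by (meson ennreal_leI order_trans)
qed

text \<open>
  A weighted mean of the two previous bounds, with weights \<open>2048 / 2560\<close> and \<open>512 / 2560\<close>, is at most
  their maximum.
\<close>
lemma minimax_risk_lower_bound:
  assumes X: "X \<in> carrier_mat n p" and \<sigma>: "\<sigma> > 0" and \<delta>: "\<delta> > 0"
    and phi: "0 < phi_max X r" "\<delta> * phi_max X r \<le> phi_min X r"
    and A: "\<And>M. M \<in> A \<Longrightarrow> M \<subseteq> {..<p}"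
    and M: "M \<in> A" "1 \<le> card M" "card M \<le> p0" "2 * card M \<le> r"
  shows "ennreal (\<delta> * \<sigma>\<^sup>2 * (real (card M) + ln (real (num_models A (card M)))) / (2560 * max 1 (ln (real p0))))
    \<le> minimax_risk X \<sigma> (models_upto A p0)"
proof -
  let ?k = "card M" and ?R = "minimax_risk X \<sigma> (models_upto A p0)"
  define H where "H = max 1 (ln (real p0))"
  define m where "m = ln (real (num_models A ?k))"
  have H: "1 \<le> H" by (simp add: H_def)
  have dim: "ennreal (\<delta> * \<sigma>\<^sup>2 * real ?k / 2048) \<le> ?R"
    using M A by (intro minimax_risk_ge_dimension[OF X \<sigma> \<delta> phi]) (auto simp: models_upto_def)
  have ent: "ennreal (\<delta> * \<sigma>\<^sup>2 * m / (512 * H)) \<le> ?R"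
    unfolding m_def num_models_def H_def
    using M A by (intro minimax_risk_ge_ln_card[OF X \<sigma> \<delta> phi, where k = ?k]) (auto simp: models_upto_def)
  let ?L = "\<delta> * \<sigma>\<^sup>2 * (real ?k + m) / (2560 * H)" and ?a = "\<delta> * \<sigma>\<^sup>2 * real ?k / 2048"
    and ?b = "\<delta> * \<sigma>\<^sup>2 * m / (512 * H)"
  have "?L \<le> max ?a ?b"
  proof -
    have "?L = \<delta> * \<sigma>\<^sup>2 * real ?k / 2560 / H + \<delta> * \<sigma>\<^sup>2 * m / (2560 * H)"
      by (simp add: distrib_left add_divide_distrib)
    also have "\<dots> \<le> \<delta> * \<sigma>\<^sup>2 * real ?k / 2560 / 1 + \<delta> * \<sigma>\<^sup>2 * m / (2560 * H)"
      using H \<delta> by (intro add_right_mono divide_left_mono) auto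
    also have "\<dots> = 2048 / 2560 * ?a + 512 / 2560 * ?b"
      using H by (simp add: field_simps)
    also have "\<dots> \<le> 2048 / 2560 * max ?a ?b + 512 / 2560 * max ?a ?b"
      by (intro add_mono mult_left_mono) auto
    also have "\<dots> = max ?a ?b" by simp
    finally show ?thesis .
  qed
  then consider "?L \<le> ?a" | "?L \<le> ?b" by (auto simp: le_max_iff_disj)
  then have "ennreal ?L \<le> ?R"
  proof cases
    case 1
    then show ?thesis using dim by (meson ennreal_leI order_trans)
  next
    case 2
    then show ?thesis using ent by (meson ennreal_leI order_trans)
  qed
  then show ?thesis unfolding m_def H_def .
qed

section \<open>The risk of the MAP estimator\<close>

text \<open>
  The penalty of the MAP criterion with its logarithm expanded, so that its growth in
  \<open>ln (m / \<pi>)\<close> and in the model size can be read off.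
\<close>
definition penalty :: "nat set set \<Rightarrow> nat pmf \<Rightarrow> real \<Rightarrow> real \<Rightarrow> nat set \<Rightarrow> real" where
  "penalty A \<pi> \<sigma> \<gamma> M = 2 * \<sigma>\<^sup>2 * (1 + 1 / \<gamma>) *
     (ln (real (num_models A (card M)) / pmf \<pi> (card M)) + real (card M) / 2 * ln (1 + \<gamma>))"

lemma penalty_eq:
  assumes "\<gamma> > 0" "num_models A (card M) > 0" "pmf \<pi> (card M) > 0"
  shows "2 * \<sigma>\<^sup>2 * (1 + 1 / \<gamma>) *
       ln (real (num_models A (card M)) * inverse (pmf \<pi> (card M)) * (1 + \<gamma>) powr (real (card M) / 2)) =
     penalty A \<pi> \<sigma> \<gamma> M"
proof -
  have "ln (real (num_models A (card M)) * inverse (pmf \<pi> (card M)) * (1 + \<gamma>) powr (real (card M) / 2)) =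
      ln (real (num_models A (card M)) * inverse (pmf \<pi> (card M))) + ln ((1 + \<gamma>) powr (real (card M) / 2))"
    using assms by (intro ln_mult_pos mult_pos_pos) auto
  then show ?thesis
    using assms(1) unfolding penalty_def divide_inverse by (simp add: ln_powr)
qed

text \<open>
  The column index \<open>p\<close>, which no model contains, stands for the mean \<open>X *\<^sub>v b\<close> itself: the error of the
  fit is a combination of the selected columns and of the mean.
\<close>
lemma map_oracle_inequality:
  assumes X: "X \<in> carrier_mat n p" and A: "\<And>M. M \<in> A \<Longrightarrow> M \<subseteq> {..<p}"
    and ident: "\<And>M. M \<in> A \<Longrightarrow> identifiable X M"
    and pos: "\<gamma> > 0" "\<And>M. M \<in> A \<Longrightarrow> 0 < num_models A (card M) \<and> 0 < pmf \<pi> (card M)"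
    and sel: "is_map_selection X A \<pi> \<sigma> \<gamma> sel"
    and M0: "M0 \<in> A" and b: "b \<in> carrier_vec p" "vec_support b \<subseteq> M0"
    and \<epsilon>: "\<epsilon> \<in> carrier_vec n" and \<theta>: "\<theta> > 0"
    and u: "orthonormal n d u"
      "covers_span n d u (insert p (sel (X *\<^sub>v b + \<epsilon>))) (\<lambda>j i. if j = p then (X *\<^sub>v b) $ i else X $$ (i, j))"
  shows "(1 - \<theta>) * sqnorm (map_estimator X sel (X *\<^sub>v b + \<epsilon>) - X *\<^sub>v b) \<le> penalty A \<pi> \<sigma> \<gamma> M0 +
      ((\<Sum>a<d. (dot n (u a) (($) \<epsilon>))\<^sup>2) / \<theta> - penalty A \<pi> \<sigma> \<gamma> (sel (X *\<^sub>v b + \<epsilon>)))"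
proof -
  define \<mu> where "\<mu> = X *\<^sub>v b"
  define y where "y = \<mu> + \<epsilon>"
  define M where "M = sel y"
  define l where "l = lse X M y"
  define f where "f = X *\<^sub>v l"
  have \<mu>: "\<mu> \<in> carrier_vec n" using X b by (simp add: \<mu>_def)
  have y: "y \<in> carrier_vec n" using \<mu> \<epsilon> by (simp add: y_def)
  have amin: "is_arg_min (map_criterion X A \<pi> \<sigma> \<gamma> y) (\<lambda>M. M \<in> A) M"
    using sel y X by (auto simp: is_map_selection_def M_def)
  then have MA: "M \<in> A" by (simp add: is_arg_min_def)
  have crit: "map_criterion X A \<pi> \<sigma> \<gamma> y M \<le> map_criterion X A \<pi> \<sigma> \<gamma> y M0"
    using amin M0 by (auto simp: is_arg_min_def not_less)
  have cr: "map_criterion X A \<pi> \<sigma> \<gamma> y M' = sqnorm (y - X *\<^sub>v lse X M' y) + penalty A \<pi> \<sigma> \<gamma> M'"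
    if "M' \<in> A" for M'
    unfolding map_criterion_def using penalty_eq[OF pos(1)] pos(2)[OF that] by simp
  have "sqnorm (y - f) + penalty A \<pi> \<sigma> \<gamma> M \<le> sqnorm (y - X *\<^sub>v lse X M0 y) + penalty A \<pi> \<sigma> \<gamma> M0"
    using crit by (simp add: cr[OF MA] cr[OF M0] f_def l_def)
  also have "sqnorm (y - X *\<^sub>v lse X M0 y) \<le> sqnorm (y - \<mu>)"
    unfolding \<mu>_def by (rule lse_minimises[OF X y ident[OF M0] b])
  also have "y - \<mu> = \<epsilon>" using \<mu> \<epsilon> by (auto simp: y_def)
  finally have basic: "sqnorm (y - f) + penalty A \<pi> \<sigma> \<gamma> M \<le> sqnorm \<epsilon> + penalty A \<pi> \<sigma> \<gamma> M0" by simp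
  note L = lse_normal_equations[OF X y ident[OF MA]]
  have l: "l \<in> carrier_vec p" "vec_support l \<subseteq> M" using L(1,2) by (simp_all add: l_def)
  have f: "f \<in> carrier_vec n" using X l by (simp add: f_def)
  define x where "x i = f $ i - \<mu> $ i" for i
  have xx: "sqnorm (f - \<mu>) = dot n x x"
    using f \<mu> by (subst sqnorm_dot[of _ n]) (auto simp: dot_def x_def)
  have "sqnorm (y - f) = (\<Sum>i<n. (\<epsilon> $ i - x i)\<^sup>2)"
    using y f \<mu> \<epsilon> by (subst sqnorm_dot[of _ n]) (auto simp: dot_def x_def y_def power2_eq_square algebra_simps)
  also have "\<dots> = sqnorm \<epsilon> - 2 * dot n x (($) \<epsilon>) + dot n x x"
    unfolding sqnorm_dot[OF \<epsilon>]
    by (simp add: dot_def power2_eq_square algebra_simps sum.distrib sum_subtractf sum_distrib_left)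
  finally have yf: "sqnorm (y - f) = sqnorm \<epsilon> - 2 * dot n x (($) \<epsilon>) + dot n x x" .
  have "\<exists>c. \<forall>i<n. x i = (\<Sum>a<d. c a * u a i)"
  proof -
    have pM: "p \<notin> M" "finite M" using A[OF MA] finite_subset by auto
    have "x i = (\<Sum>j\<in>insert p M. (if j = p then -1 else l $ j) * (if j = p then \<mu> $ i else X $$ (i, j)))"
      if i: "i < n" for i
    proof -
      have "(\<Sum>j\<in>M. (if j = p then -1 else l $ j) * (if j = p then \<mu> $ i else X $$ (i, j))) = (\<Sum>j\<in>M. l $ j * X $$ (i, j))"
        using pM by (intro sum.cong) auto
      then show ?thesis
        using pM mult_mat_vec_nth_support[OF X l(1) i l(2) A[OF MA]] by (simp add: x_def f_def)
    qed
    then have "\<forall>i<n. x i = (\<Sum>j\<in>insert p (sel (X *\<^sub>v b + \<epsilon>)). (if j = p then -1 else l $ j) * (if j = p then (X *\<^sub>v b) $ i else X $$ (i, j)))"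
      unfolding M_def y_def \<mu>_def by blast
    then show ?thesis
      by (rule covers_spanD[OF u(2)])
  qed
  then obtain c where c: "\<forall>i<n. x i = (\<Sum>a<d. c a * u a i)" by blast
  have "2 * dot n x (($) \<epsilon>) \<le> \<theta> * dot n x x + (\<Sum>a<d. (dot n (u a) (($) \<epsilon>))\<^sup>2) / \<theta>"
    by (rule two_dot_le_orthonormal[OF u(1) c \<theta>])
  then have "(1 - \<theta>) * sqnorm (f - \<mu>) \<le> penalty A \<pi> \<sigma> \<gamma> M0 +
      ((\<Sum>a<d. (dot n (u a) (($) \<epsilon>))\<^sup>2) / \<theta> - penalty A \<pi> \<sigma> \<gamma> M)"
    using basic unfolding yf xx by (simp add: algebra_simps)
  then show "(1 - \<theta>) * sqnorm (map_estimator X sel (X *\<^sub>v b + \<epsilon>) - X *\<^sub>v b) \<le> penalty A \<pi> \<sigma> \<gamma> M0 +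
      ((\<Sum>a<d. (dot n (u a) (($) \<epsilon>))\<^sup>2) / \<theta> - penalty A \<pi> \<sigma> \<gamma> (sel (X *\<^sub>v b + \<epsilon>)))"
    unfolding map_estimator_def f_def l_def M_def y_def \<mu>_def .
qed

text \<open>
  Let \<open>l = ln (m(k) / \<pi>(k))\<close> for \<open>k = card M\<close>. On the left the logarithm of the damping is
  \<open>- (1 + \<kappa>) (l + k ln (1 + \<gamma>) / 2)\<close> with \<open>\<kappa> = 1 / (4 \<gamma>)\<close>. Its part with coefficient one yields \<open>exp (- l)\<close>
  and cancels \<open>(1 + \<gamma>) ^ (k / 2)\<close>, and the surplus \<open>\<kappa> l \<ge> \<kappa> c_gamma \<gamma> k \<ge> 6 k\<close>, provided by the upper bound on
  the prior, cancels the remaining \<open>2 ^ (k / 2)\<close>.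
\<close>
lemma penalised_exponential_moment:
  assumes \<gamma>: "\<gamma> > 0" and \<sigma>: "\<sigma> > 0" and \<pi>: "pmf \<pi> (card M) > 0" and m: "num_models A (card M) > 0"
    and k: "card M \<noteq> 0 \<Longrightarrow> pmf \<pi> (card M) \<le> real (num_models A (card M)) * exp (- c_gamma \<gamma> * real (card M))"
    and d: "d \<le> card M + 1"
  shows "sqrt (2 * (1 + \<gamma>)) ^ d * exp (- ((4 * \<gamma> + 1) / (8 * (\<gamma> + 1)) * penalty A \<pi> \<sigma> \<gamma> M / \<sigma>\<^sup>2)) \<le>
    sqrt (2 * (1 + \<gamma>)) * (pmf \<pi> (card M) / real (num_models A (card M)))"
proof -
  let ?k = "real (card M)" and ?m = "real (num_models A (card M))" and ?q = "sqrt (2 * (1 + \<gamma>))"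
  define \<kappa> where "\<kappa> = 1 / (4 * \<gamma>)"
  define l where "l = ln (?m / pmf \<pi> (card M))"
  have \<kappa>: "\<kappa> > 0" using \<gamma> by (simp add: \<kappa>_def)
  have l: "c_gamma \<gamma> * ?k \<le> l"
  proof (cases "card M = 0")
    case True
    have "1 \<le> ?m" using m by simp
    then have "pmf \<pi> (card M) \<le> ?m" using pmf_le_1[of \<pi> "card M"] by linarith
    then show ?thesis using True \<pi> by (simp add: l_def pos_le_divide_eq)
  next
    case False
    have "exp (c_gamma \<gamma> * ?k) \<le> ?m / pmf \<pi> (card M)"
      using k[OF False] \<pi> m by (simp add: pos_le_divide_eq exp_minus field_simps)
    then show ?thesis unfolding l_def using m \<pi> by (subst ln_ge_iff) auto
  qed
  have pen: "(4 * \<gamma> + 1) / (8 * (\<gamma> + 1)) * penalty A \<pi> \<sigma> \<gamma> M / \<sigma>\<^sup>2 = (1 + \<kappa>) * (l + ?k / 2 * ln (1 + \<gamma>))"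
  proof -
    have "(4 * \<gamma> + 1) / (8 * (\<gamma> + 1)) * (2 * \<sigma>\<^sup>2 * (1 + 1 / \<gamma>)) / \<sigma>\<^sup>2 = 1 + \<kappa>"
    proof -
      define g where "g = \<gamma> + 1"
      have "\<gamma> \<noteq> 0" "g \<noteq> 0" "\<sigma>\<^sup>2 \<noteq> 0" using \<gamma> \<sigma> by (auto simp: g_def)
      then have "(4 * \<gamma> + 1) / (8 * (\<gamma> + 1)) * (2 * \<sigma>\<^sup>2 * ((\<gamma> + 1) / \<gamma>)) / \<sigma>\<^sup>2 = (4 * \<gamma> + 1) / (4 * \<gamma>)"
        unfolding g_def[symmetric] by simp
      moreover have "1 + 1 / \<gamma> = (\<gamma> + 1) / \<gamma>" "1 + \<kappa> = (4 * \<gamma> + 1) / (4 * \<gamma>)"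
        using \<gamma> by (simp_all add: \<kappa>_def add_divide_distrib)
      ultimately show ?thesis by simp
    qed
    then show ?thesis unfolding penalty_def l_def[symmetric] by (metis mult.assoc times_divide_eq_left)
  qed
  have q1: "1 \<le> ?q" using \<gamma> by simp
  have "?q ^ d \<le> ?q ^ (card M + 1)" using d q1 by (rule power_increasing)
  also have "\<dots> = ?q * ?q ^ card M" by simp
  also have "?q ^ card M = exp (?k * ln ?q)" using \<gamma> by (simp add: exp_of_nat_mult)
  also have "ln ?q = (ln 2 + ln (1 + \<gamma>)) / 2"
    using \<gamma> ln_mult_pos[of 2 "1 + \<gamma>"] ln_sqrt[of "2 * (1 + \<gamma>)"] by simp
  finally have qd: "?q ^ d \<le> ?q * exp (?k * ((ln 2 + ln (1 + \<gamma>)) / 2))" .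
  have "6 \<le> \<kappa> * c_gamma \<gamma>"
  proof -
    have "0 \<le> (\<gamma> - 3 / 4)\<^sup>2" by simp
    then have "24 * \<gamma> \<le> c_gamma \<gamma>" by (simp add: c_gamma_def power2_eq_square algebra_simps)
    then show ?thesis using \<gamma> by (simp add: \<kappa>_def pos_le_divide_eq)
  qed
  then have "6 * ?k \<le> \<kappa> * c_gamma \<gamma> * ?k" by (rule mult_right_mono) simp
  also have "\<dots> \<le> \<kappa> * l" using l \<kappa> by (simp add: mult.assoc)
  finally have kl: "6 * ?k \<le> \<kappa> * l" .
  have ln2: "?k * ln 2 \<le> ?k * 1" using ln_2_less_1 by (intro mult_left_mono) auto
  have lg: "0 \<le> \<kappa> * (?k / 2 * ln (1 + \<gamma>))" using \<kappa> \<gamma> by simp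
  have expo: "?k * ((ln 2 + ln (1 + \<gamma>)) / 2) - (1 + \<kappa>) * (l + ?k / 2 * ln (1 + \<gamma>)) \<le> - l"
  proof -
    have "?k * ((ln 2 + ln (1 + \<gamma>)) / 2) - (1 + \<kappa>) * (l + ?k / 2 * ln (1 + \<gamma>)) =
       ?k * ln 2 / 2 - l - \<kappa> * l - \<kappa> * (?k / 2 * ln (1 + \<gamma>))"
      by (simp add: field_simps)
    then show ?thesis using kl ln2 lg by simp
  qed
  have "?q ^ d * exp (- ((1 + \<kappa>) * (l + ?k / 2 * ln (1 + \<gamma>)))) \<le>
      ?q * exp (?k * ((ln 2 + ln (1 + \<gamma>)) / 2)) * exp (- ((1 + \<kappa>) * (l + ?k / 2 * ln (1 + \<gamma>))))"
    using qd by (rule mult_right_mono) simp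
  also have "\<dots> = ?q * exp (?k * ((ln 2 + ln (1 + \<gamma>)) / 2) - (1 + \<kappa>) * (l + ?k / 2 * ln (1 + \<gamma>)))"
    by (simp only: mult.assoc exp_add[symmetric] add_uminus_conv_diff)
  also have "\<dots> \<le> ?q * exp (- l)" using expo \<gamma> by (intro mult_left_mono) auto
  also have "exp (- l) = pmf \<pi> (card M) / ?m" using m \<pi> by (simp add: l_def exp_minus)
  finally show ?thesis unfolding pen .
qed

text \<open>
  The prior mass of a size is spread evenly over the models of that size.
\<close>
lemma sum_prior_over_models:
  assumes fin: "finite A" and m: "\<And>M. M \<in> A \<Longrightarrow> num_models A (card M) > 0"
  shows "(\<Sum>M\<in>A. pmf \<pi> (card M) / real (num_models A (card M))) \<le> 1"
proof -
  have "(\<Sum>M\<in>A. pmf \<pi> (card M) / real (num_models A (card M))) =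
      (\<Sum>k\<in>card ` A. \<Sum>M\<in>{M\<in>A. card M = k}. pmf \<pi> (card M) / real (num_models A (card M)))"
    using fin by (rule sum.image_gen)
  also have "\<dots> = (\<Sum>k\<in>card ` A. pmf \<pi> k)"
  proof (rule sum.cong[OF refl])
    fix k assume "k \<in> card ` A"
    then have "num_models A k > 0" using m by auto
    then show "(\<Sum>M\<in>{M\<in>A. card M = k}. pmf \<pi> (card M) / real (num_models A (card M))) = pmf \<pi> k"
      by (simp add: num_models_def)
  qed
  also have "\<dots> = measure (measure_pmf \<pi>) (card ` A)"
    using fin by (simp add: measure_measure_pmf_finite)
  also have "\<dots> \<le> 1" by simp
  finally show ?thesis .
qed

text \<open>
  The oracle inequality bounds the loss by the penalty of \<open>M0\<close> and the excess of a chi-square variable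
  over the penalty of the selected model. As \<open>t \<le> exp t\<close>, the excess is at most a sum of exponentials
  over all models, which removes the dependence on the selection and has expectation controlled by
  the prior masses. The majorant is measurable even when the selection is not.
\<close>
lemma map_risk_bound:
  assumes X: "X \<in> carrier_mat n p" and \<sigma>: "\<sigma> > 0" and A: "\<And>M. M \<in> A \<Longrightarrow> M \<subseteq> {..<p}"
    and ident: "\<And>M. M \<in> A \<Longrightarrow> identifiable X M"
    and pos: "\<gamma> > 0" "\<And>M. M \<in> A \<Longrightarrow> 0 < num_models A (card M) \<and> 0 < pmf \<pi> (card M)"
    and prior: "\<And>M. M \<in> A \<Longrightarrow> card M \<noteq> 0 \<Longrightarrow>
      pmf \<pi> (card M) \<le> real (num_models A (card M)) * exp (- c_gamma \<gamma> * real (card M))"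
    and sel: "is_map_selection X A \<pi> \<sigma> \<gamma> sel"
    and M0: "M0 \<in> A" and b: "b \<in> carrier_vec p" "vec_support b \<subseteq> M0"
    and \<beta>: "X *\<^sub>v \<beta> = X *\<^sub>v b" and pen0: "0 \<le> penalty A \<pi> \<sigma> \<gamma> M0"
  shows "risk X \<sigma> (map_estimator X sel) \<beta> \<le>
    ennreal ((4 * \<gamma> + 2) * (penalty A \<pi> \<sigma> \<gamma> M0 + 8 * sqrt (2 * (1 + \<gamma>)) * \<sigma>\<^sup>2))"
proof -
  \<comment> \<open>With these values \<open>1 / sqrt (1 - 2 * s) = sqrt (2 * (1 + \<gamma>))\<close> and \<open>2 * s * \<theta> * (1 + 1 / \<gamma>) = 1 + 1 / (4 * \<gamma>)\<close>,
      the two quantities that the bound on the damped exponential moment needs.\<close>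
  define \<theta> where "\<theta> = (4 * \<gamma> + 1) / (4 * \<gamma> + 2)"
  define s where "s = (2 * \<gamma> + 1) / (4 * (\<gamma> + 1))"
  define q where "q = sqrt (2 * (1 + \<gamma>))"
  have \<theta>: "\<theta> > 0" "1 - \<theta> = 1 / (4 * \<gamma> + 2)" using pos(1) by (simp_all add: \<theta>_def field_simps)
  have s: "0 < s" "2 * s < 1" using pos(1) by (simp_all add: s_def field_simps)
  have q_s: "1 / sqrt (1 - 2 * s) = q"
  proof -
    have "1 - 2 * s = 1 / (2 * (1 + \<gamma>))" using pos(1) by (simp add: s_def field_simps)
    then show ?thesis by (simp add: q_def real_sqrt_divide)
  qed
  have s\<theta>: "s * \<theta> = (4 * \<gamma> + 1) / (8 * (\<gamma> + 1))"
  proof -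
    have "4 * \<gamma> + 2 = 2 * (2 * \<gamma> + 1)" by simp
    then show ?thesis using pos(1) by (simp add: s_def \<theta>_def divide_simps) (simp add: algebra_simps)
  qed
  have s\<theta>_pos: "0 < s * \<theta>" using s \<theta> by simp
  have s\<theta>_ge: "1 \<le> 8 * (s * \<theta>)" unfolding s\<theta> using pos(1) by (simp add: field_simps)
  have finA: "finite A" by (rule finite_subset[of _ "Pow {..<p}"]) (use A in auto)
  define \<mu> where "\<mu> = X *\<^sub>v b"
  have \<mu>: "\<mu> \<in> carrier_vec n" using X b by (simp add: \<mu>_def)
  have "\<forall>M\<in>A. \<exists>d u. d \<le> card M + 1 \<and> orthonormal n d u \<and>
      covers_span n d u (insert p M) (\<lambda>j i. if j = p then \<mu> $ i else X $$ (i, j))"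
  proof
    fix M assume "M \<in> A"
    then have "finite M" "p \<notin> M" using A finite_subset by auto
    then show "\<exists>d u. d \<le> card M + 1 \<and> orthonormal n d u \<and>
      covers_span n d u (insert p M) (\<lambda>j i. if j = p then \<mu> $ i else X $$ (i, j))"
      using exists_orthonormal_covers_span[of "insert p M" n "\<lambda>j i. if j = p then \<mu> $ i else X $$ (i, j)"] by simp
  qed
  then obtain D U where DU: "\<And>M. M \<in> A \<Longrightarrow> D M \<le> card M + 1 \<and> orthonormal n (D M) (U M) \<and>
      covers_span n (D M) (U M) (insert p M) (\<lambda>j i. if j = p then \<mu> $ i else X $$ (i, j))"
    unfolding bchoice_iff by blast
  define Q where "Q M z = (\<Sum>a<D M. (dot n (U M a) z)\<^sup>2)" for M z
  define W where "W z = (\<Sum>M\<in>A. exp (s * Q M z / \<sigma>\<^sup>2) * exp (- (s * \<theta> * penalty A \<pi> \<sigma> \<gamma> M / \<sigma>\<^sup>2)))" for z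
  define P0 where "P0 = penalty A \<pi> \<sigma> \<gamma> M0"
  let ?major = "\<lambda>z. (4 * \<gamma> + 2) * (P0 + 8 * \<sigma>\<^sup>2 * W z)"
  have W_nonneg: "0 \<le> W z" for z unfolding W_def by (intro sum_nonneg) simp
  have bound: "sqnorm (map_estimator X sel (X *\<^sub>v \<beta> + \<epsilon>) - X *\<^sub>v \<beta>) \<le> ?major (($) \<epsilon>)"
    if \<epsilon>: "\<epsilon> \<in> carrier_vec n" for \<epsilon>
  proof -
    define M where "M = sel (X *\<^sub>v b + \<epsilon>)"
    have "is_arg_min (map_criterion X A \<pi> \<sigma> \<gamma> (X *\<^sub>v b + \<epsilon>)) (\<lambda>M. M \<in> A) M"
      using sel \<mu> \<epsilon> X by (auto simp: is_map_selection_def M_def \<mu>_def)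
    then have MA: "M \<in> A" by (simp add: is_arg_min_def)
    have "(1 - \<theta>) * sqnorm (map_estimator X sel (X *\<^sub>v b + \<epsilon>) - X *\<^sub>v b) \<le> P0 +
      (Q M (($) \<epsilon>) / \<theta> - penalty A \<pi> \<sigma> \<gamma> M)"
      unfolding P0_def Q_def M_def
      by (rule map_oracle_inequality[OF X A ident pos sel M0 b \<epsilon> \<theta>(1)])
         (use DU[OF MA, unfolded M_def \<mu>_def] in simp_all)
    also have "Q M (($) \<epsilon>) / \<theta> - penalty A \<pi> \<sigma> \<gamma> M =
        (s * Q M (($) \<epsilon>) / \<sigma>\<^sup>2 - s * \<theta> * penalty A \<pi> \<sigma> \<gamma> M / \<sigma>\<^sup>2) * (\<sigma>\<^sup>2 / (s * \<theta>))"
      using s \<theta> \<sigma> by (simp add: field_simps)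
    also have "\<dots> \<le> exp (s * Q M (($) \<epsilon>) / \<sigma>\<^sup>2 - s * \<theta> * penalty A \<pi> \<sigma> \<gamma> M / \<sigma>\<^sup>2) * (\<sigma>\<^sup>2 / (s * \<theta>))"
    proof (rule mult_right_mono)
      show "t \<le> exp t" for t :: real using exp_ge_add_one_self[of t] by linarith
    qed (use s\<theta>_pos in simp)
    also have "\<dots> \<le> W (($) \<epsilon>) * (8 * \<sigma>\<^sup>2)"
    proof (rule mult_mono)
      have "exp (s * Q M (($) \<epsilon>) / \<sigma>\<^sup>2) * exp (- (s * \<theta> * penalty A \<pi> \<sigma> \<gamma> M / \<sigma>\<^sup>2)) \<le> W (($) \<epsilon>)"
        unfolding W_def by (rule member_le_sum[OF MA]) (use finA in auto)
      then show "exp (s * Q M (($) \<epsilon>) / \<sigma>\<^sup>2 - s * \<theta> * penalty A \<pi> \<sigma> \<gamma> M / \<sigma>\<^sup>2) \<le> W (($) \<epsilon>)"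
        by (simp only: exp_add[symmetric] add_uminus_conv_diff)
      have "\<sigma>\<^sup>2 * 1 \<le> \<sigma>\<^sup>2 * (8 * (s * \<theta>))" using s\<theta>_ge by (intro mult_left_mono) auto
      then show "\<sigma>\<^sup>2 / (s * \<theta>) \<le> 8 * \<sigma>\<^sup>2"
        using s\<theta>_pos by (simp add: pos_divide_le_eq mult_ac)
    qed (use W_nonneg s\<theta>_pos in auto)
    finally have "sqnorm (map_estimator X sel (X *\<^sub>v b + \<epsilon>) - X *\<^sub>v b) / (4 * \<gamma> + 2) \<le> P0 + 8 * \<sigma>\<^sup>2 * W (($) \<epsilon>)"
      by (simp add: \<theta>(2) mult.commute)
    then show ?thesis using pos(1) by (simp add: \<beta> pos_divide_le_eq mult.commute)
  qed
  have Wm: "(\<lambda>z. ennreal (W z)) \<in> borel_measurable (\<Pi>\<^sub>M i\<in>{..<n}. (borel :: real measure))"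
    unfolding W_def Q_def by measurable
  have nthm: "(\<lambda>\<epsilon>. dot n w (($) \<epsilon>)) \<in> borel_measurable (borel_vec n)" for w
    unfolding dot_def by measurable
  have Wm': "(\<lambda>\<epsilon>. ennreal (?major (($) \<epsilon>))) \<in> borel_measurable (borel_vec n)"
    unfolding W_def Q_def using nthm by measurable
  interpret P: prob_space "normal_prod n \<sigma>" by (rule prob_space_normal_prod[OF \<sigma>])
  have "risk X \<sigma> (map_estimator X sel) \<beta> \<le> (\<integral>\<^sup>+ \<epsilon>. ennreal (?major (($) \<epsilon>)) \<partial>gaussian_noise n \<sigma>)"
    unfolding risk_def using X
    by (auto intro!: nn_integral_mono ennreal_leI bound simp: gaussian_noise_def)
  also have "\<dots> = (\<integral>\<^sup>+ z. ennreal (?major (($) (vec n z))) \<partial>normal_prod n \<sigma>)"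
    by (rule nn_integral_gaussian_noise[OF Wm'])
  also have "\<dots> = (\<integral>\<^sup>+ z. ennreal ((4 * \<gamma> + 2) * P0) + ennreal ((4 * \<gamma> + 2) * (8 * \<sigma>\<^sup>2)) * ennreal (W z) \<partial>normal_prod n \<sigma>)"
  proof (rule nn_integral_cong)
    fix z
    have "dot n w (($) (vec n z)) = dot n w z" for w by (simp add: dot_def)
    then have "W (($) (vec n z)) = W z" by (simp add: W_def Q_def)
    then show "ennreal (?major (($) (vec n z))) =
        ennreal ((4 * \<gamma> + 2) * P0) + ennreal ((4 * \<gamma> + 2) * (8 * \<sigma>\<^sup>2)) * ennreal (W z)"
      using pos(1) pen0 W_nonneg[of z]
      by (simp add: P0_def ennreal_mult[symmetric] ennreal_plus[symmetric] distrib_left mult.assoc del: ennreal_plus)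
  qed
  also have "\<dots> = ennreal ((4 * \<gamma> + 2) * P0) + ennreal ((4 * \<gamma> + 2) * (8 * \<sigma>\<^sup>2)) * (\<integral>\<^sup>+ z. ennreal (W z) \<partial>normal_prod n \<sigma>)"
    using Wm P.emeasure_space_1 by (simp add: nn_integral_add nn_integral_cmult)
  also have "(\<integral>\<^sup>+ z. ennreal (W z) \<partial>normal_prod n \<sigma>) \<le> ennreal q"
  proof -
    have "(\<integral>\<^sup>+ z. ennreal (W z) \<partial>normal_prod n \<sigma>) =
      (\<integral>\<^sup>+ z. (\<Sum>M\<in>A. ennreal (exp (- (s * \<theta> * penalty A \<pi> \<sigma> \<gamma> M / \<sigma>\<^sup>2))) * ennreal (exp (s * Q M z / \<sigma>\<^sup>2))) \<partial>normal_prod n \<sigma>)"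
      unfolding W_def by (intro nn_integral_cong) (simp add: sum_ennreal ennreal_mult[symmetric] mult.commute)
    also have "\<dots> = (\<Sum>M\<in>A. ennreal (exp (- (s * \<theta> * penalty A \<pi> \<sigma> \<gamma> M / \<sigma>\<^sup>2))) * (\<integral>\<^sup>+ z. ennreal (exp (s * Q M z / \<sigma>\<^sup>2)) \<partial>normal_prod n \<sigma>))"
      unfolding Q_def by (subst nn_integral_sum) (auto simp: nn_integral_cmult)
    also have "\<dots> \<le> (\<Sum>M\<in>A. ennreal (q * (pmf \<pi> (card M) / real (num_models A (card M)))))"
    proof (rule sum_mono)
      fix M assume M: "M \<in> A"
      have on: "orthonormal n (D M) (U M)" and d: "D M \<le> card M + 1" using DU[OF M] by auto
      have "(\<integral>\<^sup>+ z. ennreal (exp (s * Q M z / \<sigma>\<^sup>2)) \<partial>normal_prod n \<sigma>) = ennreal (q ^ D M)"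
        unfolding Q_def using nn_integral_exp_chi_square[OF \<sigma> _ s(2) on] s(1) q_s by simp
      moreover have "q ^ D M * exp (- (s * \<theta> * penalty A \<pi> \<sigma> \<gamma> M / \<sigma>\<^sup>2)) \<le>
          q * (pmf \<pi> (card M) / real (num_models A (card M)))"
        unfolding q_def s\<theta> using pos(2)[OF M] prior[OF M] d
        by (intro penalised_exponential_moment[OF pos(1) \<sigma>]) auto
      ultimately show "ennreal (exp (- (s * \<theta> * penalty A \<pi> \<sigma> \<gamma> M / \<sigma>\<^sup>2))) * (\<integral>\<^sup>+ z. ennreal (exp (s * Q M z / \<sigma>\<^sup>2)) \<partial>normal_prod n \<sigma>)
          \<le> ennreal (q * (pmf \<pi> (card M) / real (num_models A (card M))))"
        using pos(1) by (simp add: ennreal_mult[symmetric] q_def ennreal_leI mult.commute)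
    qed
    also have "\<dots> = ennreal (q * (\<Sum>M\<in>A. pmf \<pi> (card M) / real (num_models A (card M))))"
      using pos(1) by (subst sum_ennreal) (auto simp: q_def sum_distrib_left)
    also have "\<dots> \<le> ennreal (q * 1)"
      using sum_prior_over_models[OF finA, of \<pi>] pos by (intro ennreal_leI mult_left_mono) (auto simp: q_def)
    finally show ?thesis by simp
  qed
  also have "ennreal ((4 * \<gamma> + 2) * P0) + ennreal ((4 * \<gamma> + 2) * (8 * \<sigma>\<^sup>2)) * ennreal q =
      ennreal ((4 * \<gamma> + 2) * (P0 + 8 * q * \<sigma>\<^sup>2))"
    using pos(1) pen0 by (simp add: P0_def q_def ennreal_mult[symmetric] ennreal_plus[symmetric] algebra_simps del: ennreal_plus)
  finally show ?thesis by (simp add: P0_def q_def add_left_mono mult_left_mono)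
qed

text \<open>
  On the logarithmic scale the lower bound on the prior reads \<open>- ln \<pi>(k) \<le> c max (k, ln m(k))\<close>.
\<close>
lemma penalty_bounds:
  assumes \<gamma>: "\<gamma> > 0" and c: "c > 0" and m: "num_models A (card M) > 0" and \<pi>: "pmf \<pi> (card M) > 0"
    and low: "min (real (num_models A (card M)) powr (- c)) (exp (- c * real (card M))) \<le> pmf \<pi> (card M)"
  shows "0 \<le> penalty A \<pi> \<sigma> \<gamma> M"
    and "penalty A \<pi> \<sigma> \<gamma> M \<le> 2 * (1 + 1 / \<gamma>) * (1 + c + \<gamma>) * \<sigma>\<^sup>2 * (real (card M) + ln (real (num_models A (card M))))"
proof -
  let ?k = "real (card M)" and ?m = "real (num_models A (card M))" and ?\<pi> = "pmf \<pi> (card M)"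
  define G where "G = ln (?m / ?\<pi>) + ?k / 2 * ln (1 + \<gamma>)"
  have m1: "1 \<le> ?m" using m by simp
  have lnm: "0 \<le> ln ?m" using m1 by simp
  have ln\<pi>: "ln (?m / ?\<pi>) = ln ?m - ln ?\<pi>" using m \<pi> by (simp add: ln_div)
  have "ln ?\<pi> \<le> 0" using \<pi> pmf_le_1[of \<pi> "card M"] by simp
  then have "0 \<le> G" unfolding G_def ln\<pi> using lnm \<gamma> by simp
  moreover have pen: "penalty A \<pi> \<sigma> \<gamma> M = 2 * \<sigma>\<^sup>2 * (1 + 1 / \<gamma>) * G" by (simp add: penalty_def G_def)
  ultimately show "0 \<le> penalty A \<pi> \<sigma> \<gamma> M" using \<gamma> by simp
  have "- ln ?\<pi> \<le> c * (?k + ln ?m)"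
  proof (cases "?m powr (- c) \<le> exp (- c * ?k)")
    case True
    then have "exp (- c * ln ?m) \<le> ?\<pi>" using low m by (simp add: powr_def)
    then have "- c * ln ?m \<le> ln ?\<pi>" using \<pi> by (simp add: ln_ge_iff)
    moreover have "0 \<le> c * ?k" using c by simp
    ultimately show ?thesis by (simp add: algebra_simps)
  next
    case False
    then have "exp (- c * ?k) \<le> ?\<pi>" using low by simp
    then have "- c * ?k \<le> ln ?\<pi>" using \<pi> by (simp add: ln_ge_iff)
    moreover have "0 \<le> c * ln ?m" using c lnm by simp
    ultimately show ?thesis by (simp add: algebra_simps)
  qed
  moreover have "?k / 2 * ln (1 + \<gamma>) \<le> \<gamma> * ?k"
  proof -
    have "ln (1 + \<gamma>) \<le> \<gamma>" using \<gamma> by (intro ln_add_one_self_le_self) auto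
    then have "?k / 2 * ln (1 + \<gamma>) \<le> ?k / 2 * \<gamma>" by (rule mult_left_mono) simp
    also have "\<dots> \<le> \<gamma> * ?k" using \<gamma> by simp
    finally show ?thesis .
  qed
  moreover have "0 \<le> \<gamma> * ln ?m" using \<gamma> lnm by simp
  ultimately have "G \<le> (1 + c + \<gamma>) * (?k + ln ?m)"
    unfolding G_def ln\<pi> by (simp add: algebra_simps)
  then have "2 * \<sigma>\<^sup>2 * (1 + 1 / \<gamma>) * G \<le> 2 * \<sigma>\<^sup>2 * (1 + 1 / \<gamma>) * ((1 + c + \<gamma>) * (?k + ln ?m))"
    using \<gamma> by (intro mult_left_mono) auto
  then show "penalty A \<pi> \<sigma> \<gamma> M \<le> 2 * (1 + 1 / \<gamma>) * (1 + c + \<gamma>) * \<sigma>\<^sup>2 * (?k + ln ?m)"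
    unfolding pen by (simp only: mult_ac)
qed

section \<open>Rate optimality of the MAP estimator\<close>

theorem corollary2:
  fixes p :: "nat \<Rightarrow> nat"
    and X :: "nat \<Rightarrow> real mat"
    and A :: "nat \<Rightarrow> nat set set"
    and \<pi> :: "nat \<Rightarrow> nat pmf"
    and sel :: "nat \<Rightarrow> real vec \<Rightarrow> nat set"
    and \<sigma> \<gamma> c :: real
  assumes "\<sigma> > 0" and "\<gamma> > 0" and "c > 0"
    and "\<And>n. X n \<in> carrier_mat n (p n)"
    and "filterlim (\<lambda>n. mat_rank (X n)) at_top sequentially"
    and "\<And>n S. S \<subseteq> {..<p n} \<Longrightarrow> card S = mat_rank (X n) \<Longrightarrow> indep_columns (X n) S"
    and "nearly_orthogonal X"
    and "\<And>n. admissible_models (X n) (A n)"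
    and "\<And>n. size_prior (X n) (A n) (\<pi> n)"
    and "\<And>n k. k \<in> {1..mat_rank (X n)} \<Longrightarrow> num_models (A n) k > 0 \<Longrightarrow>
           min (real (num_models (A n) k) powr (- c)) (exp (- c * real k)) \<le> pmf (\<pi> n) k \<and>
           pmf (\<pi> n) k \<le> real (num_models (A n) k) * exp (- c_gamma \<gamma> * real k)"
    and "\<And>n. is_map_selection (X n) (A n) (\<pi> n) \<sigma> \<gamma> (sel n)"
  shows "\<exists>C>0. \<exists>r\<^sub>0. \<forall>n. r\<^sub>0 \<le> mat_rank (X n) \<longrightarrow>
    (\<forall>p\<^sub>0\<in>{1..mat_rank (X n)}. models_upto (A n) p\<^sub>0 \<noteq> {{}} \<longrightarrow>
       max_risk (X n) \<sigma> (models_upto (A n) p\<^sub>0) (map_estimator (X n) (sel n))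
       \<le> ennreal (C * max 1 (ln (real p\<^sub>0))) *
           minimax_risk (X n) \<sigma> (models_upto (A n) p\<^sub>0))"
proof -
  obtain \<delta> where \<delta>: "\<delta> > 0" and ratio: "\<And>n. 1 \<le> mat_rank (X n) \<Longrightarrow> \<delta> \<le> sparse_ratio (X n) (mat_rank (X n))"
    using assms(7) unfolding nearly_orthogonal_def by blast
  define K where "K = (4 * \<gamma> + 2) * (2 * (1 + 1 / \<gamma>) * (1 + c + \<gamma>) + 8 * sqrt (2 * (1 + \<gamma>)))"
  have K: "K > 0" unfolding K_def using assms(2,3) by (intro mult_pos_pos add_pos_pos) auto
  \<comment> \<open>The lower bounds below lose the factors \<open>2560\<close> and \<open>2048\<close>; the latter is doubled because it is used
      with \<open>r \<le> 2 * card M\<close>.\<close>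
  define C where "C = 4096 * K / \<delta>"
  have C: "C > 0" using K \<delta> by (simp add: C_def)
  have "max_risk (X n) \<sigma> (models_upto (A n) p\<^sub>0) (map_estimator (X n) (sel n))
       \<le> ennreal (C * max 1 (ln (real p\<^sub>0))) * minimax_risk (X n) \<sigma> (models_upto (A n) p\<^sub>0)"
    if p0: "p\<^sub>0 \<in> {1..mat_rank (X n)}" and ne: "models_upto (A n) p\<^sub>0 \<noteq> {{}}" for n p\<^sub>0
  proof -
    define r where "r = mat_rank (X n)"
    define H where "H = max 1 (ln (real p\<^sub>0))"
    let ?R = "minimax_risk (X n) \<sigma> (models_upto (A n) p\<^sub>0)"
    have H: "1 \<le> H" by (simp add: H_def)
    have r: "1 \<le> r" "p\<^sub>0 \<le> r" using p0 by (auto simp: r_def)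
    note Xc = assms(4)[of n]
    have dims: "dim_col (X n) = p n" "dim_row (X n) = n" using Xc by auto
    have A: "M \<subseteq> {..<p n}" "card M \<le> r" if "M \<in> A n" for M
      using assms(8)[of n] that by (auto simp: admissible_models_def dims r_def)
    have finM: "finite M" if "M \<in> A n" for M using A(1)[OF that] finite_subset by blast
    have finA: "finite (A n)" by (rule finite_subset[of _ "Pow {..<p n}"]) (use A in auto)
    have m: "0 < num_models (A n) (card M)" if "M \<in> A n" for M
      unfolding num_models_def using that finA by (subst card_gt_0_iff) auto
    have \<pi>: "0 < pmf (\<pi> n) (card M)" if "M \<in> A n" for M
    proof -
      have "pmf (\<pi> n) (card M) \<noteq> 0"
        using assms(9)[of n] m[OF that] A(2)[OF that] by (auto simp: size_prior_def r_def)
      then show ?thesis using pmf_nonneg[of "\<pi> n" "card M"] by linarith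
    qed
    have prior: "min (real (num_models (A n) (card M)) powr (- c)) (exp (- c * real (card M))) \<le> pmf (\<pi> n) (card M)"
      "pmf (\<pi> n) (card M) \<le> real (num_models (A n) (card M)) * exp (- c_gamma \<gamma> * real (card M))"
      if "M \<in> A n" "card M \<noteq> 0" for M
      using assms(10)[of "card M" n] m[OF that(1)] A(2)[OF that(1)] that(2) by (auto simp: r_def)
    have rank_le: "r \<le> p n"
      unfolding r_def mat_rank_def dims using vec_space.rank_le_nc[OF Xc] .
    have phi: "0 < phi_max (X n) r" "\<delta> * phi_max (X n) r \<le> phi_min (X n) r"
      using sparse_ratio_bound[OF Xc r(1) _ \<delta>] ratio[of n] r rank_le by (auto simp: r_def)
    have phi_min: "0 < phi_min (X n) r" using phi \<delta> by (meson less_le_trans mult_pos_pos)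
    have ident: "identifiable (X n) M" if "M \<in> A n" for M
      by (rule identifiable_of_phi_min[OF Xc phi_min finM[OF that] A(2)[OF that]])
    \<comment> \<open>For a comparison model of positive size the constant remainder in the risk bound is absorbed by the rate.\<close>
    have upper: "risk (X n) \<sigma> (map_estimator (X n) (sel n)) \<beta> \<le>
        ennreal (K * \<sigma>\<^sup>2 * (real (card M) + ln (real (num_models (A n) (card M)))))"
      if M: "M \<in> A n" "card M \<noteq> 0" and b: "b \<in> carrier_vec (p n)" "vec_support b \<subseteq> M" "X n *\<^sub>v \<beta> = X n *\<^sub>v b"
      for M b \<beta>
    proof -
      let ?s = "real (card M) + ln (real (num_models (A n) (card M)))"
      note pb = penalty_bounds[OF assms(2,3) m[OF M(1)] \<pi>[OF M(1)] prior(1)[OF M], of \<sigma>]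
      have "risk (X n) \<sigma> (map_estimator (X n) (sel n)) \<beta> \<le>
          ennreal ((4 * \<gamma> + 2) * (penalty (A n) (\<pi> n) \<sigma> \<gamma> M + 8 * sqrt (2 * (1 + \<gamma>)) * \<sigma>\<^sup>2))"
        by (rule map_risk_bound[OF Xc assms(1) A(1) ident assms(2) _ prior(2) assms(11) M(1) b pb(1)])
           (use m \<pi> in auto)
      also have "\<dots> \<le> ennreal (K * \<sigma>\<^sup>2 * ?s)"
      proof (rule ennreal_leI)
        have "1 \<le> real (card M)" using M(2) by simp
        moreover have "0 \<le> ln (real (num_models (A n) (card M)))" using m[OF M(1)] by simp
        ultimately have "1 \<le> ?s" by linarith
        then have "8 * sqrt (2 * (1 + \<gamma>)) * \<sigma>\<^sup>2 * 1 \<le> 8 * sqrt (2 * (1 + \<gamma>)) * \<sigma>\<^sup>2 * ?s"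
          using assms(2) by (intro mult_left_mono) auto
        then have "penalty (A n) (\<pi> n) \<sigma> \<gamma> M + 8 * sqrt (2 * (1 + \<gamma>)) * \<sigma>\<^sup>2 \<le>
            2 * (1 + 1 / \<gamma>) * (1 + c + \<gamma>) * \<sigma>\<^sup>2 * ?s + 8 * sqrt (2 * (1 + \<gamma>)) * \<sigma>\<^sup>2 * ?s"
          using pb(2) by linarith
        then have "(4 * \<gamma> + 2) * (penalty (A n) (\<pi> n) \<sigma> \<gamma> M + 8 * sqrt (2 * (1 + \<gamma>)) * \<sigma>\<^sup>2) \<le>
            (4 * \<gamma> + 2) * (2 * (1 + 1 / \<gamma>) * (1 + c + \<gamma>) * \<sigma>\<^sup>2 * ?s + 8 * sqrt (2 * (1 + \<gamma>)) * \<sigma>\<^sup>2 * ?s)"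
          using assms(2) by (intro mult_left_mono) auto
        also have "\<dots> = K * \<sigma>\<^sup>2 * ?s" by (simp add: K_def distrib_left distrib_right mult_ac)
        finally show "(4 * \<gamma> + 2) * (penalty (A n) (\<pi> n) \<sigma> \<gamma> M + 8 * sqrt (2 * (1 + \<gamma>)) * \<sigma>\<^sup>2) \<le> K * \<sigma>\<^sup>2 * ?s" .
      qed
      finally show ?thesis .
    qed
    show ?thesis
      unfolding max_risk_def H_def[symmetric]
    proof (rule SUP_least)
      fix \<beta> assume "\<beta> \<in> model_coeffs (X n) (models_upto (A n) p\<^sub>0)"
      then have \<beta>: "\<beta> \<in> carrier_vec (p n)" "vec_support \<beta> \<in> models_upto (A n) p\<^sub>0"
        by (auto simp: model_coeffs_def dims)
      \<comment> \<open>The rate vanishes for the null model, so the zero vector is compared with a nonempty model.\<close>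
      have "{} \<in> models_upto (A n) p\<^sub>0"
        using assms(8)[of n] by (auto simp: admissible_models_def models_upto_def)
      then obtain N where N: "N \<in> models_upto (A n) p\<^sub>0" "N \<noteq> {}" using ne by blast
      define M where "M = (if vec_support \<beta> = {} then N else vec_support \<beta>)"
      have M: "M \<in> A n" "card M \<le> p\<^sub>0" "vec_support \<beta> \<subseteq> M" "M \<noteq> {}"
        using \<beta>(2) N by (auto simp: M_def models_upto_def)
      have k: "card M \<noteq> 0" using M(1,4) finM by simp
      show "risk (X n) \<sigma> (map_estimator (X n) (sel n)) \<beta> \<le> ennreal (C * H) * ?R"
      proof (cases "2 * card M \<le> r")
        case True
        let ?s = "real (card M) + ln (real (num_models (A n) (card M)))"
        have s: "0 \<le> ?s" using m[OF M(1)] by simp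
        have "risk (X n) \<sigma> (map_estimator (X n) (sel n)) \<beta> \<le> ennreal (K * \<sigma>\<^sup>2 * ?s)"
          by (rule upper[OF M(1) k \<beta>(1) M(3) refl])
        also have "K * \<sigma>\<^sup>2 * ?s \<le> C * H * (\<delta> * \<sigma>\<^sup>2 * ?s / (2560 * H))"
        proof -
          have "C * H * (\<delta> * \<sigma>\<^sup>2 * ?s / (2560 * H)) = 4096 / 2560 * (K * \<sigma>\<^sup>2 * ?s)"
            using H \<delta> by (simp add: C_def)
          moreover have "0 \<le> K * \<sigma>\<^sup>2 * ?s" using K s by simp
          ultimately show ?thesis by linarith
        qed
        then have "ennreal (K * \<sigma>\<^sup>2 * ?s) \<le> ennreal (C * H) * ennreal (\<delta> * \<sigma>\<^sup>2 * ?s / (2560 * H))"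
          using C H \<delta> s by (subst ennreal_mult[symmetric]) (auto intro: ennreal_leI)
        also have "\<dots> \<le> ennreal (C * H) * ?R"
          unfolding H_def
          by (rule mult_left_mono[OF minimax_risk_lower_bound[OF Xc assms(1) \<delta> phi A(1) M(1) _ M(2) True]])
             (use k in auto)
        finally show ?thesis .
      next
        case False
        have "num_models (A n) r = 1" using assms(8)[of n] by (simp add: admissible_models_def r_def)
        then obtain S where "{M \<in> A n. card M = r} = {S}"
          unfolding num_models_def by (auto simp: card_1_singleton_iff)
        then have S: "S \<in> A n" "card S = r" by auto
        have mS: "num_models (A n) (card S) = 1" using S(2) \<open>num_models (A n) r = 1\<close> by simp
        obtain w where w: "w \<in> carrier_vec (p n)" "vec_support w \<subseteq> S" "X n *\<^sub>v w = X n *\<^sub>v \<beta>"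
          using range_eq_independent_columns[OF Xc A(1)[OF S(1)] _ _ \<beta>(1)] assms(6)[OF A(1)[OF S(1)]] S(2)
          by (auto simp: r_def)
        have "risk (X n) \<sigma> (map_estimator (X n) (sel n)) \<beta> \<le> ennreal (K * \<sigma>\<^sup>2 * (real (card S) + ln (real (num_models (A n) (card S)))))"
          by (rule upper[OF S(1) _ w(1,2) w(3)[symmetric]]) (use S(2) r(1) in simp)
        also have "real (card S) + ln (real (num_models (A n) (card S))) = real r" using mS by (simp add: S(2))
        also have "ennreal (K * \<sigma>\<^sup>2 * real r) \<le> ennreal (C * H * (\<delta> * \<sigma>\<^sup>2 * real (card M) / 2048))"
        proof (rule ennreal_leI)
          have "real r \<le> 2 * real (card M)" using False by simp
          then have "K * \<sigma>\<^sup>2 * real r * 1 \<le> K * \<sigma>\<^sup>2 * (2 * real (card M)) * H"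
            using K H by (intro mult_mono) auto
          also have "\<dots> = C * H * (\<delta> * \<sigma>\<^sup>2 * real (card M) / 2048)"
            using \<delta> by (simp add: C_def)
          finally show "K * \<sigma>\<^sup>2 * real r \<le> C * H * (\<delta> * \<sigma>\<^sup>2 * real (card M) / 2048)" by simp
        qed
        also have "\<dots> = ennreal (C * H) * ennreal (\<delta> * \<sigma>\<^sup>2 * real (card M) / 2048)"
          using C H \<delta> by (intro ennreal_mult) auto
        also have "\<dots> \<le> ennreal (C * H) * ?R"
          by (rule mult_left_mono[OF minimax_risk_ge_dimension[OF Xc assms(1) \<delta> phi _ A(1)[OF M(1)] _ A(2)[OF M(1)]]])
             (use M k in \<open>auto simp: models_upto_def\<close>)
        finally show ?thesis .
      qed
    qed
  qed
  then show ?thesis using C by blast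
qed

end
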